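(* Let $X$ be an infinite-dimensional complex Banach space such that $\mathcal{F}(X^* )$ is amenable. Then $\mathcal{F}(X)$ is amenable.
   Context: For a Banach space $Z$, $\mathcal{F}(Z)$ is the Banach algebra of approximable operators on $Z$: the operator-norm closure in $\mathcal{B}(Z)$ of the finite rank operators. A Banach algebra $\mathcal{A}$ is amenable if for every Banach $\mathcal{A}$-bimodule $Z$, every continuous derivation $D:\mathcal{A}\to Z^*$ is inner, i.e. of the form $a\mapsto a\cdot z^*-z^*\cdot a$ for some $z^*\in Z^*$. Here $Z^*$ carries the dual module actions $\langle a\cdot z^*,z\rangle=\langle z^*,z\cdot a\rangle$, $\langle z^*\cdot a,z\rangle=\langle z^*,a\cdot z\rangle$, and a derivation is a linear map with $D(ab)=a\cdot D(b)+D(a)\cdot b$. *)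

theory Defs
  imports "HOL-Analysis.Analysis" "HOL-Algebra.Module"
begin

section \<open>Complex Banach spaces as a type class\<close>

class scaleC =
  fixes scaleC :: "complex \<Rightarrow> 'a \<Rightarrow> 'a" (infixr "*\<^sub>C" 75)

class complex_banach = banach + scaleC +
  assumes scaleC_add_right: "c *\<^sub>C (x + y) = c *\<^sub>C x + c *\<^sub>C y"
    and scaleC_add_left: "(c + d) *\<^sub>C x = c *\<^sub>C x + d *\<^sub>C x"
    and scaleC_scaleC: "c *\<^sub>C (d *\<^sub>C x) = (c * d) *\<^sub>C x"
    and scaleC_of_real: "complex_of_real r *\<^sub>C x = r *\<^sub>R x"
    and norm_scaleC: "norm (c *\<^sub>C x) = cmod c * norm x"

global_interpretation complex_vector: vector_space "scaleC :: complex \<Rightarrow> 'a \<Rightarrow> 'a::complex_banach"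
proof
  fix x :: 'a
  show "1 *\<^sub>C x = x"
    using scaleC_of_real[of 1 x] by simp
qed (simp_all add: scaleC_add_right scaleC_add_left scaleC_scaleC)

lemma bounded_linear_scaleC: "bounded_linear (\<lambda>x::'a::complex_banach. c *\<^sub>C x)"
proof (rule bounded_linear_intro)
  fix r and x :: 'a
  show "c *\<^sub>C (r *\<^sub>R x) = r *\<^sub>R (c *\<^sub>C x)"
    by (simp add: scaleC_of_real[symmetric] scaleC_scaleC mult.commute)
  show "norm (c *\<^sub>C x) \<le> norm x * cmod c"
    by (simp add: norm_scaleC)
qed (rule scaleC_add_right)

instantiation complex :: complex_banach
begin

definition scaleC_complex :: "complex \<Rightarrow> complex \<Rightarrow> complex"
  where "scaleC_complex c z = c * z"

instance
  by standard (simp_all add: scaleC_complex_def algebra_simps norm_mult scaleR_conv_of_real)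

end

section \<open>Bounded complex-linear operators\<close>

typedef (overloaded) ('a, 'b) cblinfun =
  "{T :: 'a::complex_banach \<Rightarrow>\<^sub>L 'b::complex_banach. \<forall>c x. blinfun_apply T (c *\<^sub>C x) = c *\<^sub>C blinfun_apply T x}"
  morphisms blinfun_of_cblinfun Abs_cblinfun
  by (rule exI[of _ 0]) simp

setup_lifting type_definition_cblinfun

lift_definition capply :: "('a::complex_banach, 'b::complex_banach) cblinfun \<Rightarrow> 'a \<Rightarrow> 'b"
  is blinfun_apply .

instantiation cblinfun :: (complex_banach, complex_banach) real_normed_vector
begin

lift_definition norm_cblinfun :: "('a, 'b) cblinfun \<Rightarrow> real" is norm .

lift_definition zero_cblinfun :: "('a, 'b) cblinfun" is 0
  by simp

lift_definition plus_cblinfun :: "('a, 'b) cblinfun \<Rightarrow> ('a, 'b) cblinfun \<Rightarrow> ('a, 'b) cblinfun"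
  is "(+)"
  by (simp add: blinfun.bilinear_simps scaleC_add_right)

lift_definition minus_cblinfun :: "('a, 'b) cblinfun \<Rightarrow> ('a, 'b) cblinfun \<Rightarrow> ('a, 'b) cblinfun"
  is "(-)"
  by (simp add: blinfun.bilinear_simps complex_vector.scale_right_diff_distrib)

lift_definition uminus_cblinfun :: "('a, 'b) cblinfun \<Rightarrow> ('a, 'b) cblinfun" is uminus
  by (simp add: blinfun.bilinear_simps)

lift_definition scaleR_cblinfun :: "real \<Rightarrow> ('a, 'b) cblinfun \<Rightarrow> ('a, 'b) cblinfun" is scaleR
  by (simp add: blinfun.bilinear_simps linear_simps(5)[OF bounded_linear_scaleC])

definition dist_cblinfun :: "('a, 'b) cblinfun \<Rightarrow> ('a, 'b) cblinfun \<Rightarrow> real"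
  where "dist_cblinfun S T = norm (S - T)"

definition sgn_cblinfun :: "('a, 'b) cblinfun \<Rightarrow> ('a, 'b) cblinfun"
  where "sgn_cblinfun T = scaleR (inverse (norm T)) T"

definition uniformity_cblinfun :: "(('a, 'b) cblinfun \<times> ('a, 'b) cblinfun) filter"
  where "uniformity_cblinfun = (INF e\<in>{0 <..}. principal {(S, T). dist S T < e})"

definition open_cblinfun :: "('a, 'b) cblinfun set \<Rightarrow> bool"
  where "open_cblinfun U = (\<forall>S\<in>U. \<forall>\<^sub>F (S', T) in uniformity. S' = S \<longrightarrow> T \<in> U)"

instance
  apply standard
  unfolding dist_cblinfun_def open_cblinfun_def sgn_cblinfun_def uniformity_cblinfun_def
  apply (rule refl | (transfer, simp add: algebra_simps norm_triangle_ineq))+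
  done

end

lemma norm_blinfun_of_cblinfun_diff:
  "norm (blinfun_of_cblinfun S - blinfun_of_cblinfun T) = norm (S - T)"
  by transfer simp

instance cblinfun :: (complex_banach, complex_banach) banach
proof
  fix X :: "nat \<Rightarrow> ('a, 'b) cblinfun"
  assume "Cauchy X"
  hence "Cauchy (\<lambda>n. blinfun_of_cblinfun (X n))"
    by (simp add: Cauchy_iff norm_blinfun_of_cblinfun_diff)
  then obtain T where T: "(\<lambda>n. blinfun_of_cblinfun (X n)) \<longlonglongrightarrow> T"
    using Cauchy_convergent convergent_def by blast
  have app: "(\<lambda>n. blinfun_apply (blinfun_of_cblinfun (X n)) x) \<longlonglongrightarrow> blinfun_apply T x" for x
    by (intro tendsto_intros T)
  have "blinfun_apply T (c *\<^sub>C x) = c *\<^sub>C blinfun_apply T x" for c x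
  proof (rule LIMSEQ_unique[OF app])
    have "blinfun_apply (blinfun_of_cblinfun (X n)) (c *\<^sub>C x)
        = c *\<^sub>C blinfun_apply (blinfun_of_cblinfun (X n)) x" for n
      using blinfun_of_cblinfun[of "X n"] by simp
    thus "(\<lambda>n. blinfun_apply (blinfun_of_cblinfun (X n)) (c *\<^sub>C x)) \<longlonglongrightarrow> c *\<^sub>C blinfun_apply T x"
      by (simp add: bounded_linear.tendsto[OF bounded_linear_scaleC app])
  qed
  hence "blinfun_of_cblinfun (Abs_cblinfun T) = T"
    by (simp add: Abs_cblinfun_inverse)
  hence "X \<longlonglongrightarrow> Abs_cblinfun T"
    using T by (simp add: LIMSEQ_iff norm_blinfun_of_cblinfun_diff[symmetric])
  thus "convergent X"
    by (rule convergentI)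
qed

lemma capply_eqI: "(\<And>x. capply S x = capply T x) \<Longrightarrow> S = T"
  by transfer (rule blinfun_eqI)

lemma norm_capply: "norm (capply T x) \<le> norm T * norm x"
  by transfer (rule norm_blinfun)

lemma norm_cblinfun_bound:
  "0 \<le> K \<Longrightarrow> (\<And>x. norm (capply T x) \<le> K * norm x) \<Longrightarrow> norm T \<le> K"
  by transfer (rule norm_blinfun_bound)

lemma capply_simps:
  "capply 0 x = 0"
  "capply (S + T) x = capply S x + capply T x"
  "capply (S - T) x = capply S x - capply T x"
  "capply (- T) x = - capply T x"
  "capply (r *\<^sub>R T) x = r *\<^sub>R capply T x"
  "capply T (x + y) = capply T x + capply T y"
  "capply T (x - y) = capply T x - capply T y"
  "capply T (r *\<^sub>R x) = r *\<^sub>R capply T x"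
  "capply T (c *\<^sub>C x) = c *\<^sub>C capply T x"
  "capply T 0 = 0"
  by (transfer; simp add: blinfun.bilinear_simps)+

instantiation cblinfun :: (complex_banach, complex_banach) complex_banach
begin

lift_definition scaleC_cblinfun :: "complex \<Rightarrow> ('a, 'b) cblinfun \<Rightarrow> ('a, 'b) cblinfun"
  is "\<lambda>c T. blinfun_compose (Blinfun (scaleC c)) T"
  by (simp add: bounded_linear_Blinfun_apply[OF bounded_linear_scaleC] mult.commute)

lemma capply_scaleC: "capply (c *\<^sub>C T) x = c *\<^sub>C capply T x"
  by transfer (simp add: bounded_linear_Blinfun_apply[OF bounded_linear_scaleC])

instance
proof
  fix c d :: complex and r :: real and S T :: "('a, 'b) cblinfun"
  show "c *\<^sub>C (S + T) = c *\<^sub>C S + c *\<^sub>C T"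
    by (rule capply_eqI) (simp add: capply_scaleC capply_simps scaleC_add_right)
  show "(c + d) *\<^sub>C T = c *\<^sub>C T + d *\<^sub>C T"
    by (rule capply_eqI) (simp add: capply_scaleC capply_simps scaleC_add_left)
  show "c *\<^sub>C (d *\<^sub>C T) = (c * d) *\<^sub>C T"
    by (rule capply_eqI) (simp add: capply_scaleC)
  show "complex_of_real r *\<^sub>C T = r *\<^sub>R T"
    by (rule capply_eqI) (simp add: capply_scaleC capply_simps scaleC_of_real)
  have le: "norm (c *\<^sub>C T) \<le> cmod c * norm T" for c and T :: "('a, 'b) cblinfun"
    by (rule norm_cblinfun_bound)
      (auto simp: capply_scaleC norm_scaleC mult.assoc intro!: mult_left_mono norm_capply)
  show "norm (c *\<^sub>C T) = cmod c * norm T"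
  proof (cases "c = 0")
    case True
    then show ?thesis
      using le[of 0 T] by simp
  next
    case False
    have "T = inverse c *\<^sub>C (c *\<^sub>C T)"
      using False by (intro capply_eqI) (simp add: capply_scaleC)
    hence "cmod c * norm T \<le> cmod c * (cmod (inverse c) * norm (c *\<^sub>C T))"
      using le[of "inverse c" "c *\<^sub>C T"] by (intro mult_left_mono) simp_all
    also have "\<dots> = norm (c *\<^sub>C T)"
      using False by (simp add: norm_inverse)
    finally show ?thesis
      using le[of c T] by simp
  qed
qed

end

type_synonym 'a cdual = "('a, complex) cblinfun"

lift_definition ccompose ::
  "('b::complex_banach, 'c::complex_banach) cblinfun \<Rightarrow> ('a::complex_banach, 'b) cblinfun \<Rightarrow> ('a, 'c) cblinfun"
  is blinfun_compose
  by simp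

lemma capply_ccompose: "capply (ccompose S T) x = capply S (capply T x)"
  by transfer simp

definition finite_rank :: "('a::complex_banach, 'b::complex_banach) cblinfun \<Rightarrow> bool"
  where "finite_rank T \<longleftrightarrow> (\<exists>B. finite B \<and> range (capply T) \<subseteq> complex_vector.span B)"

definition approximable :: "('a::complex_banach, 'a) cblinfun set"
  where "approximable = closure {T. finite_rank T}"

section \<open>Banach algebras\<close>

text \<open>A Banach algebra is given as a closed subspace \<open>A\<close> of a Banach space together with a
  product \<open>mul\<close>, so that \<open>approximable\<close> with \<open>ccompose\<close> is an instance.\<close>

locale banach_algebra =
  fixes A :: "'a::complex_banach set" and mul :: "'a \<Rightarrow> 'a \<Rightarrow> 'a"
  assumes closed: "closed A"
    and subspace: "complex_vector.subspace A"
    and mul_closed: "a \<in> A \<Longrightarrow> b \<in> A \<Longrightarrow> mul a b \<in> A"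
    and mul_add_left: "a \<in> A \<Longrightarrow> b \<in> A \<Longrightarrow> c \<in> A \<Longrightarrow> mul (a + b) c = mul a c + mul b c"
    and mul_add_right: "a \<in> A \<Longrightarrow> b \<in> A \<Longrightarrow> c \<in> A \<Longrightarrow> mul a (b + c) = mul a b + mul a c"
    and mul_scaleC_left: "a \<in> A \<Longrightarrow> b \<in> A \<Longrightarrow> mul (k *\<^sub>C a) b = k *\<^sub>C mul a b"
    and mul_scaleC_right: "a \<in> A \<Longrightarrow> b \<in> A \<Longrightarrow> mul a (k *\<^sub>C b) = k *\<^sub>C mul a b"
    and mul_assoc: "a \<in> A \<Longrightarrow> b \<in> A \<Longrightarrow> c \<in> A \<Longrightarrow> mul (mul a b) c = mul a (mul b c)"
    and norm_mul: "a \<in> A \<Longrightarrow> b \<in> A \<Longrightarrow> norm (mul a b) \<le> norm a * norm b"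

lemma norm_ccompose: "norm (ccompose S T) \<le> norm S * norm T"
  by transfer (rule norm_blinfun_compose)

lemma bounded_bilinear_ccompose: "bounded_bilinear ccompose"
proof
  show "\<exists>K. \<forall>S T. norm (ccompose S T) \<le> norm S * norm T * K"
    by (intro exI[of _ 1]) (simp add: norm_ccompose)
qed (auto intro!: capply_eqI simp: capply_ccompose capply_simps)

lemma finite_rank_zero: "finite_rank 0"
  unfolding finite_rank_def by (rule exI[of _ "{}"]) (simp add: capply_simps)

lemma finite_rank_add:
  assumes "finite_rank S" "finite_rank T"
  shows "finite_rank (S + T)"
proof -
  obtain B C where "finite B" "range (capply S) \<subseteq> complex_vector.span B"
    "finite C" "range (capply T) \<subseteq> complex_vector.span C"
    using assms unfolding finite_rank_def by blast
  hence "finite (B \<union> C) \<and> range (capply (S + T)) \<subseteq> complex_vector.span (B \<union> C)"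
    by (fastforce simp: capply_simps complex_vector.span_Un)
  thus ?thesis
    unfolding finite_rank_def by blast
qed

lemma finite_rank_scaleC: "finite_rank T \<Longrightarrow> finite_rank (c *\<^sub>C T)"
  unfolding finite_rank_def
  by (auto simp: capply_scaleC intro!: complex_vector.span_scale)

lemma finite_rank_ccompose: "finite_rank S \<Longrightarrow> finite_rank (ccompose S T)"
  unfolding finite_rank_def by (auto simp: capply_ccompose)

lemma banach_algebra_approximable: "banach_algebra approximable ccompose"
proof
  show "closed (approximable :: ('a, 'a) cblinfun set)"
    by (simp add: approximable_def)
  show "complex_vector.subspace (approximable :: ('a, 'a) cblinfun set)"
  proof (rule complex_vector.subspaceI)
    show "(0 :: ('a, 'a) cblinfun) \<in> approximable"
      unfolding approximable_def by (rule subsetD[OF closure_subset]) (simp add: finite_rank_zero)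
  next
    fix S T :: "('a, 'a) cblinfun"
    assume "S \<in> approximable" "T \<in> approximable"
    then obtain f g where "\<And>n. finite_rank (f n)" "f \<longlonglongrightarrow> S" "\<And>n. finite_rank (g n)" "g \<longlonglongrightarrow> T"
      by (auto simp: approximable_def closure_sequential)
    thus "S + T \<in> approximable"
      unfolding approximable_def closure_sequential
      by (intro exI[of _ "\<lambda>n. f n + g n"]) (auto intro: finite_rank_add tendsto_add)
  next
    fix c and T :: "('a, 'a) cblinfun"
    assume "T \<in> approximable"
    then obtain f where "\<And>n. finite_rank (f n)" "f \<longlonglongrightarrow> T"
      by (auto simp: approximable_def closure_sequential)
    thus "c *\<^sub>C T \<in> approximable"
      unfolding approximable_def closure_sequential
      by (intro exI[of _ "\<lambda>n. c *\<^sub>C f n"])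
        (auto intro: finite_rank_scaleC bounded_linear.tendsto[OF bounded_linear_scaleC])
  qed
next
  fix S T :: "('a, 'a) cblinfun"
  assume "S \<in> approximable" "T \<in> approximable"
  then obtain f g where "\<And>n. finite_rank (f n)" "f \<longlonglongrightarrow> S" "\<And>n. finite_rank (g n)" "g \<longlonglongrightarrow> T"
    by (auto simp: approximable_def closure_sequential)
  thus "ccompose S T \<in> approximable"
    unfolding approximable_def closure_sequential
    by (intro exI[of _ "\<lambda>n. ccompose (f n) (g n)"])
      (auto intro: finite_rank_ccompose bounded_bilinear.tendsto[OF bounded_bilinear_ccompose])
qed (auto intro!: capply_eqI norm_ccompose simp: capply_ccompose capply_simps capply_scaleC)

section \<open>Banach bimodules, derivations and amenability\<close>

text \<open>Bimodules have an explicit carrier and explicit operations, because amenability quantifies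
  over all of them. The underlying vector space is a module over the ring \<open>complex_ring\<close>; the
  fields \<open>mult\<close> and \<open>one\<close> that a module record inherits from rings play no role.\<close>

definition complex_ring :: "complex ring"
  where "complex_ring = \<lparr>carrier = UNIV, monoid.mult = (*), one = 1, zero = 0, add = (+)\<rparr>"

record ('a, 'z) bimodule = "(complex, 'z) module" +
  mnorm :: "'z \<Rightarrow> real"
  lact :: "'a \<Rightarrow> 'z \<Rightarrow> 'z"
  ract :: "'z \<Rightarrow> 'a \<Rightarrow> 'z"

locale complex_banach_space = Module.module complex_ring Z for Z :: "('a, 'z) bimodule" (structure) +
  assumes mnorm_eq_0_iff: "x \<in> carrier Z \<Longrightarrow> mnorm Z x = 0 \<longleftrightarrow> x = \<zero>"
    and mnorm_smult: "x \<in> carrier Z \<Longrightarrow> mnorm Z (k \<odot> x) = cmod k * mnorm Z x"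
    and mnorm_triangle: "x \<in> carrier Z \<Longrightarrow> y \<in> carrier Z \<Longrightarrow> mnorm Z (x \<oplus> y) \<le> mnorm Z x + mnorm Z y"
    and complete: "\<lbrakk>\<And>n. s n \<in> carrier Z;
        \<And>e. e > 0 \<Longrightarrow> \<exists>N::nat. \<forall>m\<ge>N. \<forall>n\<ge>N. mnorm Z (s m \<ominus> s n) < e\<rbrakk>
      \<Longrightarrow> \<exists>l\<in>carrier Z. (\<lambda>n. mnorm Z (s n \<ominus> l)) \<longlonglongrightarrow> 0"

locale banach_bimodule = banach_algebra A mul + complex_banach_space Z
  for A :: "'a::complex_banach set" and mul and Z :: "('a, 'z) bimodule" (structure) +
  assumes lact_closed: "a \<in> A \<Longrightarrow> x \<in> carrier Z \<Longrightarrow> lact Z a x \<in> carrier Z"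
    and ract_closed: "a \<in> A \<Longrightarrow> x \<in> carrier Z \<Longrightarrow> ract Z x a \<in> carrier Z"
    and lact_add: "\<lbrakk>a \<in> A; x \<in> carrier Z; y \<in> carrier Z\<rbrakk>
      \<Longrightarrow> lact Z a (x \<oplus> y) = lact Z a x \<oplus> lact Z a y"
    and ract_add: "\<lbrakk>a \<in> A; x \<in> carrier Z; y \<in> carrier Z\<rbrakk>
      \<Longrightarrow> ract Z (x \<oplus> y) a = ract Z x a \<oplus> ract Z y a"
    and add_lact: "\<lbrakk>a \<in> A; b \<in> A; x \<in> carrier Z\<rbrakk> \<Longrightarrow> lact Z (a + b) x = lact Z a x \<oplus> lact Z b x"
    and add_ract: "\<lbrakk>a \<in> A; b \<in> A; x \<in> carrier Z\<rbrakk> \<Longrightarrow> ract Z x (a + b) = ract Z x a \<oplus> ract Z x b"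
    and lact_smult: "\<lbrakk>a \<in> A; x \<in> carrier Z\<rbrakk> \<Longrightarrow> lact Z a (k \<odot> x) = k \<odot> lact Z a x"
    and ract_smult: "\<lbrakk>a \<in> A; x \<in> carrier Z\<rbrakk> \<Longrightarrow> ract Z (k \<odot> x) a = k \<odot> ract Z x a"
    and scaleC_lact: "\<lbrakk>a \<in> A; x \<in> carrier Z\<rbrakk> \<Longrightarrow> lact Z (k *\<^sub>C a) x = k \<odot> lact Z a x"
    and scaleC_ract: "\<lbrakk>a \<in> A; x \<in> carrier Z\<rbrakk> \<Longrightarrow> ract Z x (k *\<^sub>C a) = k \<odot> ract Z x a"
    and lact_mul: "\<lbrakk>a \<in> A; b \<in> A; x \<in> carrier Z\<rbrakk> \<Longrightarrow> lact Z (mul a b) x = lact Z a (lact Z b x)"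
    and ract_mul: "\<lbrakk>a \<in> A; b \<in> A; x \<in> carrier Z\<rbrakk> \<Longrightarrow> ract Z x (mul a b) = ract Z (ract Z x a) b"
    and lact_ract: "\<lbrakk>a \<in> A; b \<in> A; x \<in> carrier Z\<rbrakk>
      \<Longrightarrow> ract Z (lact Z a x) b = lact Z a (ract Z x b)"
    and act_bounded: "\<exists>K. \<forall>a\<in>A. \<forall>x\<in>carrier Z.
      mnorm Z (lact Z a x) \<le> K * norm a * mnorm Z x \<and> mnorm Z (ract Z x a) \<le> K * norm a * mnorm Z x"

text \<open>The functionals in the dual are \<open>undefined\<close> off the carrier, so that they are equal as soon as
  they agree on it.\<close>

definition dual_bimodule :: "('a, 'z) bimodule \<Rightarrow> ('a, 'z \<Rightarrow> complex) bimodule"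
  where "dual_bimodule Z =
    \<lparr>carrier = {\<phi> \<in> extensional (carrier Z).
        (\<forall>x\<in>carrier Z. \<forall>y\<in>carrier Z. \<phi> (x \<oplus>\<^bsub>Z\<^esub> y) = \<phi> x + \<phi> y) \<and>
        (\<forall>k. \<forall>x\<in>carrier Z. \<phi> (k \<odot>\<^bsub>Z\<^esub> x) = k * \<phi> x) \<and>
        (\<exists>K. \<forall>x\<in>carrier Z. cmod (\<phi> x) \<le> K * mnorm Z x)},
     monoid.mult = undefined,
     one = undefined,
     zero = (\<lambda>x\<in>carrier Z. 0),
     add = (\<lambda>\<phi> \<psi>. \<lambda>x\<in>carrier Z. \<phi> x + \<psi> x),
     smult = (\<lambda>k \<phi>. \<lambda>x\<in>carrier Z. k * \<phi> x),
     mnorm = (\<lambda>\<phi>. SUP x\<in>{x \<in> carrier Z. mnorm Z x \<le> 1}. cmod (\<phi> x)),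
     lact = (\<lambda>a \<phi>. \<lambda>x\<in>carrier Z. \<phi> (ract Z x a)),
     ract = (\<lambda>\<phi> a. \<lambda>x\<in>carrier Z. \<phi> (lact Z a x))\<rparr>"

definition continuous_derivation ::
  "'a::complex_banach set \<Rightarrow> ('a \<Rightarrow> 'a \<Rightarrow> 'a) \<Rightarrow> ('a, 'm) bimodule \<Rightarrow> ('a \<Rightarrow> 'm) \<Rightarrow> bool"
  where "continuous_derivation A mul M D \<longleftrightarrow>
    D \<in> A \<rightarrow> carrier M \<and>
    (\<forall>a\<in>A. \<forall>b\<in>A. D (a + b) = D a \<oplus>\<^bsub>M\<^esub> D b) \<and>
    (\<forall>k. \<forall>a\<in>A. D (k *\<^sub>C a) = k \<odot>\<^bsub>M\<^esub> D a) \<and>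
    (\<forall>a\<in>A. \<forall>b\<in>A. D (mul a b) = lact M a (D b) \<oplus>\<^bsub>M\<^esub> ract M (D a) b) \<and>
    (\<forall>a\<in>A. \<forall>e>0. \<exists>d>0. \<forall>b\<in>A. dist b a < d \<longrightarrow> mnorm M (D b \<ominus>\<^bsub>M\<^esub> D a) < e)"

definition inner_derivation ::
  "'a::complex_banach set \<Rightarrow> ('a, 'm) bimodule \<Rightarrow> ('a \<Rightarrow> 'm) \<Rightarrow> bool"
  where "inner_derivation A M D \<longleftrightarrow>
    (\<exists>\<phi>\<in>carrier M. \<forall>a\<in>A. D a = lact M a \<phi> \<ominus>\<^bsub>M\<^esub> ract M \<phi> a)"

text \<open>HOL cannot quantify over types inside a formula, so the type \<open>'z\<close> in which the carriers of
  the bimodules live is a parameter. Amenability proper is \<open>amenable TYPE('z) A mul\<close> for every type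
  \<open>'z\<close>. This is what a conclusion with a free type variable \<open>'z\<close> expresses.\<close>

definition amenable :: "'z itself \<Rightarrow> 'a::complex_banach set \<Rightarrow> ('a \<Rightarrow> 'a \<Rightarrow> 'a) \<Rightarrow> bool"
  where "amenable (_ :: 'z itself) A mul \<longleftrightarrow>
    banach_algebra A mul \<and>
    (\<forall>(Z :: ('a, 'z) bimodule) D.
      banach_bimodule A mul Z \<longrightarrow>
      continuous_derivation A mul (dual_bimodule Z) D \<longrightarrow>
      inner_derivation A (dual_bimodule Z) D)"

text \<open>In a hypothesis one type has to be chosen. The type below has enough room for an algebra
  \<open>A\<close> with elements in \<open>'a\<close>: the first dual of \<open>A\<close> and quotients of the space of bounded bilinear
  forms on \<open>A\<close> (whose elements are sets of functions \<open>'a \<Rightarrow> 'a \<Rightarrow> complex\<close>) fit into it. Johnson's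
  construction of a bounded approximate identity and a virtual diagonal for \<open>A\<close> uses only such
  bimodules, and these two objects in turn give amenability for every type \<open>'z\<close>.\<close>

type_synonym 'a bimodule_universe = "('a \<Rightarrow> 'a \<Rightarrow> complex) set"

end

theory Submission
  imports Defs "HOL-Library.Function_Algebras"
begin

text \<open>
  Write \<open>A\<close> for the approximable operators on the dual space and \<open>B\<close> for those on the space
  itself. Taking adjoints embeds \<open>B\<close> into \<open>A\<close> and reverses products; the image is a left ideal, but
  amenability does not in general descend to left ideals. What makes this one special is that
  bounded functionals extend canonically from it. For a functional \<open>\<psi>\<close> on \<open>B\<close> and \<open>f\<close> in the dual
  let \<open>\<psi>\<^sub>f\<close> be the functional \<open>x \<mapsto> \<psi> (rank_one x f)\<close>. The extension sends the rank one operator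
  \<open>rank_one f \<xi>\<close>, with \<open>\<xi>\<close> in the second dual, to \<open>\<xi> \<psi>\<^sub>f\<close>. This is well defined and bounded because of
  the inequality

    \<open>|\<Sum>\<^sub>i \<xi>\<^sub>i \<psi>\<^sub>f\<^sub>i| \<le> 2 \<parallel>\<psi>\<parallel> \<parallel>\<Sum>\<^sub>i rank_one f\<^sub>i \<xi>\<^sub>i\<parallel>\<close>

  (\<open>operator_functional_trace_bound\<close>), a dual form of the principle of local reflexivity: operators
  with values in a finite dimensional space of functionals behave, as far as \<open>\<psi>\<close> can see, as if they
  were adjoints. The inequality rests on the Hahn-Banach theorem, which is derived here from the
  existence of minimal sublinear functionals. The extension is linear in \<open>\<psi>\<close> and respects
  multiplication by elements of \<open>B\<close> on either side (\<open>extension_ccompose_left\<close>,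
  \<open>extension_ccompose_right\<close>, \<open>extension_ccompose\<close>).

  Amenability of \<open>A\<close> is used through one derivation. Let \<open>A\<^sup>1\<close> be \<open>A\<close> with a unit adjoined. The kernel
  of the multiplication of \<open>A\<^sup>1\<close> is the left module \<open>A\<^sup>1 \<otimes> A\<close>, and \<open>s \<mapsto> 1 \<otimes> s\<close> is, up to sign, the universal
  derivation into it. Its dual is the bimodule of bounded bilinear forms on \<open>A\<^sup>1 \<times> A\<close>, and
  amenability of \<open>A\<close> says that \<open>s \<mapsto> (F \<mapsto> F (1, s))\<close> is inner: there is a bounded functional \<open>M\<close> on
  these forms with \<open>F (1, s) = M (F \<cdot> s) - M (s \<cdot> F)\<close> (\<open>amenable_universal_splitting\<close>). This avoids
  approximate identities and virtual diagonals altogether.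

  Now let \<open>D\<close> be a continuous derivation of \<open>B\<close> into the dual of a bimodule \<open>Z\<close>. For \<open>z\<close> in \<open>Z\<close> the
  form \<open>(a, b) \<mapsto> \<langle>D b, a z\<rangle>\<close> on \<open>B\<^sup>1 \<times> B\<close> extends, one variable at a time, to a form \<open>F\<^sub>z\<close> on \<open>A\<^sup>1 \<times> A\<close>.
  Since the extension respects multiplication, the derivation rule gives \<open>F\<^bsub>cz\<^esub> = F\<^sub>z \<cdot> c'\<close> and
  \<open>F\<^bsub>zc\<^esub> = c' \<cdot> F\<^sub>z\<close>, where \<open>c'\<close> is the adjoint of \<open>c\<close>, while \<open>F\<^sub>z (1, c') = \<langle>D c, z\<rangle>\<close>. Hence
  \<open>\<langle>D c, z\<rangle> = M F\<^bsub>cz\<^esub> - M F\<^bsub>zc\<^esub>\<close>, that is, \<open>z \<mapsto> - M F\<^sub>z\<close> implements \<open>D\<close>. The functional \<open>M\<close> belongs to \<open>A\<close>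
  alone, so \<open>Z\<close> can live in any type.
\<close>

section \<open>The Hahn-Banach theorem\<close>

text \<open>For dilations an inequality is required, since that is what constructions by infima provide;
  equality follows.\<close>

definition sublinear :: "('v::real_vector \<Rightarrow> real) \<Rightarrow> bool"
  where "sublinear q \<longleftrightarrow> (\<forall>u v. q (u + v) \<le> q u + q v) \<and> (\<forall>t\<ge>0. \<forall>v. q (t *\<^sub>R v) \<le> t * q v)"

lemma sublinearI:
  "(\<And>u v. q (u + v) \<le> q u + q v) \<Longrightarrow> (\<And>t v. t > 0 \<Longrightarrow> q (t *\<^sub>R v) \<le> t * q v) \<Longrightarrow> q 0 \<le> 0 \<Longrightarrow> sublinear q"
  unfolding sublinear_def by (metis less_eq_real_def mult_zero_left scaleR_zero_left)

lemma sublinear_add: "sublinear q \<Longrightarrow> q (u + v) \<le> q u + q v"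
  by (simp add: sublinear_def)

lemma sublinear_scaleR_le: "sublinear q \<Longrightarrow> t \<ge> 0 \<Longrightarrow> q (t *\<^sub>R v) \<le> t * q v"
  by (simp add: sublinear_def)

lemma sublinear_zero:
  assumes "sublinear q" shows "q 0 = 0"
  using sublinear_add[OF assms, of 0 0] sublinear_scaleR_le[OF assms, of 0 0] by simp

lemma sublinear_scaleR:
  assumes "sublinear q" "t \<ge> 0" shows "q (t *\<^sub>R v) = t * q v"
proof (cases "t = 0")
  case True
  then show ?thesis using sublinear_zero[OF assms(1)] by simp
next
  case False
  with assms have t: "t > 0" by simp
  have "q (inverse t *\<^sub>R (t *\<^sub>R v)) \<le> inverse t * q (t *\<^sub>R v)"
    using t by (intro sublinear_scaleR_le assms) simp
  hence "t * q v \<le> q (t *\<^sub>R v)"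
    using t by (simp add: field_simps)
  with sublinear_scaleR_le[OF assms, of v] show ?thesis by simp
qed

lemma sublinear_minus_le:
  assumes "sublinear q" shows "- q (- v) \<le> q v"
  using sublinear_add[OF assms, of v "- v"] sublinear_zero[OF assms] by simp

text \<open>An infimum of functions is sublinear even if the members are not, as long as sums and positive
  dilations of values of members dominate values of further members.\<close>

lemma sublinear_INF:
  assumes ne: "I \<noteq> {}"
    and bdd: "\<And>v. bdd_below ((\<lambda>i. r i v) ` I)"
    and add: "\<And>i j u v. i \<in> I \<Longrightarrow> j \<in> I \<Longrightarrow> \<exists>k\<in>I. r k (u + v) \<le> r i u + r j v"
    and scale: "\<And>i t v. i \<in> I \<Longrightarrow> t > 0 \<Longrightarrow> \<exists>k\<in>I. r k (t *\<^sub>R v) \<le> t * r i v"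
    and zero: "\<exists>i\<in>I. r i 0 \<le> 0"
  shows "sublinear (\<lambda>v. INF i\<in>I. r i v)"
proof (rule sublinearI)
  have le: "k \<in> I \<Longrightarrow> r k v \<le> x \<Longrightarrow> (INF i\<in>I. r i v) \<le> x" for k v x
    using cINF_lower[OF bdd, of k v] by linarith
  fix u v
  have "(INF i\<in>I. r i (u + v)) - r i u \<le> (INF j\<in>I. r j v)" if "i \<in> I" for i
    using ne add[OF that, of _ u v] le[of _ "u + v"] by (intro cINF_greatest) (auto, force)
  hence "(INF i\<in>I. r i (u + v)) - (INF j\<in>I. r j v) \<le> (INF i\<in>I. r i u)"
    using ne by (intro cINF_greatest) (auto simp: algebra_simps)
  thus "(INF i\<in>I. r i (u + v)) \<le> (INF i\<in>I. r i u) + (INF i\<in>I. r i v)" by linarith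
next
  fix t :: real and v
  assume t: "t > 0"
  have le: "k \<in> I \<Longrightarrow> r k v \<le> x \<Longrightarrow> (INF i\<in>I. r i v) \<le> x" for k v x
    using cINF_lower[OF bdd, of k v] by linarith
  have "inverse t * (INF i\<in>I. r i (t *\<^sub>R v)) \<le> (INF i\<in>I. r i v)"
  proof (rule cINF_greatest[OF ne])
    fix i assume "i \<in> I"
    then obtain k where "k \<in> I" "r k (t *\<^sub>R v) \<le> t * r i v" using scale t by blast
    from le[OF this] show "inverse t * (INF i\<in>I. r i (t *\<^sub>R v)) \<le> r i v"
      using t by (simp add: field_simps)
  qed
  thus "(INF i\<in>I. r i (t *\<^sub>R v)) \<le> t * (INF i\<in>I. r i v)"
    using t by (simp add: field_simps)
next
  show "(INF i\<in>I. r i 0) \<le> 0"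
    using zero cINF_lower[OF bdd, of _ 0] by force
qed

text \<open>A sublinear functional \<open>q\<close> that is minimal is additive: \<open>v \<mapsto> INF t\<ge>0. q (v + t w) - t q w\<close>
  is sublinear and below \<open>q\<close>, hence equal to \<open>q\<close>, and \<open>t = 1\<close> gives \<open>q v + q w \<le> q (v + w)\<close>.\<close>

lemma minimal_sublinear_linear:
  fixes q :: "'v::real_vector \<Rightarrow> real"
  assumes q: "sublinear q" and minimal: "\<And>r. sublinear r \<Longrightarrow> r \<le> q \<Longrightarrow> r = q"
  shows "linear q"
proof -
  have super: "q v + q w \<le> q (v + w)" for v w
  proof -
    \<comment> \<open>Bounded below in \<open>t\<close> since \<open>t q w = q (t w) \<le> q (v + t w) + q (- v)\<close>.\<close>
    define f where "f t v = q (v + t *\<^sub>R w) - t * q w" for t v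
    have lower: "- q (- v) \<le> f t v" if "t \<ge> 0" for t v
      using sublinear_add[OF q, of "v + t *\<^sub>R w" "- v"] sublinear_scaleR[OF q that, of w]
      by (simp add: f_def)
    have bdd: "bdd_below ((\<lambda>t. f t v) ` {0..})" for v
      by (rule bdd_belowI[of _ "- q (- v)"]) (auto intro: lower)
    have "sublinear (\<lambda>v. INF t\<in>{0..}. f t v)"
    proof (rule sublinear_INF[OF _ bdd])
      fix s t :: real and u v assume "s \<in> {0..}" "t \<in> {0..}"
      moreover have "f (s + t) (u + v) \<le> f s u + f t v"
        using sublinear_add[OF q, of "u + s *\<^sub>R w" "v + t *\<^sub>R w"] by (simp add: f_def algebra_simps)
      ultimately show "\<exists>k\<in>{0..}. f k (u + v) \<le> f s u + f t v"
        by (intro bexI[of _ "s + t"]) auto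
    next
      fix s t :: real and v assume "s \<in> {0..}" "t > 0"
      moreover from this have "f (t * s) (t *\<^sub>R v) \<le> t * f s v"
        using sublinear_scaleR_le[OF q, of t "v + s *\<^sub>R w"] by (simp add: f_def algebra_simps)
      ultimately show "\<exists>k\<in>{0..}. f k (t *\<^sub>R v) \<le> t * f s v"
        by (intro bexI[of _ "t * s"]) auto
    next
      show "\<exists>t\<in>{0..}. f t 0 \<le> 0"
        by (rule bexI[of _ 0]) (simp_all add: f_def sublinear_zero[OF q])
    qed auto
    moreover have "(\<lambda>v. INF t\<in>{0..}. f t v) \<le> q"
      using cINF_lower[OF bdd, of 0] by (auto simp: le_fun_def f_def)
    ultimately have "(\<lambda>v. INF t\<in>{0..}. f t v) = q" by (rule minimal)
    hence "q v \<le> f 1 v"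
      using cINF_lower[OF bdd, of 1 v] by (auto dest: fun_cong[of _ _ v])
    thus ?thesis by (simp add: f_def)
  qed
  have add: "q (v + w) = q v + q w" for v w
    using super[of v w] sublinear_add[OF q, of v w] by simp
  hence minus: "q (- v) = - q v" for v
    using add[of v "- v"] sublinear_zero[OF q] by simp
  show ?thesis
  proof (rule linearI[OF add])
    fix t v
    show "q (t *\<^sub>R v) = t *\<^sub>R q v"
      using sublinear_scaleR[OF q, of t v] sublinear_scaleR[OF q, of "- t" v] minus[of "t *\<^sub>R v"]
      by (cases "t \<ge> 0") auto
  qed
qed

text \<open>Zorn's lemma applies to the sublinear functionals below \<open>p\<close>: all of them are at least
  \<open>v \<mapsto> - p (- v)\<close>, so the pointwise infimum of a chain is finite.\<close>

lemma linear_below_sublinear: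
  fixes p :: "'v::real_vector \<Rightarrow> real"
  assumes p: "sublinear p"
  obtains \<theta> where "linear \<theta>" "\<theta> \<le> p"
proof -
  define Q where "Q = {q. sublinear q \<and> q \<le> p}"
  have lower: "- p (- v) \<le> q v" if "q \<in> Q" for q v
    using that sublinear_minus_le[of q v] by (auto simp: Q_def le_fun_def) (smt (verit, best))
  have "\<exists>m\<in>Q. \<forall>q\<in>Q. q \<le> m \<longrightarrow> q = m"
  proof (rule predicate_Zorn)
    show "partial_order_on Q (relation_of (\<lambda>q r. r \<le> q) Q)"
      by (rule partial_order_on_relation_ofI) auto
  next
    fix C assume "C \<in> Chains (relation_of (\<lambda>q r. r \<le> q) Q)"
    hence C: "C \<subseteq> Q" and total: "\<And>q r. q \<in> C \<Longrightarrow> r \<in> C \<Longrightarrow> q \<le> r \<or> r \<le> q"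
      by (auto simp: Chains_def relation_of_def)
    show "\<exists>u\<in>Q. \<forall>q\<in>C. u \<le> q"
    proof (cases "C = {}")
      case True
      then show ?thesis using p by (auto simp: Q_def)
    next
      case False
      have bdd: "bdd_below ((\<lambda>q. q v) ` C)" for v
        using C lower by (intro bdd_belowI[of _ "- p (- v)"]) auto
      have sub: "sublinear q" if "q \<in> C" for q
        using that C by (auto simp: Q_def)
      have "sublinear (\<lambda>v. INF q\<in>C. q v)"
      proof (rule sublinear_INF[OF False bdd])
        fix q r u v assume qr: "q \<in> C" "r \<in> C"
        have "q (u + v) \<le> q u + q v" "r (u + v) \<le> r u + r v"
          using qr sub by (auto intro: sublinear_add)
        moreover have "q u \<le> r u \<and> q v \<le> r v \<or> r u \<le> q u \<and> r v \<le> q v"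
          using total[OF qr] by (auto simp: le_fun_def)
        ultimately show "\<exists>k\<in>C. k (u + v) \<le> q u + r v"
          using qr by (smt (verit, best))
      next
        show "\<exists>q\<in>C. q 0 \<le> 0"
          using False sub sublinear_zero by fastforce
      next
        fix q and t :: real and v assume "q \<in> C" "t > 0"
        thus "\<exists>k\<in>C. k (t *\<^sub>R v) \<le> t * q v"
          using sub by (intro bexI[of _ q] sublinear_scaleR_le) auto
      qed
      moreover have "(INF q\<in>C. q v) \<le> q v" if "q \<in> C" for q v
        using cINF_lower[OF bdd that] .
      moreover from this have "(INF q\<in>C. q v) \<le> p v" for v
        using False C by (force simp: Q_def le_fun_def intro: order_trans)
      ultimately show ?thesis
        by (intro bexI[of _ "\<lambda>v. INF q\<in>C. q v"]) (auto simp: Q_def le_fun_def)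
    qed
  qed
  then obtain m where m: "m \<in> Q" "\<And>q. q \<in> Q \<Longrightarrow> q \<le> m \<Longrightarrow> q = m" by blast
  have "linear m"
    using m by (intro minimal_sublinear_linear) (auto simp: Q_def)
  with m(1) show ?thesis by (auto simp: Q_def intro: that)
qed

text \<open>The extension form of the theorem, with the subspace given as the range of a linear map \<open>J\<close>.
  That \<open>\<Psi>\<close> depends only on \<open>J w\<close> is part of what the inequality \<open>\<Psi> \<le> P \<circ> J\<close> says.\<close>

lemma hahn_banach:
  fixes J :: "'w::real_vector \<Rightarrow> 'v::real_vector" and \<Psi> :: "'w \<Rightarrow> real"
  assumes P: "sublinear P" and J: "linear J" and \<Psi>: "linear \<Psi>" and le: "\<And>w. \<Psi> w \<le> P (J w)"
  obtains \<theta> where "linear \<theta>" "\<And>v. \<theta> v \<le> P v" "\<And>w. \<theta> (J w) = \<Psi> w"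
proof -
  \<comment> \<open>The infimum over \<open>w\<close> is below \<open>P\<close>, and any linear functional below it agrees with \<open>\<Psi>\<close> on the range of \<open>J\<close>.\<close>
  define f where "f w v = P (v - J w) + \<Psi> w" for w v
  have lower: "- P (- v) \<le> f w v" for w v
    using le[of "- w"] sublinear_add[OF P, of "v - J w" "- v"]
    by (simp add: f_def linear_neg[OF J] linear_neg[OF \<Psi>])
  have bdd: "bdd_below (range (\<lambda>w. f w v))" for v
    by (rule bdd_belowI[of _ "- P (- v)"]) (auto intro: lower)
  have "sublinear (\<lambda>v. INF w. f w v)"
  proof (rule sublinear_INF[OF _ bdd])
    fix w w' v v'
    have "f (w + w') (v + v') \<le> f w v + f w' v'"
      using sublinear_add[OF P, of "v - J w" "v' - J w'"]
      by (simp add: f_def linear_add[OF J] linear_add[OF \<Psi>] algebra_simps)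
    thus "\<exists>k\<in>UNIV. f k (v + v') \<le> f w v + f w' v'" by blast
  next
    fix w v and t :: real assume "t > 0"
    hence "f (t *\<^sub>R w) (t *\<^sub>R v) \<le> t * f w v"
      using sublinear_scaleR_le[OF P, of t "v - J w"]
      by (simp add: f_def linear_scale[OF J] linear_scale[OF \<Psi>] algebra_simps)
    thus "\<exists>k\<in>UNIV. f k (t *\<^sub>R v) \<le> t * f w v" by blast
  next
    show "\<exists>w\<in>UNIV. f w 0 \<le> 0"
      by (rule bexI[of _ 0]) (simp_all add: f_def linear_0[OF J] linear_0[OF \<Psi>] sublinear_zero[OF P])
  qed simp
  then obtain \<theta> where \<theta>: "linear \<theta>" "\<theta> \<le> (\<lambda>v. INF w. f w v)"
    by (rule linear_below_sublinear)
  have \<theta>_le: "\<theta> v \<le> f w v" for v w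
    using \<theta>(2) cINF_lower[OF bdd, of w v] by (auto simp: le_fun_def intro: order_trans)
  have upper: "\<theta> (J w) \<le> \<Psi> w" for w
    using \<theta>_le[of "J w" w] by (simp add: f_def sublinear_zero[OF P])
  have "\<theta> (J w) = \<Psi> w" for w
    using upper[of w] upper[of "- w"] by (simp add: linear_neg[OF J] linear_neg[OF \<Psi>] linear_neg[OF \<theta>(1)])
  moreover have "\<theta> v \<le> P v" for v
    using \<theta>_le[of v 0] by (simp add: f_def linear_0[OF J] linear_0[OF \<Psi>])
  ultimately show ?thesis using \<theta>(1) that by blast
qed

section \<open>Functionals and rank one operators\<close>

definition cblinfun_of :: "('a::complex_banach \<Rightarrow> 'b::complex_banach) \<Rightarrow> ('a, 'b) cblinfun"
  where "cblinfun_of f = Abs_cblinfun (Blinfun f)"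

lemma capply_cblinfun_of:
  assumes "\<And>x y. f (x + y) = f x + f y" "\<And>c x. f (c *\<^sub>C x) = c *\<^sub>C f x"
    and "\<And>x. norm (f x) \<le> K * norm x"
  shows "capply (cblinfun_of f) = f"
proof -
  have "bounded_linear f"
    using assms(1,3) assms(2)[of "complex_of_real _"]
    by (intro bounded_linear_intro[of _ K]) (simp_all add: scaleC_of_real mult.commute)
  hence B: "blinfun_apply (Blinfun f) = f" by (rule bounded_linear_Blinfun_apply)
  show ?thesis
    unfolding cblinfun_of_def capply.rep_eq using assms(2) B
    by (subst Abs_cblinfun_inverse) simp_all
qed

lemma norm_cblinfun_of:
  assumes "\<And>x y. f (x + y) = f x + f y" "\<And>c x. f (c *\<^sub>C x) = c *\<^sub>C f x"
    and "\<And>x. norm (f x) \<le> K * norm x" and "0 \<le> K"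
  shows "norm (cblinfun_of f) \<le> K"
  using assms(3,4) capply_cblinfun_of[OF assms(1-3)] by (intro norm_cblinfun_bound) simp_all

lemma capply_sum:
  "capply (\<Sum>i\<in>I. T i) x = (\<Sum>i\<in>I. capply (T i) x)"
  "capply S (\<Sum>i\<in>I. y i) = (\<Sum>i\<in>I. capply S (y i))"
  by (induction I rule: infinite_finite_induct) (simp_all add: capply_simps)

text \<open>A complex functional is determined by its real part \<open>\<theta>\<close>, as \<open>x \<mapsto> \<theta> x - \<i> \<theta> (\<i> x)\<close>. The crude bound
  \<open>2 K\<close> suffices, since constants are immaterial for continuity of the extensions below.\<close>

lemma complexified_functional:
  fixes \<theta> :: "'a::complex_banach \<Rightarrow> real"
  assumes \<theta>: "linear \<theta>" and le: "\<And>x. \<theta> x \<le> K * norm x" and K: "0 \<le> K"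
  obtains g :: "'a cdual" where
    "\<And>x. Re (capply g x) = \<theta> x" "norm g \<le> 2 * K"
proof -
  define f where "f x = complex_of_real (\<theta> x) - \<i> * complex_of_real (\<theta> (\<i> *\<^sub>C x))" for x
  have ii: "\<i> *\<^sub>C \<i> *\<^sub>C x = - x" for x :: 'a
    using scaleC_of_real[of "-1" x] by (simp add: scaleC_scaleC)
  have cx: "c *\<^sub>C x = Re c *\<^sub>R x + Im c *\<^sub>R (\<i> *\<^sub>C x)" for c and x :: 'a
  proof -
    have "c = complex_of_real (Re c) + complex_of_real (Im c) * \<i>"
      by (simp add: complex_eq_iff)
    then have "c *\<^sub>C x = (complex_of_real (Re c) + complex_of_real (Im c) * \<i>) *\<^sub>C x" by simp
    thus ?thesis
      by (simp only: scaleC_add_left scaleC_scaleC[symmetric] scaleC_of_real)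
  qed
  have abs_le: "\<bar>\<theta> x\<bar> \<le> K * norm x" for x
    using le[of x] le[of "- x"] by (simp add: linear_neg[OF \<theta>])
  have add: "f (x + y) = f x + f y" for x y
    by (simp add: f_def linear_add[OF \<theta>] scaleC_add_right algebra_simps)
  have icx: "\<i> *\<^sub>C c *\<^sub>C x = Re c *\<^sub>R (\<i> *\<^sub>C x) - Im c *\<^sub>R x" for c and x :: 'a
    using cx[of "\<i> * c" x] by (simp add: scaleC_scaleC)
  have scale: "f (c *\<^sub>C x) = c *\<^sub>C f x" for c x
    unfolding f_def scaleC_complex_def icx unfolding cx[of c x]
    by (simp add: linear_add[OF \<theta>] linear_diff[OF \<theta>] linear_scale[OF \<theta>] complex_eq_iff algebra_simps)
  have bound: "norm (f x) \<le> (2 * K) * norm x" for x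
  proof -
    have "norm (f x) \<le> \<bar>\<theta> x\<bar> + \<bar>\<theta> (\<i> *\<^sub>C x)\<bar>"
      unfolding f_def by (rule order_trans[OF norm_triangle_ineq4]) (simp add: norm_mult)
    also have "\<dots> \<le> K * norm x + K * norm x"
      using abs_le[of x] abs_le[of "\<i> *\<^sub>C x"] by (simp add: norm_scaleC)
    finally show ?thesis by simp
  qed
  note ap = capply_cblinfun_of[of f, OF add scale bound]
  show ?thesis
    by (rule that[of "cblinfun_of f"])
      (use norm_cblinfun_of[of f, OF add scale bound] K in \<open>simp_all add: ap f_def\<close>)
qed

lemma exists_functional_eq_one:
  fixes w :: "'a::complex_banach"
  assumes "w \<noteq> 0"
  obtains g :: "'a cdual" where "capply g w = 1"
proof -
  have J: "linear (\<lambda>c. c *\<^sub>C w)"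
    by (intro linearI) (simp_all only: scaleC_add_left scaleC_scaleC[symmetric] scaleC_of_real
        scaleR_conv_of_real)
  have \<Psi>: "linear (\<lambda>c. norm w * Re c)"
    by (intro linearI) (simp_all add: algebra_simps)
  have P: "sublinear (norm :: 'a \<Rightarrow> real)"
    by (intro sublinearI) (simp_all add: norm_triangle_ineq)
  have "norm w * Re c \<le> norm (c *\<^sub>C w)" for c
    by (simp add: norm_scaleC mult.commute[of "norm w"] complex_Re_le_cmod mult_right_mono)
  from hahn_banach[OF P J \<Psi> this] obtain \<theta> where \<theta>: "linear \<theta>" "\<And>x. \<theta> x \<le> norm x"
    "\<And>c. \<theta> (c *\<^sub>C w) = norm w * Re c" by blast
  obtain g :: "'a cdual" where g: "\<And>x. Re (capply g x) = \<theta> x"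
    using complexified_functional[OF \<theta>(1), of 1] \<theta>(2) by (metis mult_1 zero_le_one)
  have "capply g w = norm w"
    using g[of w] g[of "\<i> *\<^sub>C w"] \<theta>(3)[of 1] \<theta>(3)[of \<i>]
    by (simp add: capply_simps scaleC_complex_def complex_eq_iff)
  hence "capply (complex_of_real (inverse (norm w)) *\<^sub>C g) w = 1"
    using assms by (simp add: capply_scaleC scaleC_complex_def)
  thus ?thesis by (rule that)
qed

definition rank_one :: "'b::complex_banach \<Rightarrow> 'a::complex_banach cdual \<Rightarrow> ('a, 'b) cblinfun"
  where "rank_one u g = cblinfun_of (\<lambda>x. capply g x *\<^sub>C u)"

lemma
  shows capply_rank_one: "capply (rank_one u g) x = capply g x *\<^sub>C u"
    and norm_rank_one: "norm (rank_one u g) \<le> norm g * norm u"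
proof -
  have *: "capply g (x + y) *\<^sub>C u = capply g x *\<^sub>C u + capply g y *\<^sub>C u"
    "capply g (c *\<^sub>C x) *\<^sub>C u = c *\<^sub>C capply g x *\<^sub>C u"
    "norm (capply g x *\<^sub>C u) \<le> (norm g * norm u) * norm x" for x y c
    using mult_right_mono[OF norm_capply[of g x] norm_ge_zero[of u]]
    by (simp_all add: capply_simps scaleC_add_left scaleC_complex_def scaleC_scaleC norm_scaleC ac_simps)
  show "capply (rank_one u g) x = capply g x *\<^sub>C u"
    unfolding rank_one_def using capply_cblinfun_of[of "\<lambda>x. capply g x *\<^sub>C u", OF *] by simp
  show "norm (rank_one u g) \<le> norm g * norm u"
    unfolding rank_one_def using norm_cblinfun_of[of "\<lambda>x. capply g x *\<^sub>C u", OF *] by simp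
qed

lemma rank_one_add_left: "rank_one (u + v) g = rank_one u g + rank_one v g"
  and rank_one_scaleC_left: "rank_one (c *\<^sub>C u) g = c *\<^sub>C rank_one u g"
  and rank_one_scaleC_right: "rank_one u (c *\<^sub>C g) = c *\<^sub>C rank_one u g"
  by (auto intro!: capply_eqI simp: capply_rank_one capply_simps capply_scaleC scaleC_add_right
      scaleC_add_left scaleC_scaleC scaleC_complex_def mult.commute)

lemma ccompose_rank_one: "ccompose T (rank_one u g) = rank_one (capply T u) g"
  and rank_one_ccompose: "ccompose (rank_one u g) S = rank_one u (ccompose g S)"
  by (auto intro!: capply_eqI simp: capply_ccompose capply_rank_one capply_simps)

abbreviation rank_one_span :: "('a::complex_banach, 'b::complex_banach) cblinfun set"
  where "rank_one_span \<equiv> complex_vector.span (range (\<lambda>(u, g). rank_one u g))"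

lemma rank_one_in_span: "rank_one u g \<in> rank_one_span"
  by (rule complex_vector.span_base) (auto intro!: image_eqI[of _ _ "(u, g)"])

lemma ccompose_rank_one_span: "T \<in> rank_one_span \<Longrightarrow> ccompose T S \<in> rank_one_span"
proof (induction rule: complex_vector.span_induct_alt)
  case base
  then show ?case
    by (simp add: bounded_bilinear.zero_left[OF bounded_bilinear_ccompose] complex_vector.span_zero)
next
  case (step c x y)
  then obtain u g where "x = rank_one u g" by auto
  hence "ccompose (c *\<^sub>C x + y) S = c *\<^sub>C rank_one u (ccompose g S) + ccompose y S"
    by (intro capply_eqI) (simp add: capply_ccompose capply_simps capply_scaleC capply_rank_one)
  with step show ?case
    by (auto intro: complex_vector.span_add complex_vector.span_scale rank_one_in_span)
qed

text \<open>Adding one vector \<open>b\<close> at a time: if \<open>P\<close> fixes the span so far and \<open>w = b - P b\<close> is not zero, then a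
  functional that is \<open>1\<close> on \<open>w\<close>, composed with \<open>id - P\<close>, vanishes on the old span and gives the
  correction in the direction \<open>w\<close>. This replaces coordinate functionals, whose continuity would have
  to be proved separately.\<close>

lemma exists_projection_fixing:
  fixes B :: "'a::complex_banach set"
  assumes "finite B"
  obtains P where "P \<in> rank_one_span" "\<And>b. b \<in> complex_vector.span B \<Longrightarrow> capply P b = b"
proof -
  have "\<exists>P \<in> rank_one_span. \<forall>b\<in>B. capply P b = b"
    using assms
  proof induction
    case empty
    then show ?case using complex_vector.span_zero by blast
  next
    case (insert b B)
    then obtain P where P: "P \<in> rank_one_span" "\<And>b. b \<in> B \<Longrightarrow> capply P b = b" by blast
    define w where "w = b - capply P b"
    show ?case
    proof (cases "w = 0")
      case True
      then show ?thesis using P by (auto simp: w_def intro!: bexI[of _ P])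
    next
      case False
      from exists_functional_eq_one[OF False] obtain g :: "'a cdual" where g: "capply g w = 1" .
      have "P + rank_one w (g - ccompose g P) \<in> rank_one_span"
        by (intro complex_vector.span_add P rank_one_in_span)
      moreover have "capply (P + rank_one w (g - ccompose g P)) b' = b'" if "b' \<in> insert b B" for b'
      proof -
        have "capply (P + rank_one w (g - ccompose g P)) b' = capply P b' + capply g (b' - capply P b') *\<^sub>C w"
          by (simp add: capply_simps capply_rank_one capply_ccompose)
        also have "\<dots> = b'"
        proof (cases "b' \<in> B")
          case True
          then show ?thesis by (simp add: P(2) capply_simps)
        next
          case False
          with that have "b' = b" by simp
          then show ?thesis using g by (simp add: w_def)
        qed
        finally show ?thesis .
      qed
      ultimately show ?thesis by blast
    qed
  qed
  then obtain P where P: "P \<in> rank_one_span" "\<And>b. b \<in> B \<Longrightarrow> capply P b = b" by blast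
  have "capply P b = b" if "b \<in> complex_vector.span B" for b
    using that by (induction rule: complex_vector.span_induct_alt) (simp_all add: capply_simps P)
  with P(1) show ?thesis by (rule that)
qed

lemma finite_rank_iff: "finite_rank T \<longleftrightarrow> T \<in> rank_one_span"
proof
  assume "finite_rank T"
  then obtain B where B: "finite B" "range (capply T) \<subseteq> complex_vector.span B"
    unfolding finite_rank_def by blast
  obtain P where P: "P \<in> rank_one_span" "\<And>b. b \<in> complex_vector.span B \<Longrightarrow> capply P b = b"
    using exists_projection_fixing[OF B(1)] by blast
  have "T = ccompose P T"
    using P(2)[OF subsetD[OF B(2) rangeI]] by (intro capply_eqI) (simp add: capply_ccompose)
  thus "T \<in> rank_one_span"
    using ccompose_rank_one_span[OF P(1), of T] by simp
next
  assume "T \<in> rank_one_span"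
  thus "finite_rank T"
  proof (induction rule: complex_vector.span_induct_alt)
    case (step c x y)
    then obtain u g where "x = rank_one u g" by auto
    moreover have "finite_rank (rank_one u g)"
      unfolding finite_rank_def
      by (rule exI[of _ "{u}"]) (auto simp: capply_rank_one complex_vector.span_base intro: complex_vector.span_scale)
    ultimately show ?case using step by (auto intro: finite_rank_add finite_rank_scaleC)
  qed (rule finite_rank_zero)
qed

lemma approximable_eq: "approximable = closure rank_one_span"
  by (simp add: approximable_def finite_rank_iff)

lemma rank_one_approximable: "rank_one u g \<in> approximable"
  unfolding approximable_eq using closure_subset rank_one_in_span by blast

section \<open>Functionals on the approximable operators\<close>

definition functional_on :: "'a::complex_banach set \<Rightarrow> real \<Rightarrow> ('a \<Rightarrow> complex) \<Rightarrow> bool"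
  where "functional_on V K \<psi> \<longleftrightarrow> 0 \<le> K \<and> (\<forall>a\<in>V. \<forall>b\<in>V. \<psi> (a + b) = \<psi> a + \<psi> b) \<and>
    (\<forall>k. \<forall>a\<in>V. \<psi> (k *\<^sub>C a) = k * \<psi> a) \<and> (\<forall>a\<in>V. cmod (\<psi> a) \<le> K * norm a)"

lemma functional_onI:
  assumes "0 \<le> K" "\<And>a b. a \<in> V \<Longrightarrow> b \<in> V \<Longrightarrow> \<psi> (a + b) = \<psi> a + \<psi> b"
    "\<And>k a. a \<in> V \<Longrightarrow> \<psi> (k *\<^sub>C a) = k * \<psi> a" "\<And>a. a \<in> V \<Longrightarrow> cmod (\<psi> a) \<le> K * norm a"
  shows "functional_on V K \<psi>"
  using assms by (simp add: functional_on_def)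

lemma functional_onD:
  assumes "functional_on V K \<psi>"
  shows "0 \<le> K" "\<And>a b. a \<in> V \<Longrightarrow> b \<in> V \<Longrightarrow> \<psi> (a + b) = \<psi> a + \<psi> b"
    "\<And>k a. a \<in> V \<Longrightarrow> \<psi> (k *\<^sub>C a) = k * \<psi> a" "\<And>a. a \<in> V \<Longrightarrow> cmod (\<psi> a) \<le> K * norm a"
  using assms by (simp_all add: functional_on_def)

lemmas approximable_subspace = banach_algebra.subspace[OF banach_algebra_approximable]
lemmas approximable_add = complex_vector.subspace_add[OF approximable_subspace]
lemmas approximable_diff = complex_vector.subspace_diff[OF approximable_subspace]
lemmas approximable_scaleC = complex_vector.subspace_scale[OF approximable_subspace]
lemmas approximable_sum = complex_vector.subspace_sum[OF approximable_subspace]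
lemmas approximable_ccompose = banach_algebra.mul_closed[OF banach_algebra_approximable]

lemma functional_on_diff:
  assumes \<psi>: "functional_on approximable K \<psi>" and "a \<in> approximable" "b \<in> approximable"
  shows "\<psi> (a - b) = \<psi> a - \<psi> b"
  using functional_onD(2)[OF \<psi>, of "a - b" b] assms by (simp add: approximable_diff)

lemma functional_on_sum:
  assumes \<psi>: "functional_on approximable K \<psi>" and T: "\<And>i. i \<in> I \<Longrightarrow> T i \<in> approximable"
  shows "\<psi> (\<Sum>i\<in>I. T i) = (\<Sum>i\<in>I. \<psi> (T i))"
proof -
  have zero: "\<psi> 0 = 0"
    using functional_on_diff[OF \<psi>, of 0 0] complex_vector.subspace_0[OF approximable_subspace] by simp
  show ?thesis
    using T
  proof (induction I rule: infinite_finite_induct)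
    case (insert i I)
    then show ?case
      using functional_onD(2)[OF \<psi>, of "T i" "sum T I"] by (simp add: approximable_sum)
  qed (simp_all add: zero)
qed

lemma functional_on_tendsto:
  assumes \<psi>: "functional_on approximable K \<psi>"
    and T: "\<And>n. T n \<in> approximable" "S \<in> approximable" "T \<longlonglongrightarrow> S"
  shows "(\<lambda>n. \<psi> (T n)) \<longlonglongrightarrow> \<psi> S"
proof (rule LIM_zero_cancel, rule Lim_null_comparison)
  have "cmod (\<psi> (T n) - \<psi> S) \<le> K * norm (T n - S)" for n
    using functional_onD(4)[OF \<psi>, of "T n - S"] T by (simp add: approximable_diff functional_on_diff[OF \<psi>])
  thus "\<forall>\<^sub>F n in sequentially. cmod (\<psi> (T n) - \<psi> S) \<le> K * norm (T n - S)" by simp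
  show "(\<lambda>n. K * norm (T n - S)) \<longlonglongrightarrow> 0"
    using tendsto_mult_right_zero[OF tendsto_norm_zero[OF LIM_zero[OF T(3)]]] by simp
qed

lemma approximable_limit:
  assumes "S \<in> approximable"
  obtains T where "\<forall>n. T n \<in> rank_one_span" "T \<longlonglongrightarrow> S"
proof -
  from assms obtain T where T: "(\<forall>n. T n \<in> rank_one_span) \<and> T \<longlonglongrightarrow> S"
    unfolding approximable_eq closure_sequential ..
  show ?thesis by (rule that[OF conjunct1[OF T] conjunct2[OF T]])
qed

lemma rank_one_span_approximable: "T \<in> rank_one_span \<Longrightarrow> T \<in> approximable"
  unfolding approximable_eq using closure_subset by blast

text \<open>The span of the rank one operators is dense, so they determine a bounded functional.\<close>

lemma functional_on_eqI:
  fixes \<psi> \<omega> :: "('a::complex_banach, 'a) cblinfun \<Rightarrow> complex"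
  assumes \<psi>: "functional_on approximable K \<psi>" and \<omega>: "functional_on approximable L \<omega>"
    and eq: "\<And>u g. \<psi> (rank_one u g) = \<omega> (rank_one u g)" and S: "S \<in> approximable"
  shows "\<psi> S = \<omega> S"
proof -
  have span: "T \<in> approximable \<and> \<psi> T = \<omega> T" if "T \<in> rank_one_span" for T
    using that
  proof (induction rule: complex_vector.span_induct_alt)
    case base
    show ?case
      using functional_on_sum[OF \<psi>, of "{}"] functional_on_sum[OF \<omega>, of "{}"] complex_vector.subspace_0[OF approximable_subspace]
      by simp
  next
    case (step c x y)
    then obtain u g where "x = rank_one u g" by auto
    then show ?case
      using step.IH eq rank_one_approximable[of u g]
      by (simp add: functional_onD[OF \<psi>] functional_onD[OF \<omega>] approximable_scaleC approximable_add)
  qed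
  from approximable_limit[OF S]
  obtain T where T: "\<forall>n. T n \<in> rank_one_span" "T \<longlonglongrightarrow> S" .
  have "(\<lambda>n. \<psi> (T n)) \<longlonglongrightarrow> \<psi> S" "(\<lambda>n. \<omega> (T n)) \<longlonglongrightarrow> \<omega> S"
    using T S by (auto intro!: functional_on_tendsto[OF \<psi>] functional_on_tendsto[OF \<omega>]
        rank_one_span_approximable)
  thus ?thesis
    using T(1) by (intro LIMSEQ_unique[of "\<lambda>n. \<psi> (T n)"]) (simp_all add: span)
qed

section \<open>Adjoints\<close>

definition adjoint_op :: "('a::complex_banach, 'b::complex_banach) cblinfun \<Rightarrow> ('b cdual, 'a cdual) cblinfun"
  where "adjoint_op T = cblinfun_of (\<lambda>g. ccompose g T)"

definition evaluation :: "'a::complex_banach \<Rightarrow> 'a cdual cdual"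
  where "evaluation x = cblinfun_of (\<lambda>g. capply g x)"

lemma
  shows capply_adjoint: "capply (adjoint_op T) g = ccompose g T"
    and norm_adjoint: "norm (adjoint_op T) \<le> norm T"
proof -
  have *: "ccompose (g + h) T = ccompose g T + ccompose h T" "ccompose (c *\<^sub>C g) T = c *\<^sub>C ccompose g T"
    "norm (ccompose g T) \<le> norm T * norm g" for g h :: "'b cdual" and c
    using norm_ccompose[of g T]
    by (auto intro!: capply_eqI simp: capply_ccompose capply_simps capply_scaleC mult.commute[of "norm T"])
  show "capply (adjoint_op T) g = ccompose g T" "norm (adjoint_op T) \<le> norm T"
    unfolding adjoint_op_def
    using capply_cblinfun_of[of "\<lambda>g. ccompose g T", OF *] norm_cblinfun_of[of "\<lambda>g. ccompose g T", OF *]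
    by simp_all
qed

lemma capply_evaluation: "capply (evaluation x) g = capply g x"
  unfolding evaluation_def
  by (subst capply_cblinfun_of[of _ "norm x"])
    (simp_all add: capply_simps capply_scaleC scaleC_complex_def norm_capply mult.commute[of "norm x"])

lemma adjoint_add: "adjoint_op (S + T) = adjoint_op S + adjoint_op T"
  and adjoint_diff: "adjoint_op (S - T) = adjoint_op S - adjoint_op T"
  and adjoint_scaleC: "adjoint_op (c *\<^sub>C T) = c *\<^sub>C adjoint_op T"
  by (auto intro!: capply_eqI simp: capply_adjoint capply_ccompose capply_simps capply_scaleC)

lemma adjoint_rank_one: "adjoint_op (rank_one x f) = rank_one f (evaluation x)"
  by (auto intro!: capply_eqI simp: capply_adjoint capply_ccompose capply_rank_one capply_evaluation
      capply_simps capply_scaleC scaleC_complex_def)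

text \<open>Adjoints of rank one operators have rank one, with an evaluation functional as second factor. The
  embedding is thus visible on the dense span, and it is a contraction.\<close>

lemma adjoint_approximable:
  fixes T :: "('a::complex_banach, 'a) cblinfun"
  assumes "T \<in> approximable" shows "adjoint_op T \<in> approximable"
proof -
  have span: "adjoint_op S \<in> rank_one_span" if "S \<in> rank_one_span" for S :: "('a, 'a) cblinfun"
    using that
  proof (induction rule: complex_vector.span_induct_alt)
    case base
    have "adjoint_op 0 = (0 :: ('a cdual, 'a cdual) cblinfun)"
      using adjoint_diff[of 0 "0 :: ('a, 'a) cblinfun"] by simp
    then show ?case by (simp add: complex_vector.span_zero)
  next
    case (step c x y)
    then show ?case
      by (auto simp: adjoint_add adjoint_scaleC adjoint_rank_one
          intro!: complex_vector.span_add complex_vector.span_scale rank_one_in_span)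
  qed
  from approximable_limit[OF assms]
  obtain S where S: "\<forall>n. S n \<in> rank_one_span" "S \<longlonglongrightarrow> T" .
  have "(\<lambda>n. adjoint_op (S n)) \<longlonglongrightarrow> adjoint_op T"
  proof (rule LIM_zero_cancel, rule Lim_null_comparison)
    show "\<forall>\<^sub>F n in sequentially. norm (adjoint_op (S n) - adjoint_op T) \<le> norm (S n - T)"
      by (simp add: norm_adjoint flip: adjoint_diff)
    show "(\<lambda>n. norm (S n - T)) \<longlonglongrightarrow> 0"
      by (rule tendsto_norm_zero[OF LIM_zero[OF S(2)]])
  qed
  thus ?thesis
    unfolding approximable_eq closure_sequential
    using S(1) span by (intro exI[of _ "\<lambda>n. adjoint_op (S n)"]) simp
qed

section \<open>A trace inequality from the Hahn-Banach theorem\<close>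

text \<open>The Hahn-Banach theorem will be applied to a space of vector valued functions on a finite index
  set, taken here as all functions on a type with a seminorm that sees only finitely many values.\<close>

instantiation "fun" :: (type, real_vector) real_vector
begin

definition scaleR_fun :: "real \<Rightarrow> ('a \<Rightarrow> 'b) \<Rightarrow> 'a \<Rightarrow> 'b"
  where "scaleR_fun r f = (\<lambda>x. r *\<^sub>R f x)"

instance
  by standard (simp_all add: scaleR_fun_def fun_eq_iff scaleR_add_right scaleR_add_left)

end

lemma scaleR_fun_apply [simp]: "(r *\<^sub>R f) x = r *\<^sub>R f x"
  by (simp add: scaleR_fun_def)

definition single :: "'i \<Rightarrow> 'a \<Rightarrow> 'i \<Rightarrow> 'a::zero"
  where "single i x = (\<lambda>j. if j = i then x else 0)"

lemma single_apply: "single i x j = (if j = i then x else 0)"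
  by (simp add: single_def)

lemma single_add: "single i (x + y) = single i x + single i (y :: 'a::monoid_add)"
  by (auto simp: single_def)

lemma single_scaleR: "single i (r *\<^sub>R x) = r *\<^sub>R single i (x :: 'a::real_vector)"
  by (auto simp: single_def)

lemma linear_single: "linear (single i :: 'a::real_vector \<Rightarrow> 'i \<Rightarrow> 'a)"
  by (rule linearI) (rule single_add, rule single_scaleR)

lemma sum_fun_apply: "(\<Sum>i\<in>I. f i) x = (\<Sum>i\<in>I. f i x :: 'a::comm_monoid_add)"
  by (induction I rule: infinite_finite_induct) simp_all

text \<open>The values of finitely many functionals on the unit ball form a bounded set in a finite dimensional
  space. Each coordinate is rounded to a finite \<open>\<delta>/2\<close>-net, and one point is kept for each rounded tuple
  that occurs.\<close>

lemma finite_net_for_functionals: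
  fixes f :: "'i \<Rightarrow> 'a::complex_banach cdual"
  assumes "finite I" and \<delta>: "\<delta> > 0"
  obtains Y where "finite Y" "Y \<noteq> {}" "\<And>y. y \<in> Y \<Longrightarrow> norm y \<le> 1"
    "\<And>x. norm x \<le> 1 \<Longrightarrow> \<exists>y\<in>Y. \<forall>i\<in>I. cmod (capply (f i) x - capply (f i) y) < \<delta>"
proof -
  have "\<exists>C. finite C \<and> cball (0::complex) (norm (f i)) \<subseteq> (\<Union>c\<in>C. ball c (\<delta> / 2))" for i
    using compact_cball[of "0 :: complex" "norm (f i)"] half_gt_zero[OF \<delta>]
    unfolding compact_eq_totally_bounded by blast
  then have "\<forall>i. \<exists>C. finite C \<and> cball (0::complex) (norm (f i)) \<subseteq> (\<Union>c\<in>C. ball c (\<delta> / 2))" ..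
  from choice[OF this] obtain C
    where "\<forall>i. finite (C i) \<and> cball (0::complex) (norm (f i)) \<subseteq> (\<Union>c\<in>C i. ball c (\<delta> / 2))" ..
  hence C: "finite (C i)" "cball (0::complex) (norm (f i)) \<subseteq> (\<Union>c\<in>C i. ball c (\<delta> / 2))" for i
    by simp_all
  have "\<exists>c\<in>C i. cmod (capply (f i) x - c) < \<delta> / 2" if "norm x \<le> 1" for x i
  proof -
    have "norm (capply (f i) x) \<le> norm (f i)"
      using norm_capply[of "f i" x] mult_left_le[OF that norm_ge_zero[of "f i"]] by linarith
    hence "capply (f i) x \<in> (\<Union>c\<in>C i. ball c (\<delta> / 2))"
      using C(2)[of i] by (auto simp: subset_iff)
    thus ?thesis by (auto simp: dist_norm norm_minus_commute)
  qed
  then obtain c where c: "\<And>x i. norm x \<le> 1 \<Longrightarrow> c x i \<in> C i"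
    "\<And>x i. norm x \<le> 1 \<Longrightarrow> cmod (capply (f i) x - c x i) < \<delta> / 2"
    by metis
  define h where "h x = restrict (c x) I" for x
  define B where "B = {x::'a. norm x \<le> 1}"
  have "finite (h ` B)"
    by (rule finite_subset[OF _ finite_PiE[OF assms(1), of C]]) (auto simp: h_def B_def c C(1))
  then obtain Y where Y: "Y \<subseteq> B" "finite Y" "h ` B = h ` Y"
    by (rule finite_subset_image[OF _ subset_refl, elim_format]) blast
  have "\<exists>y\<in>Y. \<forall>i\<in>I. cmod (capply (f i) x - capply (f i) y) < \<delta>" if x: "norm x \<le> 1" for x
  proof -
    have "h x \<in> h ` Y" using x Y(3) by (auto simp: B_def)
    then obtain y where y: "y \<in> Y" "h x = h y" by blast
    have "norm y \<le> 1" using y(1) Y(1) by (auto simp: B_def)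
    have "cmod (capply (f i) x - capply (f i) y) < \<delta>" if "i \<in> I" for i
    proof -
      have "c x i = c y i" using y(2) that by (auto simp: h_def fun_eq_iff dest: spec[of _ i])
      with c(2)[OF x, of i] c(2)[OF \<open>norm y \<le> 1\<close>, of i] show ?thesis
        using norm_triangle_ineq4[of "capply (f i) x - c x i" "capply (f i) y - c x i"] by simp
    qed
    with y(1) show ?thesis by blast
  qed
  moreover have "Y \<noteq> {}"
    using Y(3) norm_zero[where 'a = 'a] zero_le_one unfolding B_def by (metis (mono_tags, lifting) empty_iff image_is_empty mem_Collect_eq)
  ultimately show ?thesis using Y by (intro that[of Y]) (auto simp: B_def)
qed

text \<open>The functional \<open>\<psi>\<^sub>f\<close> of the introduction. As a function of \<open>f\<close> it is the integral operator that
  represents \<open>\<psi>\<close> under trace duality.\<close>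

definition operator_functional :: "(('a::complex_banach, 'a) cblinfun \<Rightarrow> complex) \<Rightarrow> 'a cdual \<Rightarrow> 'a cdual"
  where "operator_functional \<psi> f = cblinfun_of (\<lambda>x. \<psi> (rank_one x f))"

lemma capply_operator_functional:
  assumes \<psi>: "functional_on approximable K \<psi>"
  shows "capply (operator_functional \<psi> f) x = \<psi> (rank_one x f)"
proof -
  have "capply (cblinfun_of (\<lambda>x. \<psi> (rank_one x f))) = (\<lambda>x. \<psi> (rank_one x f))"
  proof (rule capply_cblinfun_of)
    fix x
    show "cmod (\<psi> (rank_one x f)) \<le> (K * norm f) * norm x"
      using functional_onD(4)[OF \<psi> rank_one_approximable, of x f]
        mult_left_mono[OF norm_rank_one[of x f] functional_onD(1)[OF \<psi>]] by (simp add: mult.assoc)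
  qed (simp_all add: rank_one_add_left rank_one_scaleC_left functional_onD[OF \<psi>] rank_one_approximable
      scaleC_complex_def)
  thus ?thesis by (simp add: operator_functional_def)
qed

lemma norm_cblinfun_bound_unit:
  assumes "0 \<le> K" "\<And>x. norm x \<le> 1 \<Longrightarrow> norm (capply T x) \<le> K"
  shows "norm T \<le> K"
proof (rule norm_cblinfun_bound[OF assms(1)])
  fix x
  show "norm (capply T x) \<le> K * norm x"
  proof (cases "x = 0")
    case False
    then show ?thesis
      using assms(2)[of "inverse (norm x) *\<^sub>R x"] by (simp add: capply_simps field_simps)
  qed (simp add: capply_simps)
qed

lemma exists_almost_norming:
  fixes g :: "'a::complex_banach cdual"
  obtains x where "norm x \<le> 1" "norm g \<le> 2 * Re (capply g x)"
proof (cases "norm g = 0")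
  case True
  then show ?thesis using that[of 0] by (simp add: capply_simps)
next
  case False
  have "\<exists>x. norm x \<le> 1 \<and> norm g / 2 < cmod (capply g x)"
  proof (rule ccontr)
    assume "\<nexists>x. norm x \<le> 1 \<and> norm g / 2 < cmod (capply g x)"
    hence "norm g \<le> norm g / 2"
      by (intro norm_cblinfun_bound_unit) (auto simp: not_less)
    with False show False by simp
  qed
  then obtain x where x: "norm x \<le> 1" "norm g / 2 < cmod (capply g x)" by blast
  \<comment> \<open>Rotating \<open>x\<close> makes the value real and positive.\<close>
  define c where "c = cnj (sgn (capply g x))"
  have nz: "capply g x \<noteq> 0" using x(2) by auto
  have "capply g (c *\<^sub>C x) = cmod (capply g x)"
    using nz by (simp add: capply_simps scaleC_complex_def c_def sgn_eq complex_norm_square[symmetric]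
        field_simps power2_eq_square)
  moreover have "norm (c *\<^sub>C x) \<le> 1"
    using x(1) nz by (simp add: norm_scaleC c_def norm_sgn)
  ultimately show ?thesis using x(2) by (intro that[of "c *\<^sub>C x"]) auto
qed

lemma cdual_eqI_Re:
  fixes g h :: "'a::complex_banach cdual"
  assumes "\<And>x. Re (capply g x) = Re (capply h x)"
  shows "g = h"
proof (rule capply_eqI)
  fix x
  show "capply g x = capply h x"
    using assms[of x] assms[of "\<i> *\<^sub>C x"] by (simp add: capply_simps scaleC_complex_def complex_eq_iff)
qed

text \<open>For operators \<open>p = \<Sum>\<^sub>i rank_one x\<^sub>i f\<^sub>i\<close> the norm is the supremum of \<open>\<parallel>p z\<parallel>\<close> over the unit ball, which the
  net \<open>Y\<close> replaces by a maximum over finitely many points, up to \<open>\<delta> \<Sum>\<^sub>i \<parallel>x\<^sub>i\<parallel>\<close>. So \<open>\<psi> p\<close> is bounded by a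
  seminorm of the finite family consisting of the \<open>p y\<close> and the \<open>x\<^sub>i\<close>, and by the Hahn-Banach theorem it
  is a sum of functionals \<open>\<theta> y\<close> of \<open>p y\<close> and \<open>\<rho> i\<close> of \<open>x\<^sub>i\<close>. Reading off the coefficient of \<open>x\<^sub>i\<close> gives the
  decomposition. Replacing the supremum by a finite maximum is the essential step, because in place of
  \<open>\<theta>\<close> one would otherwise obtain only a finitely additive measure, with which a functional from the
  second dual cannot be interchanged.\<close>

lemma operator_functional_decomposition:
  fixes f :: "'i \<Rightarrow> 'a::complex_banach cdual"
  assumes \<psi>: "functional_on approximable K \<psi>" and I: "finite I" and \<delta>: "\<delta> > 0"
  obtains Y \<theta> \<rho> where "\<And>y. y \<in> Y \<Longrightarrow> norm y \<le> 1" "(\<Sum>y\<in>Y. norm (\<theta> y)) \<le> 2 * K"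
    "\<And>i. i \<in> I \<Longrightarrow> norm (\<rho> i) \<le> 2 * K * \<delta>"
    "\<And>i. i \<in> I \<Longrightarrow> operator_functional \<psi> (f i) = (\<Sum>y\<in>Y. capply (f i) y *\<^sub>C \<theta> y) + \<rho> i"
proof -
  have K: "0 \<le> K" by (rule functional_onD(1)[OF \<psi>])
  obtain Y where Y: "finite Y" "Y \<noteq> {}" "\<And>y. y \<in> Y \<Longrightarrow> norm y \<le> 1"
    and net: "\<And>x. norm x \<le> 1 \<Longrightarrow> \<exists>y\<in>Y. \<forall>i\<in>I. cmod (capply (f i) x - capply (f i) y) < \<delta>"
    by (rule finite_net_for_functionals[OF I \<delta>, of f]) blast
  define p where "p x = (\<Sum>i\<in>I. rank_one (x i) (f i))" for x :: "'i \<Rightarrow> 'a"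
  \<comment> \<open>The finite family of the \<open>p y\<close> for \<open>y \<in> Y\<close> and the \<open>x\<^sub>i\<close>, as one function on a sum type.\<close>
  define J where "J x = case_sum (\<lambda>y. if y \<in> Y then capply (p x) y else 0) (\<lambda>i. if i \<in> I then x i else 0)"
    for x :: "'i \<Rightarrow> 'a"
  \<comment> \<open>The seminorm that dominates \<open>\<psi>\<close>: a maximum over \<open>Y\<close> plus the error term of the net.\<close>
  define P where "P v = K * (Max ((\<lambda>y. norm (v (Inl y))) ` Y) + \<delta> * (\<Sum>i\<in>I. norm (v (Inr i))))"
    for v :: "'a + 'i \<Rightarrow> 'a"
  define \<Psi> where "\<Psi> x = Re (\<psi> (p x))" for x
  have p_apply: "capply (p x) y = (\<Sum>i\<in>I. capply (f i) y *\<^sub>C x i)" for x y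
    by (simp add: p_def capply_sum capply_rank_one)
  have p_approx: "p x \<in> approximable" for x
    by (simp add: p_def approximable_sum rank_one_approximable)
  have p_add: "p (x + y) = p x + p y" and p_scaleR: "p (r *\<^sub>R x) = complex_of_real r *\<^sub>C p x" for x y r
    by (auto intro!: capply_eqI simp: p_apply capply_simps capply_scaleC scaleC_add_right sum.distrib
        complex_vector.scale_sum_right scaleC_of_real[symmetric] mult.commute)
  have Max_le: "Max ((\<lambda>y. norm (v (Inl y))) ` Y) \<le> B \<longleftrightarrow> (\<forall>y\<in>Y. norm (v (Inl y)) \<le> B)"
    for v :: "'a + 'i \<Rightarrow> 'a" and B
    using Y by simp
  have le_Max: "norm (v (Inl y)) \<le> Max ((\<lambda>y. norm (v (Inl y))) ` Y)" if "y \<in> Y" for v :: "'a + 'i \<Rightarrow> 'a" and y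
    using Y that by simp
  have P_le: "P v \<le> K * (B + \<delta> * C)"
    if "\<And>y. y \<in> Y \<Longrightarrow> norm (v (Inl y)) \<le> B" "(\<Sum>i\<in>I. norm (v (Inr i))) \<le> C" for v B C
    unfolding P_def using that K \<delta> Y(1,2) by (intro mult_left_mono add_mono) simp_all
  have P: "sublinear P"
  proof (rule sublinearI)
    fix u v :: "'a + 'i \<Rightarrow> 'a"
    have "Max ((\<lambda>y. norm ((u + v) (Inl y))) ` Y)
        \<le> Max ((\<lambda>y. norm (u (Inl y))) ` Y) + Max ((\<lambda>y. norm (v (Inl y))) ` Y)"
      unfolding Max_le by (simp add: norm_triangle_mono le_Max)
    moreover
    have "(\<Sum>i\<in>I. norm ((u + v) (Inr i))) \<le> (\<Sum>i\<in>I. norm (u (Inr i))) + (\<Sum>i\<in>I. norm (v (Inr i)))"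
      unfolding sum.distrib[symmetric] by (intro sum_mono) (simp add: norm_triangle_ineq)
    with \<delta> have "\<delta> * (\<Sum>i\<in>I. norm ((u + v) (Inr i)))
        \<le> \<delta> * (\<Sum>i\<in>I. norm (u (Inr i))) + \<delta> * (\<Sum>i\<in>I. norm (v (Inr i)))"
      unfolding distrib_left[symmetric] by (intro mult_left_mono) simp_all
    ultimately show "P (u + v) \<le> P u + P v"
      unfolding P_def distrib_left[of K, symmetric] using K by (intro mult_left_mono) (simp_all add: distrib_left)
  next
    fix t :: real and v :: "'a + 'i \<Rightarrow> 'a" assume t: "t > 0"
    have "Max ((\<lambda>y. norm ((t *\<^sub>R v) (Inl y))) ` Y) \<le> t * Max ((\<lambda>y. norm (v (Inl y))) ` Y)"
      unfolding Max_le using le_Max[of _ v] t by simp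
    moreover have "(\<Sum>i\<in>I. norm ((t *\<^sub>R v) (Inr i))) = t * (\<Sum>i\<in>I. norm (v (Inr i)))"
      using t by (simp add: sum_distrib_left)
    ultimately show "P (t *\<^sub>R v) \<le> t * P v"
      unfolding P_def using K by (simp add: algebra_simps mult_left_mono)
  next
    show "P 0 \<le> 0" using Y by (simp add: P_def)
  qed
  have J: "linear J"
  proof (rule linearI)
    show "J (x + y) = J x + J y" for x y
      by (rule ext) (simp add: J_def p_add capply_simps split: sum.split)
    show "J (r *\<^sub>R x) = r *\<^sub>R J x" for r x
      by (rule ext) (simp add: J_def p_scaleR capply_simps scaleC_of_real split: sum.split)
  qed
  have \<Psi>: "linear \<Psi>"
    by (rule linearI) (simp_all add: \<Psi>_def p_add p_scaleR functional_onD[OF \<psi>] p_approx)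
  have le: "\<Psi> x \<le> P (J x)" for x
  proof -
    let ?M = "Max ((\<lambda>y. norm (J x (Inl y))) ` Y)"
    have M: "0 \<le> ?M" using Y by (auto simp: Max_ge_iff)
    have "norm (p x) \<le> ?M + \<delta> * (\<Sum>i\<in>I. norm (x i))"
    proof (rule norm_cblinfun_bound_unit)
      fix z :: 'a assume "norm z \<le> 1"
      then obtain y where y: "y \<in> Y" "\<And>i. i \<in> I \<Longrightarrow> cmod (capply (f i) z - capply (f i) y) < \<delta>"
        using net by blast
      have "norm (capply (p x) z - capply (p x) y) = norm (\<Sum>i\<in>I. (capply (f i) z - capply (f i) y) *\<^sub>C x i)"
        by (simp add: p_apply sum_subtractf complex_vector.scale_left_diff_distrib)
      also have "\<dots> \<le> (\<Sum>i\<in>I. \<delta> * norm (x i))"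
        by (intro sum_norm_le) (simp add: norm_scaleC mult_right_mono less_imp_le y(2))
      finally have "norm (capply (p x) z) \<le> norm (capply (p x) y) + \<delta> * (\<Sum>i\<in>I. norm (x i))"
        using norm_triangle_sub[of "capply (p x) z" "capply (p x) y"] by (simp add: sum_distrib_left)
      also have "norm (capply (p x) y) \<le> ?M"
        using le_Max[OF y(1), of "J x"] y(1) by (simp add: J_def)
      finally show "norm (capply (p x) z) \<le> ?M + \<delta> * (\<Sum>i\<in>I. norm (x i))" by simp
    qed (use M \<delta> in \<open>simp add: sum_nonneg\<close>)
    hence "K * norm (p x) \<le> P (J x)"
      unfolding P_def using K by (intro mult_left_mono) (simp_all add: J_def)
    moreover have "\<Psi> x \<le> K * norm (p x)"
      unfolding \<Psi>_def using functional_onD(4)[OF \<psi> p_approx, of x] complex_Re_le_cmod order_trans by blast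
    ultimately show ?thesis by linarith
  qed
  obtain \<Theta> where \<Theta>: "linear \<Theta>" "\<And>v. \<Theta> v \<le> P v" "\<And>x. \<Theta> (J x) = \<Psi> x"
    using hahn_banach[OF P J \<Psi>] le by blast
  have lin: "linear (\<lambda>x. \<Theta> (single s x))" for s
    using linear_compose[OF linear_single \<Theta>(1)] by (simp add: o_def)
  have "\<exists>g. (\<forall>x. Re (capply g x) = \<Theta> (single (Inl y) x))" if y: "y \<in> Y" for y
  proof -
    have "P (single (Inl y) x) \<le> K * norm x" for x
      using P_le[of "single (Inl y) x" "norm x" 0] by (simp add: single_apply)
    with \<Theta>(2) have "\<Theta> (single (Inl y) x) \<le> K * norm x" for x by (blast intro: order_trans)
    from complexified_functional[OF lin this K] show ?thesis by metis
  qed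
  then obtain \<theta> where \<theta>: "\<And>y x. y \<in> Y \<Longrightarrow> Re (capply (\<theta> y) x) = \<Theta> (single (Inl y) x)" by metis
  have "\<exists>g. (\<forall>x. Re (capply g x) = \<Theta> (single (Inr i) x)) \<and> norm g \<le> 2 * (K * \<delta>)" if i: "i \<in> I" for i
  proof -
    have "P (single (Inr i) x) \<le> (K * \<delta>) * norm x" for x
    proof -
      have "(\<Sum>j\<in>I. norm (single (Inr i) x (Inr j :: 'a + 'i))) = (\<Sum>j\<in>I. if j = i then norm x else 0)"
        by (rule sum.cong) (auto simp: single_apply)
      also have "\<dots> = norm x" using i I by simp
      finally show ?thesis
        using P_le[of "single (Inr i) x" 0 "norm x"] by (simp add: single_apply mult.assoc)
    qed
    with \<Theta>(2) have "\<Theta> (single (Inr i) x) \<le> (K * \<delta>) * norm x" for x by (blast intro: order_trans)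
    moreover have "0 \<le> K * \<delta>" using K \<delta> by simp
    ultimately show ?thesis using complexified_functional[OF lin] by metis
  qed
  then obtain \<rho> where \<rho>: "\<And>i x. i \<in> I \<Longrightarrow> Re (capply (\<rho> i) x) = \<Theta> (single (Inr i) x)"
    "\<And>i. i \<in> I \<Longrightarrow> norm (\<rho> i) \<le> 2 * (K * \<delta>)" by metis
  have "\<exists>x. norm x \<le> 1 \<and> norm (\<theta> y) \<le> 2 * Re (capply (\<theta> y) x)" for y
    using exists_almost_norming[of "\<theta> y"] by metis
  then obtain z where z: "\<And>y. norm (z y) \<le> 1" "\<And>y. norm (\<theta> y) \<le> 2 * Re (capply (\<theta> y) (z y))" by metis
  have "(\<Sum>y\<in>Y. norm (\<theta> y)) \<le> (\<Sum>y\<in>Y. 2 * \<Theta> (single (Inl y) (z y)))"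
    using z(2) by (intro sum_mono) (simp add: \<theta>[symmetric])
  also have "\<dots> = 2 * \<Theta> (\<Sum>y\<in>Y. single (Inl y) (z y))"
    by (simp add: linear_sum[OF \<Theta>(1)] sum_distrib_left)
  also have "\<dots> \<le> 2 * P (\<Sum>y\<in>Y. single (Inl y) (z y))" using \<Theta>(2) by simp
  also have "P (\<Sum>y\<in>Y. single (Inl y) (z y)) \<le> K * 1"
    using P_le[of "\<Sum>y\<in>Y. single (Inl y) (z y)" 1 0] Y(1) z(1)
    by (simp add: sum_fun_apply single_apply)
  finally have sum_\<theta>: "(\<Sum>y\<in>Y. norm (\<theta> y)) \<le> 2 * K" by simp
  have decomp: "operator_functional \<psi> (f i) = (\<Sum>y\<in>Y. capply (f i) y *\<^sub>C \<theta> y) + \<rho> i" if i: "i \<in> I" for i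
  proof (rule cdual_eqI_Re)
    fix u
    have p_single: "p (single i u) = rank_one u (f i)"
    proof (rule capply_eqI)
      fix y
      have "capply (p (single i u)) y = (\<Sum>j\<in>I. if j = i then capply (f i) y *\<^sub>C u else 0)"
        unfolding p_apply by (rule sum.cong) (auto simp: single_apply)
      thus "capply (p (single i u)) y = capply (rank_one u (f i)) y"
        using i I by (simp add: capply_rank_one)
    qed
    have "J (single i u) = (\<Sum>y\<in>Y. single (Inl y) (capply (f i) y *\<^sub>C u)) + single (Inr i) u"
      using Y(1) i
      by (intro ext) (auto simp: J_def p_single capply_rank_one sum_fun_apply single_apply split: sum.split)
    hence "\<Psi> (single i u) = (\<Sum>y\<in>Y. \<Theta> (single (Inl y) (capply (f i) y *\<^sub>C u))) + \<Theta> (single (Inr i) u)"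
      by (simp add: \<Theta>(3)[symmetric] linear_add[OF \<Theta>(1)] linear_sum[OF \<Theta>(1)])
    also have "\<dots> = (\<Sum>y\<in>Y. Re (capply (\<theta> y) (capply (f i) y *\<^sub>C u))) + Re (capply (\<rho> i) u)"
      using i by (simp add: \<theta> \<rho>(1))
    finally show "Re (capply (operator_functional \<psi> (f i)) u)
        = Re (capply ((\<Sum>y\<in>Y. capply (f i) y *\<^sub>C \<theta> y) + \<rho> i) u)"
      by (simp add: \<Psi>_def p_single capply_operator_functional[OF \<psi>] capply_simps capply_sum capply_scaleC)
  qed
  show ?thesis
    using Y(3) sum_\<theta> \<rho>(2) decomp by (intro that[of Y \<theta> \<rho>]) (simp_all add: mult.assoc)
qed

text \<open>Applying \<open>\<xi>\<^sub>i\<close> to the decomposition and summing, the main part becomes \<open>\<Sum>\<^sub>y (S (\<theta> y)) y\<close> with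
  \<open>S = \<Sum>\<^sub>i rank_one f\<^sub>i \<xi>\<^sub>i\<close>, an expression in which only the operator norm of \<open>S\<close> enters. The remainder is
  as small as desired.\<close>

lemma operator_functional_trace_bound:
  fixes f :: "'i \<Rightarrow> 'a::complex_banach cdual"
  assumes \<psi>: "functional_on approximable K \<psi>" and I: "finite I"
  shows "cmod (\<Sum>i\<in>I. capply (\<xi> i) (operator_functional \<psi> (f i)))
    \<le> 2 * K * norm (\<Sum>i\<in>I. rank_one (f i) (\<xi> i))"
proof (rule field_le_epsilon)
  fix e :: real assume e: "e > 0"
  have K: "0 \<le> K" by (rule functional_onD(1)[OF \<psi>])
  define S where "S = (\<Sum>i\<in>I. rank_one (f i) (\<xi> i))"
  define N where "N = (\<Sum>i\<in>I. norm (\<xi> i))"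
  have N: "0 \<le> N" by (simp add: N_def sum_nonneg)
  \<comment> \<open>The summand \<open>1\<close> only keeps the denominator positive.\<close>
  define \<delta> where "\<delta> = e / (2 * K * N + 1)"
  have \<delta>: "\<delta> > 0" using e K N by (simp add: \<delta>_def add_nonneg_pos)
  obtain Y \<theta> \<rho> where Y: "\<And>y. y \<in> Y \<Longrightarrow> norm y \<le> 1" and \<theta>: "(\<Sum>y\<in>Y. norm (\<theta> y)) \<le> 2 * K"
    and \<rho>: "\<And>i. i \<in> I \<Longrightarrow> norm (\<rho> i) \<le> 2 * K * \<delta>"
    and decomp: "\<And>i. i \<in> I \<Longrightarrow> operator_functional \<psi> (f i) = (\<Sum>y\<in>Y. capply (f i) y *\<^sub>C \<theta> y) + \<rho> i"
    by (rule operator_functional_decomposition[OF \<psi> I \<delta>, of f]) blast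
  have "(\<Sum>i\<in>I. capply (\<xi> i) (operator_functional \<psi> (f i)))
      = (\<Sum>i\<in>I. \<Sum>y\<in>Y. capply (f i) y * capply (\<xi> i) (\<theta> y)) + (\<Sum>i\<in>I. capply (\<xi> i) (\<rho> i))"
    by (simp add: decomp capply_simps capply_sum scaleC_complex_def sum.distrib)
  also have "(\<Sum>i\<in>I. \<Sum>y\<in>Y. capply (f i) y * capply (\<xi> i) (\<theta> y)) = (\<Sum>y\<in>Y. capply (capply S (\<theta> y)) y)"
    by (subst sum.swap) (simp add: S_def capply_sum capply_rank_one capply_scaleC scaleC_complex_def mult.commute)
  finally have "cmod (\<Sum>i\<in>I. capply (\<xi> i) (operator_functional \<psi> (f i)))
      \<le> cmod (\<Sum>y\<in>Y. capply (capply S (\<theta> y)) y) + cmod (\<Sum>i\<in>I. capply (\<xi> i) (\<rho> i))"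
    by (simp add: norm_triangle_ineq)
  also have "cmod (\<Sum>y\<in>Y. capply (capply S (\<theta> y)) y) \<le> (\<Sum>y\<in>Y. norm S * norm (\<theta> y))"
  proof (rule sum_norm_le)
    fix y assume "y \<in> Y"
    have "cmod (capply (capply S (\<theta> y)) y) \<le> norm (capply S (\<theta> y)) * norm y" by (rule norm_capply)
    also have "\<dots> \<le> norm (capply S (\<theta> y))" using Y[OF \<open>y \<in> Y\<close>] by (simp add: mult_left_le)
    also have "\<dots> \<le> norm S * norm (\<theta> y)" by (rule norm_capply)
    finally show "cmod (capply (capply S (\<theta> y)) y) \<le> norm S * norm (\<theta> y)" .
  qed
  also have "\<dots> \<le> norm S * (2 * K)"
    using \<theta> by (simp add: mult_left_mono flip: sum_distrib_left)
  also have "cmod (\<Sum>i\<in>I. capply (\<xi> i) (\<rho> i)) \<le> (\<Sum>i\<in>I. norm (\<xi> i) * (2 * K * \<delta>))"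
    using \<rho> by (intro sum_norm_le order_trans[OF norm_capply] mult_left_mono) auto
  also have "\<dots> = (2 * K * N) * \<delta>" by (simp add: N_def flip: sum_distrib_right)
  also have "\<dots> \<le> e"
    using e K N by (simp add: \<delta>_def divide_simps add_nonneg_pos)
  finally show "cmod (\<Sum>i\<in>I. capply (\<xi> i) (operator_functional \<psi> (f i)))
      \<le> 2 * K * norm (\<Sum>i\<in>I. rank_one (f i) (\<xi> i)) + e"
    by (simp add: S_def mult.commute)
qed

section \<open>Extension of functionals to operators on the dual\<close>

text \<open>A list of pairs \<open>(\<xi>, f)\<close> stands for a formal sum of elementary tensors. The operator that it
  defines does not determine the list, so the value of the extension is first assigned to lists.\<close>

definition tensor_op :: "('a::complex_banach cdual cdual \<times> 'a cdual) list \<Rightarrow> ('a cdual, 'a cdual) cblinfun"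
  where "tensor_op ps = (\<Sum>(\<xi>, f)\<leftarrow>ps. rank_one f \<xi>)"

definition tensor_val ::
  "(('a::complex_banach, 'a) cblinfun \<Rightarrow> complex) \<Rightarrow> ('a cdual cdual \<times> 'a cdual) list \<Rightarrow> complex"
  where "tensor_val \<psi> ps = (\<Sum>(\<xi>, f)\<leftarrow>ps. capply \<xi> (operator_functional \<psi> f))"

definition tensor_scale ::
  "complex \<Rightarrow> ('a::complex_banach cdual cdual \<times> 'a cdual) list \<Rightarrow> ('a cdual cdual \<times> 'a cdual) list"
  where "tensor_scale c ps = map (\<lambda>(\<xi>, f). (c *\<^sub>C \<xi>, f)) ps"

lemma tensor_append:
  "tensor_op (ps @ qs) = tensor_op ps + tensor_op qs"
  "tensor_val \<psi> (ps @ qs) = tensor_val \<psi> ps + tensor_val \<psi> qs"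
  by (simp_all add: tensor_op_def tensor_val_def)

lemma tensor_scale:
  "tensor_op (tensor_scale c ps) = c *\<^sub>C tensor_op ps"
  "tensor_val \<psi> (tensor_scale c ps) = c * tensor_val \<psi> ps"
  by (induction ps) (auto simp: tensor_op_def tensor_val_def tensor_scale_def rank_one_scaleC_right
      scaleC_add_right capply_scaleC scaleC_complex_def algebra_simps)

lemma tensor_val_bound:
  assumes \<psi>: "functional_on approximable K \<psi>"
  shows "cmod (tensor_val \<psi> ps) \<le> 2 * K * norm (tensor_op ps)"
  using operator_functional_trace_bound[OF \<psi>, of "{0..<length ps}" "\<lambda>i. fst (ps ! i)" "\<lambda>i. snd (ps ! i)"]
  by (simp add: tensor_val_def tensor_op_def sum_list_sum_nth case_prod_unfold)

text \<open>In particular the value depends only on the operator, and Lipschitz continuously so.\<close>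

lemma tensor_val_diff_bound:
  assumes \<psi>: "functional_on approximable K \<psi>"
  shows "cmod (tensor_val \<psi> ps - tensor_val \<psi> qs) \<le> 2 * K * norm (tensor_op ps - tensor_op qs)"
proof -
  have "(-1) *\<^sub>C x = - x" for x :: "('a cdual, 'a cdual) cblinfun"
    using scaleC_of_real[of "-1" x] by simp
  thus ?thesis
    using tensor_val_bound[OF \<psi>, of "ps @ tensor_scale (-1) qs"]
    by (simp add: tensor_append tensor_scale)
qed

lemma rank_one_span_eq_tensor_op:
  assumes "T \<in> rank_one_span" shows "\<exists>ps. tensor_op ps = T"
  using assms
proof (induction rule: complex_vector.span_induct_alt)
  case base
  show ?case by (rule exI[of _ "[]"]) (simp add: tensor_op_def)
next
  case (step c x y)
  then obtain f \<xi> ps where "x = rank_one f \<xi>" "tensor_op ps = y" by auto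
  hence "tensor_op ((c *\<^sub>C \<xi>, f) # ps) = c *\<^sub>C x + y"
    by (auto simp: tensor_op_def rank_one_scaleC_right)
  thus ?case by blast
qed

text \<open>The approximating lists depend on the operator alone. The extension is therefore a limit along
  the same lists for all functionals.\<close>

definition tensor_approx ::
  "('a::complex_banach cdual, 'a cdual) cblinfun \<Rightarrow> nat \<Rightarrow> ('a cdual cdual \<times> 'a cdual) list"
  where "tensor_approx S n = (SOME ps. norm (tensor_op ps - S) < inverse (real (Suc n)))"

lemma tensor_approx:
  assumes "S \<in> approximable"
  shows "(\<lambda>n. tensor_op (tensor_approx S n)) \<longlonglongrightarrow> S"
proof (rule LIM_zero_cancel, rule Lim_null_comparison)
  have "\<exists>ps. norm (tensor_op ps - S) < inverse (real (Suc n))" for n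
  proof -
    have "inverse (real (Suc n)) > 0" by simp
    then obtain T where "T \<in> rank_one_span" "dist T S < inverse (real (Suc n))"
      using assms unfolding approximable_eq closure_approachable by metis
    thus ?thesis using rank_one_span_eq_tensor_op by (metis dist_norm)
  qed
  hence "norm (tensor_op (tensor_approx S n) - S) < inverse (real (Suc n))" for n
    unfolding tensor_approx_def by (rule someI_ex)
  thus "\<forall>\<^sub>F n in sequentially. norm (tensor_op (tensor_approx S n) - S) \<le> inverse (real (Suc n))"
    by (simp add: less_imp_le)
  show "(\<lambda>n. inverse (real (Suc n))) \<longlonglongrightarrow> 0" by (rule LIMSEQ_inverse_real_of_nat)
qed

definition extension ::
  "(('a::complex_banach, 'a) cblinfun \<Rightarrow> complex) \<Rightarrow> ('a cdual, 'a cdual) cblinfun \<Rightarrow> complex"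
  where "extension \<psi> S = lim (\<lambda>n. tensor_val \<psi> (tensor_approx S n))"

lemma tendsto_extension:
  assumes \<psi>: "functional_on approximable K \<psi>" and S: "S \<in> approximable"
    and ps: "(\<lambda>n. tensor_op (ps n)) \<longlonglongrightarrow> S"
  shows "(\<lambda>n. tensor_val \<psi> (ps n)) \<longlonglongrightarrow> extension \<psi> S"
proof -
  have K: "0 \<le> K" by (rule functional_onD(1)[OF \<psi>])
  let ?a = "tensor_approx S"
  have "Cauchy (\<lambda>n. tensor_val \<psi> (?a n))"
  proof (rule metric_CauchyI)
    fix e :: real assume e: "e > 0"
    have "Cauchy (\<lambda>n. tensor_op (?a n))"
      using tensor_approx[OF S] by (rule LIMSEQ_imp_Cauchy)
    moreover have "e / (2 * K + 1) > 0" using e K by simp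
    ultimately obtain N where N: "\<And>m n. m \<ge> N \<Longrightarrow> n \<ge> N \<Longrightarrow>
        dist (tensor_op (?a m)) (tensor_op (?a n)) < e / (2 * K + 1)"
      unfolding Cauchy_def by meson
    have "dist (tensor_val \<psi> (?a m)) (tensor_val \<psi> (?a n)) < e" if "m \<ge> N" "n \<ge> N" for m n
    proof -
      have "dist (tensor_val \<psi> (?a m)) (tensor_val \<psi> (?a n))
          \<le> 2 * K * dist (tensor_op (?a m)) (tensor_op (?a n))"
        unfolding dist_norm by (rule tensor_val_diff_bound[OF \<psi>])
      also have "\<dots> \<le> 2 * K * (e / (2 * K + 1))"
        using N[OF that] K by (intro mult_left_mono) auto
      also have "\<dots> < e" using e K by (simp add: field_simps)
      finally show ?thesis .
    qed
    thus "\<exists>N. \<forall>m\<ge>N. \<forall>n\<ge>N. dist (tensor_val \<psi> (?a m)) (tensor_val \<psi> (?a n)) < e" by blast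
  qed
  hence lim: "(\<lambda>n. tensor_val \<psi> (?a n)) \<longlonglongrightarrow> extension \<psi> S"
    unfolding extension_def by (simp add: Cauchy_convergent_iff convergent_LIMSEQ_iff)
  have "(\<lambda>n. tensor_val \<psi> (ps n) - tensor_val \<psi> (?a n)) \<longlonglongrightarrow> 0"
  proof (rule Lim_null_comparison)
    show "\<forall>\<^sub>F n in sequentially. norm (tensor_val \<psi> (ps n) - tensor_val \<psi> (?a n))
        \<le> 2 * K * norm (tensor_op (ps n) - tensor_op (?a n))"
      by (simp add: tensor_val_diff_bound[OF \<psi>])
    have "(\<lambda>n. tensor_op (ps n) - tensor_op (?a n)) \<longlonglongrightarrow> 0"
      using tendsto_diff[OF ps tensor_approx[OF S]] by simp
    thus "(\<lambda>n. 2 * K * norm (tensor_op (ps n) - tensor_op (?a n))) \<longlonglongrightarrow> 0"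
      by (intro tendsto_mult_right_zero tendsto_norm_zero)
  qed
  from tendsto_add[OF this lim] show ?thesis by simp
qed

lemma functional_on_extension:
  assumes \<psi>: "functional_on approximable K \<psi>"
  shows "functional_on approximable (2 * K) (extension \<psi>)"
proof (rule functional_onI)
  show "0 \<le> 2 * K" using functional_onD(1)[OF \<psi>] by simp
  note lim = tendsto_extension[OF \<psi> _ tensor_approx]
  fix S T :: "('a cdual, 'a cdual) cblinfun" and c
  assume S: "S \<in> approximable"
  have "(\<lambda>n. tensor_op (tensor_scale c (tensor_approx S n))) \<longlonglongrightarrow> c *\<^sub>C S"
    unfolding tensor_scale by (rule bounded_linear.tendsto[OF bounded_linear_scaleC tensor_approx[OF S]])
  from tendsto_extension[OF \<psi> approximable_scaleC[OF S] this] 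
  have "(\<lambda>n. c * tensor_val \<psi> (tensor_approx S n)) \<longlonglongrightarrow> extension \<psi> (c *\<^sub>C S)"
    by (simp add: tensor_scale)
  from LIMSEQ_unique[OF this tendsto_mult_left[OF lim[OF S S]]]
  show "extension \<psi> (c *\<^sub>C S) = c * extension \<psi> S" .
  show "cmod (extension \<psi> S) \<le> 2 * K * norm S"
    by (rule LIMSEQ_le[OF tendsto_norm[OF lim[OF S S]] tendsto_mult_left[OF tendsto_norm[OF tensor_approx[OF S]]]])
      (simp add: tensor_val_bound[OF \<psi>])
  assume T: "T \<in> approximable"
  have "(\<lambda>n. tensor_op (tensor_approx S n @ tensor_approx T n)) \<longlonglongrightarrow> S + T"
    unfolding tensor_append by (rule tendsto_add[OF tensor_approx[OF S] tensor_approx[OF T]])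
  from tendsto_extension[OF \<psi> approximable_add[OF S T] this] 
  have "(\<lambda>n. tensor_val \<psi> (tensor_approx S n) + tensor_val \<psi> (tensor_approx T n)) \<longlonglongrightarrow> extension \<psi> (S + T)"
    by (simp add: tensor_append)
  from LIMSEQ_unique[OF this tendsto_add[OF lim[OF S S] lim[OF T T]]]
  show "extension \<psi> (S + T) = extension \<psi> S + extension \<psi> T" .
qed

lemma extension_rank_one:
  assumes \<psi>: "functional_on approximable K \<psi>"
  shows "extension \<psi> (rank_one f \<xi>) = capply \<xi> (operator_functional \<psi> f)"
proof -
  have "(\<lambda>n. tensor_op [(\<xi>, f)]) \<longlonglongrightarrow> rank_one f \<xi>" by (simp add: tensor_op_def)
  from tendsto_extension[OF \<psi> rank_one_approximable this] show ?thesis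
    by (simp add: tensor_val_def LIMSEQ_const_iff)
qed

lemma extension_cong:
  assumes "\<And>x f. \<psi> (rank_one x f) = \<omega> (rank_one x f)"
  shows "extension \<psi> = extension \<omega>"
  by (simp add: extension_def tensor_val_def operator_functional_def assms fun_eq_iff)

lemma functional_on_add:
  "functional_on V K \<psi> \<Longrightarrow> functional_on V L \<omega> \<Longrightarrow> functional_on V (K + L) (\<lambda>p. \<psi> p + \<omega> p)"
  by (rule functional_onI)
    (auto simp: functional_onD distrib_right distrib_left intro: norm_triangle_mono)

lemma functional_on_mult:
  "functional_on V K \<psi> \<Longrightarrow> functional_on V (cmod k * K) (\<lambda>p. k * \<psi> p)"
  by (rule functional_onI)
    (auto simp: functional_onD distrib_left norm_mult mult.assoc intro!: mult_left_mono)

lemma functional_on_compose: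
  assumes \<psi>: "functional_on W K \<psi>" and L: "\<And>a. a \<in> V \<Longrightarrow> L a \<in> W"
    "\<And>a b. a \<in> V \<Longrightarrow> b \<in> V \<Longrightarrow> L (a + b) = L a + L b" "\<And>k a. a \<in> V \<Longrightarrow> L (k *\<^sub>C a) = k *\<^sub>C L a"
    "\<And>a. a \<in> V \<Longrightarrow> norm (L a) \<le> C * norm a" and C: "0 \<le> C"
  shows "functional_on V (K * C) (\<lambda>a. \<psi> (L a))"
proof (rule functional_onI)
  note [simp] = functional_onD[OF \<psi>] L
  show "0 \<le> K * C" using C by simp
  fix a assume a: "a \<in> V"
  have "cmod (\<psi> (L a)) \<le> K * norm (L a)" using a by simp
  also have "\<dots> \<le> K * (C * norm a)" using a by (intro mult_left_mono) simp_all
  finally show "cmod (\<psi> (L a)) \<le> K * C * norm a" by simp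
qed (simp_all add: functional_onD[OF \<psi>] L)

lemma extension_add:
  assumes \<psi>: "functional_on approximable K \<psi>" and \<omega>: "functional_on approximable L \<omega>"
    and S: "S \<in> approximable"
  shows "extension (\<lambda>p. \<psi> p + \<omega> p) S = extension \<psi> S + extension \<omega> S"
proof (rule functional_on_eqI[OF _ _ _ S])
  note \<psi>\<omega> = functional_on_add[OF \<psi> \<omega>]
  show "functional_on approximable (2 * (K + L)) (extension (\<lambda>p. \<psi> p + \<omega> p))"
    by (rule functional_on_extension[OF \<psi>\<omega>])
  show "functional_on approximable (2 * K + 2 * L) (\<lambda>S. extension \<psi> S + extension \<omega> S)"
    by (intro functional_on_add functional_on_extension \<psi> \<omega>)
  fix f :: "'a cdual" and \<xi>
  have "operator_functional (\<lambda>p. \<psi> p + \<omega> p) f = operator_functional \<psi> f + operator_functional \<omega> f"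
    by (rule capply_eqI) (simp add: capply_simps capply_operator_functional[OF \<psi>]
        capply_operator_functional[OF \<omega>] capply_operator_functional[OF \<psi>\<omega>])
  thus "extension (\<lambda>p. \<psi> p + \<omega> p) (rank_one f \<xi>)
      = extension \<psi> (rank_one f \<xi>) + extension \<omega> (rank_one f \<xi>)"
    by (simp add: extension_rank_one[OF \<psi>] extension_rank_one[OF \<omega>] extension_rank_one[OF \<psi>\<omega>] capply_simps)
qed

lemma extension_mult:
  assumes \<psi>: "functional_on approximable K \<psi>" and S: "S \<in> approximable"
  shows "extension (\<lambda>p. k * \<psi> p) S = k * extension \<psi> S"
proof (rule functional_on_eqI[OF _ _ _ S])
  note k\<psi> = functional_on_mult[OF \<psi>, of k]
  show "functional_on approximable (2 * (cmod k * K)) (extension (\<lambda>p. k * \<psi> p))"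
    by (rule functional_on_extension[OF k\<psi>])
  show "functional_on approximable (cmod k * (2 * K)) (\<lambda>S. k * extension \<psi> S)"
    by (intro functional_on_mult functional_on_extension \<psi>)
  fix f :: "'a cdual" and \<xi>
  have "operator_functional (\<lambda>p. k * \<psi> p) f = k *\<^sub>C operator_functional \<psi> f"
    by (rule capply_eqI) (simp add: capply_scaleC scaleC_complex_def capply_operator_functional[OF \<psi>]
        capply_operator_functional[OF k\<psi>])
  thus "extension (\<lambda>p. k * \<psi> p) (rank_one f \<xi>) = k * extension \<psi> (rank_one f \<xi>)"
    by (simp add: extension_rank_one[OF \<psi>] extension_rank_one[OF k\<psi>] capply_simps scaleC_complex_def)
qed

text \<open>This is the sense in which \<open>extension \<psi>\<close> extends \<open>\<psi>\<close>. Evaluation functionals in the place of \<open>\<xi>\<close>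
  return the values of \<open>\<psi>\<close> on rank one operators.\<close>

lemma extension_adjoint:
  assumes \<psi>: "functional_on approximable K \<psi>" and T: "T \<in> approximable"
  shows "extension \<psi> (adjoint_op T) = \<psi> T"
proof (rule functional_on_eqI[OF _ \<psi> _ T])
  show "functional_on approximable (2 * K * 1) (\<lambda>T. extension \<psi> (adjoint_op T))"
    by (rule functional_on_compose[OF functional_on_extension[OF \<psi>]])
      (simp_all add: adjoint_approximable adjoint_add adjoint_scaleC norm_adjoint)
  show "extension \<psi> (adjoint_op (rank_one u g)) = \<psi> (rank_one u g)" for u g
    by (simp add: adjoint_rank_one extension_rank_one[OF \<psi>] capply_evaluation capply_operator_functional[OF \<psi>])
qed

lemma bilinear_ccompose:
  "ccompose S (T + U) = ccompose S T + ccompose S U" "ccompose (S + T) U = ccompose S U + ccompose T U"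
  "ccompose S (c *\<^sub>C T) = c *\<^sub>C ccompose S T" "ccompose (c *\<^sub>C S) T = c *\<^sub>C ccompose S T"
  by (auto intro!: capply_eqI simp: capply_ccompose capply_simps capply_scaleC)

lemma functional_on_ccompose_left:
  assumes \<psi>: "functional_on approximable K \<psi>" and c: "c \<in> approximable"
  shows "functional_on approximable (K * norm c) (\<lambda>p. \<psi> (ccompose c p))"
  by (rule functional_on_compose[OF \<psi>])
    (simp_all add: c approximable_ccompose bilinear_ccompose norm_ccompose)

lemma functional_on_ccompose_right:
  assumes \<psi>: "functional_on approximable K \<psi>" and c: "c \<in> approximable"
  shows "functional_on approximable (K * norm c) (\<lambda>p. \<psi> (ccompose p c))"
  by (rule functional_on_compose[OF \<psi>])
    (simp_all add: c approximable_ccompose bilinear_ccompose norm_ccompose mult.commute[of "norm c"])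

text \<open>Both sides are bounded functionals of \<open>S\<close>. On \<open>S = rank_one f \<xi>\<close> both are \<open>\<xi>\<close> applied to the adjoint of
  \<open>c\<close> at \<open>\<psi>\<^sub>f\<close>. The next lemma is its mirror image, with \<open>c\<close> acting on \<open>f\<close>.\<close>

lemma extension_ccompose_left:
  assumes \<psi>: "functional_on approximable K \<psi>" and c: "c \<in> approximable" and S: "S \<in> approximable"
  shows "extension (\<lambda>p. \<psi> (ccompose c p)) S = extension \<psi> (ccompose S (adjoint_op c))"
proof (rule functional_on_eqI[OF _ _ _ S])
  note \<psi>c = functional_on_ccompose_left[OF \<psi> c]
  show "functional_on approximable (2 * (K * norm c)) (extension (\<lambda>p. \<psi> (ccompose c p)))"
    by (rule functional_on_extension[OF \<psi>c])
  show "functional_on approximable (2 * K * norm (adjoint_op c)) (\<lambda>S. extension \<psi> (ccompose S (adjoint_op c)))"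
    by (rule functional_on_ccompose_right[OF functional_on_extension[OF \<psi>] adjoint_approximable[OF c]])
  fix f :: "'a cdual" and \<xi>
  have "operator_functional (\<lambda>p. \<psi> (ccompose c p)) f = capply (adjoint_op c) (operator_functional \<psi> f)"
    by (rule capply_eqI) (simp add: capply_adjoint capply_ccompose capply_operator_functional[OF \<psi>]
        capply_operator_functional[OF \<psi>c] ccompose_rank_one)
  thus "extension (\<lambda>p. \<psi> (ccompose c p)) (rank_one f \<xi>) = extension \<psi> (ccompose (rank_one f \<xi>) (adjoint_op c))"
    by (simp add: extension_rank_one[OF \<psi>] extension_rank_one[OF \<psi>c] rank_one_ccompose capply_ccompose)
qed

lemma extension_ccompose_right:
  assumes \<psi>: "functional_on approximable K \<psi>" and c: "c \<in> approximable" and S: "S \<in> approximable"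
  shows "extension (\<lambda>p. \<psi> (ccompose p c)) S = extension \<psi> (ccompose (adjoint_op c) S)"
proof (rule functional_on_eqI[OF _ _ _ S])
  note \<psi>c = functional_on_ccompose_right[OF \<psi> c]
  show "functional_on approximable (2 * (K * norm c)) (extension (\<lambda>p. \<psi> (ccompose p c)))"
    by (rule functional_on_extension[OF \<psi>c])
  show "functional_on approximable (2 * K * norm (adjoint_op c)) (\<lambda>S. extension \<psi> (ccompose (adjoint_op c) S))"
    by (rule functional_on_ccompose_left[OF functional_on_extension[OF \<psi>] adjoint_approximable[OF c]])
  fix f :: "'a cdual" and \<xi>
  have "operator_functional (\<lambda>p. \<psi> (ccompose p c)) f = operator_functional \<psi> (capply (adjoint_op c) f)"
    by (rule capply_eqI) (simp add: capply_adjoint capply_operator_functional[OF \<psi>]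
        capply_operator_functional[OF \<psi>c] rank_one_ccompose)
  thus "extension (\<lambda>p. \<psi> (ccompose p c)) (rank_one f \<xi>) = extension \<psi> (ccompose (adjoint_op c) (rank_one f \<xi>))"
    by (simp add: extension_rank_one[OF \<psi>] extension_rank_one[OF \<psi>c] ccompose_rank_one)
qed

text \<open>Products of two operators on the dual are reached by extending in one factor at a time. The inner
  extension is \<open>a \<mapsto> extension \<psi> (a' \<circ> T)\<close>, where \<open>a'\<close> is the adjoint of \<open>a\<close>, and the functional that this
  assigns to \<open>f\<close> is \<open>T \<psi>\<^sub>f\<close>.\<close>

lemma extension_ccompose:
  assumes \<psi>: "functional_on approximable K \<psi>" and S: "S \<in> approximable" and T: "T \<in> approximable"
  shows "extension (\<lambda>a. extension (\<lambda>b. \<psi> (ccompose b a)) T) S = extension \<psi> (ccompose S T)"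
proof -
  note e = functional_on_extension[OF \<psi>]
  have inner: "functional_on approximable (2 * K * norm T * 1) (\<lambda>a. extension \<psi> (ccompose (adjoint_op a) T))"
    by (rule functional_on_compose[OF functional_on_ccompose_right[OF e T]])
      (simp_all add: adjoint_approximable adjoint_add adjoint_scaleC norm_adjoint)
  have "extension (\<lambda>a. extension (\<lambda>b. \<psi> (ccompose b a)) T) = extension (\<lambda>a. extension \<psi> (ccompose (adjoint_op a) T))"
    by (rule extension_cong) (rule extension_ccompose_right[OF \<psi> rank_one_approximable T])
  moreover have "extension (\<lambda>a. extension \<psi> (ccompose (adjoint_op a) T)) S = extension \<psi> (ccompose S T)"
  proof (rule functional_on_eqI[OF functional_on_extension[OF inner] functional_on_ccompose_right[OF e T] _ S])
    fix f :: "'a cdual" and \<xi>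
    have "operator_functional (\<lambda>a. extension \<psi> (ccompose (adjoint_op a) T)) f
        = capply T (operator_functional \<psi> f)"
      by (rule capply_eqI) (simp add: capply_operator_functional[OF inner] adjoint_rank_one
          rank_one_ccompose extension_rank_one[OF \<psi>] capply_ccompose capply_evaluation)
    thus "extension (\<lambda>a. extension \<psi> (ccompose (adjoint_op a) T)) (rank_one f \<xi>)
        = extension \<psi> (ccompose (rank_one f \<xi>) T)"
      by (simp add: extension_rank_one[OF inner] extension_rank_one[OF \<psi>] rank_one_ccompose capply_ccompose)
  qed
  ultimately show ?thesis by simp
qed

section \<open>Extension of bilinear forms\<close>

definition bilinear_on :: "'a::complex_banach set \<Rightarrow> real \<Rightarrow> ('a \<Rightarrow> 'a \<Rightarrow> complex) \<Rightarrow> bool"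
  where "bilinear_on V K \<phi> \<longleftrightarrow> 0 \<le> K \<and> (\<forall>a\<in>V. functional_on V (K * norm a) (\<phi> a)) \<and>
    (\<forall>b\<in>V. functional_on V (K * norm b) (\<lambda>a. \<phi> a b))"

lemma bilinear_onD:
  assumes "bilinear_on V K \<phi>"
  shows "0 \<le> K" "\<And>a. a \<in> V \<Longrightarrow> functional_on V (K * norm a) (\<phi> a)"
    "\<And>b. b \<in> V \<Longrightarrow> functional_on V (K * norm b) (\<lambda>a. \<phi> a b)"
  using assms by (simp_all add: bilinear_on_def)

text \<open>The order of the two extensions may matter, as for Arens products; the second variable comes
  first.\<close>

definition extension2 ::
  "(('a::complex_banach, 'a) cblinfun \<Rightarrow> ('a, 'a) cblinfun \<Rightarrow> complex) \<Rightarrow>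
    ('a cdual, 'a cdual) cblinfun \<Rightarrow> ('a cdual, 'a cdual) cblinfun \<Rightarrow> complex"
  where "extension2 \<phi> S T = extension (\<lambda>a. extension (\<phi> a) T) S"

lemma functional_on_inner_extension:
  fixes \<phi> :: "('a::complex_banach, 'a) cblinfun \<Rightarrow> ('a, 'a) cblinfun \<Rightarrow> complex"
  assumes \<phi>: "bilinear_on approximable K \<phi>" and T: "T \<in> approximable"
  shows "functional_on approximable (2 * K * norm T) (\<lambda>a. extension (\<phi> a) T)"
proof (rule functional_onI)
  note \<phi>1 = bilinear_onD(2)[OF \<phi>] and \<phi>2 = bilinear_onD(3)[OF \<phi> rank_one_approximable]
  show "0 \<le> 2 * K * norm T" using bilinear_onD(1)[OF \<phi>] by simp
  fix a b :: "('a, 'a) cblinfun" and k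
  assume a: "a \<in> approximable"
  have "extension (\<phi> (k *\<^sub>C a)) = extension (\<lambda>p. k * \<phi> a p)"
    by (rule extension_cong) (simp add: functional_onD(3)[OF \<phi>2] a)
  thus "extension (\<phi> (k *\<^sub>C a)) T = k * extension (\<phi> a) T"
    by (simp add: extension_mult[OF \<phi>1[OF a] T])
  show "cmod (extension (\<phi> a) T) \<le> 2 * K * norm T * norm a"
    using functional_onD(4)[OF functional_on_extension[OF \<phi>1[OF a]] T] by (simp add: ac_simps)
  assume b: "b \<in> approximable"
  have "extension (\<phi> (a + b)) = extension (\<lambda>p. \<phi> a p + \<phi> b p)"
    by (rule extension_cong) (simp add: functional_onD(2)[OF \<phi>2] a b)
  thus "extension (\<phi> (a + b)) T = extension (\<phi> a) T + extension (\<phi> b) T"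
    by (simp add: extension_add[OF \<phi>1[OF a] \<phi>1[OF b] T])
qed

lemma bilinear_on_extension2:
  fixes \<phi> :: "('a::complex_banach, 'a) cblinfun \<Rightarrow> ('a, 'a) cblinfun \<Rightarrow> complex"
  assumes \<phi>: "bilinear_on approximable K \<phi>"
  shows "bilinear_on approximable (4 * K) (extension2 \<phi>)"
  unfolding bilinear_on_def
proof (intro conjI ballI)
  note \<phi>1 = functional_on_extension[OF bilinear_onD(2)[OF \<phi> rank_one_approximable]]
  note inner = functional_on_inner_extension[OF \<phi>]
  show "0 \<le> 4 * K" using bilinear_onD(1)[OF \<phi>] by simp
  fix S :: "('a cdual, 'a cdual) cblinfun"
  assume S: "S \<in> approximable"
  show "functional_on approximable (4 * K * norm S) (\<lambda>T. extension2 \<phi> T S)"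
    unfolding extension2_def using functional_on_extension[OF inner[OF S]] by (simp add: mult.assoc)
  show "functional_on approximable (4 * K * norm S) (extension2 \<phi> S)"
    unfolding extension2_def
  proof (rule functional_onI)
    show "0 \<le> 4 * K * norm S" using bilinear_onD(1)[OF \<phi>] by simp
    fix T U :: "('a cdual, 'a cdual) cblinfun" and k
    assume T: "T \<in> approximable"
    have "extension (\<lambda>a. extension (\<phi> a) (k *\<^sub>C T)) = extension (\<lambda>a. k * extension (\<phi> a) T)"
      by (rule extension_cong) (rule functional_onD(3)[OF \<phi>1 T])
    thus "extension (\<lambda>a. extension (\<phi> a) (k *\<^sub>C T)) S = k * extension (\<lambda>a. extension (\<phi> a) T) S"
      by (simp add: extension_mult[OF inner[OF T] S])
    show "cmod (extension (\<lambda>a. extension (\<phi> a) T) S) \<le> 4 * K * norm S * norm T"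
      using functional_onD(4)[OF functional_on_extension[OF inner[OF T]] S] by (simp add: ac_simps)
    assume U: "U \<in> approximable"
    have "extension (\<lambda>a. extension (\<phi> a) (T + U)) = extension (\<lambda>a. extension (\<phi> a) T + extension (\<phi> a) U)"
      by (rule extension_cong) (rule functional_onD(2)[OF \<phi>1 T U])
    thus "extension (\<lambda>a. extension (\<phi> a) (T + U)) S
        = extension (\<lambda>a. extension (\<phi> a) T) S + extension (\<lambda>a. extension (\<phi> a) U) S"
      by (simp add: extension_add[OF inner[OF T] inner[OF U] S])
  qed
qed

lemma extension2_cong:
  assumes "\<And>a b. a \<in> approximable \<Longrightarrow> b \<in> approximable \<Longrightarrow> \<phi> a b = \<phi>' a b"
  shows "extension2 \<phi> = extension2 \<phi>'"
proof -
  have "extension (\<phi> (rank_one x f)) = extension (\<phi>' (rank_one x f))" for x f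
    by (rule extension_cong) (simp add: assms rank_one_approximable)
  hence "extension (\<lambda>a. extension (\<phi> a) T) = extension (\<lambda>a. extension (\<phi>' a) T)" for T
    by (intro extension_cong) simp
  thus ?thesis by (simp add: extension2_def fun_eq_iff)
qed

lemma extension2_add:
  assumes \<phi>: "bilinear_on approximable K \<phi>" and \<phi>': "bilinear_on approximable L \<phi>'"
    and S: "S \<in> approximable" and T: "T \<in> approximable"
  shows "extension2 (\<lambda>a b. \<phi> a b + \<phi>' a b) S T = extension2 \<phi> S T + extension2 \<phi>' S T"
proof -
  have "extension (\<lambda>a. extension (\<lambda>b. \<phi> a b + \<phi>' a b) T) = extension (\<lambda>a. extension (\<phi> a) T + extension (\<phi>' a) T)"
    by (rule extension_cong)
      (rule extension_add[OF bilinear_onD(2)[OF \<phi>] bilinear_onD(2)[OF \<phi>'] T]; rule rank_one_approximable)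
  thus ?thesis
    by (simp add: extension2_def extension_add[OF functional_on_inner_extension[OF \<phi> T]
          functional_on_inner_extension[OF \<phi>' T] S])
qed

lemma extension2_mult:
  assumes \<phi>: "bilinear_on approximable K \<phi>" and S: "S \<in> approximable" and T: "T \<in> approximable"
  shows "extension2 (\<lambda>a b. k * \<phi> a b) S T = k * extension2 \<phi> S T"
proof -
  have "extension (\<lambda>a. extension (\<lambda>b. k * \<phi> a b) T) = extension (\<lambda>a. k * extension (\<phi> a) T)"
    by (rule extension_cong) (rule extension_mult[OF bilinear_onD(2)[OF \<phi>] T]; rule rank_one_approximable)
  thus ?thesis
    by (simp add: extension2_def extension_mult[OF functional_on_inner_extension[OF \<phi> T] S])
qed

section \<open>Dual bimodules\<close>

lemma cring_complex_ring: "cring complex_ring"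
proof (rule cringI)
  show "abelian_group complex_ring"
  proof (rule abelian_groupI)
    fix x assume "x \<in> carrier complex_ring"
    show "\<exists>y\<in>carrier complex_ring. y \<oplus>\<^bsub>complex_ring\<^esub> x = \<zero>\<^bsub>complex_ring\<^esub>"
      by (rule bexI[of _ "- x"]) (simp_all add: complex_ring_def)
  qed (simp_all add: complex_ring_def)
  show "comm_monoid complex_ring"
    by (rule comm_monoidI) (simp_all add: complex_ring_def)
qed (simp add: complex_ring_def distrib_right)

context complex_banach_space
begin

lemma smult_in_carrier: "x \<in> carrier Z \<Longrightarrow> k \<odot> x \<in> carrier Z"
  using smult_closed[of k x] by (simp add: complex_ring_def)

lemma dual_carrierI:
  assumes "\<phi> \<in> extensional (carrier Z)"
    and "\<And>x y. x \<in> carrier Z \<Longrightarrow> y \<in> carrier Z \<Longrightarrow> \<phi> (x \<oplus> y) = \<phi> x + \<phi> y"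
    and "\<And>k x. x \<in> carrier Z \<Longrightarrow> \<phi> (k \<odot> x) = k * \<phi> x"
    and "\<And>x. x \<in> carrier Z \<Longrightarrow> cmod (\<phi> x) \<le> K * mnorm Z x"
  shows "\<phi> \<in> carrier (dual_bimodule Z)"
  using assms by (auto simp: dual_bimodule_def intro!: exI[of _ K])

lemma dual_carrierD:
  assumes "\<phi> \<in> carrier (dual_bimodule Z)"
  shows "\<phi> \<in> extensional (carrier Z)"
    and "\<And>x y. x \<in> carrier Z \<Longrightarrow> y \<in> carrier Z \<Longrightarrow> \<phi> (x \<oplus> y) = \<phi> x + \<phi> y"
    and "\<And>k x. x \<in> carrier Z \<Longrightarrow> \<phi> (k \<odot> x) = k * \<phi> x"
    and "\<exists>K. \<forall>x\<in>carrier Z. cmod (\<phi> x) \<le> K * mnorm Z x"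
  using assms by (auto simp: dual_bimodule_def)

lemma dual_combination_closed:
  assumes \<phi>: "\<phi> \<in> carrier (dual_bimodule Z)" and \<psi>: "\<psi> \<in> carrier (dual_bimodule Z)"
  shows "(\<lambda>x\<in>carrier Z. \<phi> x + k * \<psi> x) \<in> carrier (dual_bimodule Z)"
proof -
  obtain K L where K: "\<And>x. x \<in> carrier Z \<Longrightarrow> cmod (\<phi> x) \<le> K * mnorm Z x"
    and L: "\<And>x. x \<in> carrier Z \<Longrightarrow> cmod (\<psi> x) \<le> L * mnorm Z x"
    using dual_carrierD(4)[OF \<phi>] dual_carrierD(4)[OF \<psi>] by blast
  show ?thesis
  proof (rule dual_carrierI)
    fix x assume x: "x \<in> carrier Z"
    have "cmod (\<phi> x + k * \<psi> x) \<le> K * mnorm Z x + cmod k * (L * mnorm Z x)"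
      using K[OF x] mult_left_mono[OF L[OF x], of "cmod k"]
      by (intro norm_triangle_mono) (simp_all add: norm_mult)
    thus "cmod ((\<lambda>x\<in>carrier Z. \<phi> x + k * \<psi> x) x) \<le> (K + cmod k * L) * mnorm Z x"
      using x by (simp add: algebra_simps)
  qed (auto simp: dual_carrierD[OF \<phi>] dual_carrierD[OF \<psi>] smult_in_carrier algebra_simps)
qed

lemma dual_simps:
  "\<zero>\<^bsub>dual_bimodule Z\<^esub> = (\<lambda>x\<in>carrier Z. 0)"
  "\<phi> \<oplus>\<^bsub>dual_bimodule Z\<^esub> \<psi> = (\<lambda>x\<in>carrier Z. \<phi> x + \<psi> x)"
  "k \<odot>\<^bsub>dual_bimodule Z\<^esub> \<phi> = (\<lambda>x\<in>carrier Z. k * \<phi> x)"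
  "lact (dual_bimodule Z) a \<phi> = (\<lambda>x\<in>carrier Z. \<phi> (ract Z x a))"
  "ract (dual_bimodule Z) \<phi> a = (\<lambda>x\<in>carrier Z. \<phi> (lact Z a x))"
  "mnorm (dual_bimodule Z) \<phi> = (SUP x\<in>{x \<in> carrier Z. mnorm Z x \<le> 1}. cmod (\<phi> x))"
  by (simp_all add: dual_bimodule_def)

lemma dual_zero_closed: "(\<lambda>x\<in>carrier Z. 0) \<in> carrier (dual_bimodule Z)"
  by (rule dual_carrierI[of _ 0]) (auto simp: smult_in_carrier)

lemma dual_eqI:
  "\<phi> \<in> carrier (dual_bimodule Z) \<Longrightarrow> \<psi> \<in> carrier (dual_bimodule Z) \<Longrightarrow>
    (\<And>x. x \<in> carrier Z \<Longrightarrow> \<phi> x = \<psi> x) \<Longrightarrow> \<phi> = \<psi>"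
  by (rule extensionalityI[of _ "carrier Z"]) (auto dest: dual_carrierD(1))

lemma abelian_group_dual: "abelian_group (dual_bimodule Z)"
proof (rule abelian_groupI)
  fix \<phi> assume \<phi>: "\<phi> \<in> carrier (dual_bimodule Z)"
  show "\<exists>\<psi>\<in>carrier (dual_bimodule Z). \<psi> \<oplus>\<^bsub>dual_bimodule Z\<^esub> \<phi> = \<zero>\<^bsub>dual_bimodule Z\<^esub>"
    using dual_combination_closed[OF dual_zero_closed \<phi>, of "-1"]
    by (intro bexI[of _ "\<lambda>x\<in>carrier Z. (\<lambda>x\<in>carrier Z. 0) x + (-1) * \<phi> x"])
      (auto simp: dual_simps restrict_def)
  show "\<zero>\<^bsub>dual_bimodule Z\<^esub> \<oplus>\<^bsub>dual_bimodule Z\<^esub> \<phi> = \<phi>"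
    using dual_carrierD(1)[OF \<phi>] by (auto simp: dual_simps restrict_def extensional_def)
  fix \<psi> assume \<psi>: "\<psi> \<in> carrier (dual_bimodule Z)"
  show "\<phi> \<oplus>\<^bsub>dual_bimodule Z\<^esub> \<psi> \<in> carrier (dual_bimodule Z)"
    using dual_combination_closed[OF \<phi> \<psi>, of 1] by (simp add: dual_simps)
qed (auto simp: dual_simps dual_zero_closed add_ac intro!: restrict_ext)

lemma dual_minus:
  assumes \<phi>: "\<phi> \<in> carrier (dual_bimodule Z)" and \<psi>: "\<psi> \<in> carrier (dual_bimodule Z)"
  shows "\<phi> \<ominus>\<^bsub>dual_bimodule Z\<^esub> \<psi> = (\<lambda>x\<in>carrier Z. \<phi> x - \<psi> x)"
proof -
  interpret dual: abelian_group "dual_bimodule Z" by (rule abelian_group_dual)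
  let ?n = "\<lambda>x\<in>carrier Z. (\<lambda>x\<in>carrier Z. 0) x + (-1) * \<psi> x"
  have "\<ominus>\<^bsub>dual_bimodule Z\<^esub> \<psi> = ?n"
    using dual_combination_closed[OF dual_zero_closed \<psi>, of "-1"] \<psi>
    by (intro dual.minus_equality) (auto simp: dual_simps restrict_def)
  thus ?thesis
    unfolding a_minus_def by (auto simp: dual_simps restrict_def)
qed

lemma mnorm_zero: "mnorm Z \<zero> = 0"
  by (simp add: mnorm_eq_0_iff)

lemma mnorm_nonneg:
  assumes x: "x \<in> carrier Z" shows "0 \<le> mnorm Z x"
proof -
  have "(1 + (-1)) \<odot> x = 1 \<odot> x \<oplus> (-1) \<odot> x"
    using smult_l_distr[of 1 "-1" x] x by (simp add: complex_ring_def)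
  moreover have "mnorm Z (0 \<odot> x) = 0" using mnorm_smult[OF x, of 0] by simp
  ultimately have "0 \<le> mnorm Z (1 \<odot> x) + mnorm Z ((-1) \<odot> x)"
    using mnorm_triangle[OF smult_in_carrier[OF x, of 1] smult_in_carrier[OF x, of "-1"]] by simp
  thus ?thesis by (simp add: mnorm_smult[OF x])
qed

text \<open>The norm of the dual bimodule is a supremum over the unit ball, which by definition of its carrier
  is finite.\<close>

lemma dual_bound:
  assumes \<phi>: "\<phi> \<in> carrier (dual_bimodule Z)" and x: "x \<in> carrier Z"
  shows "cmod (\<phi> x) \<le> mnorm (dual_bimodule Z) \<phi> * mnorm Z x"
proof (cases "mnorm Z x = 0")
  case True
  obtain K where "\<forall>x\<in>carrier Z. cmod (\<phi> x) \<le> K * mnorm Z x" using dual_carrierD(4)[OF \<phi>] by blast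
  hence "cmod (\<phi> x) \<le> K * mnorm Z x" using x by blast
  thus ?thesis by (simp add: True)
next
  case False
  with mnorm_nonneg[OF x] have pos: "mnorm Z x > 0" by simp
  obtain K where K: "\<And>x. x \<in> carrier Z \<Longrightarrow> cmod (\<phi> x) \<le> K * mnorm Z x"
    using dual_carrierD(4)[OF \<phi>] by blast
  have "bdd_above ((\<lambda>x. cmod (\<phi> x)) ` {x \<in> carrier Z. mnorm Z x \<le> 1})"
  proof (rule bdd_aboveI2)
    fix y assume y: "y \<in> {x \<in> carrier Z. mnorm Z x \<le> 1}"
    have "K * mnorm Z y \<le> \<bar>K\<bar> * 1"
      using y mnorm_nonneg[of y] by (intro mult_mono) auto
    with K[of y] y show "cmod (\<phi> y) \<le> \<bar>K\<bar>" by simp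
  qed
  moreover let ?y = "complex_of_real (inverse (mnorm Z x)) \<odot> x"
  have "?y \<in> {x \<in> carrier Z. mnorm Z x \<le> 1}"
    using pos x by (simp add: smult_in_carrier mnorm_smult norm_inverse)
  ultimately have "cmod (\<phi> ?y) \<le> mnorm (dual_bimodule Z) \<phi>"
    unfolding dual_simps by (intro cSUP_upper)
  thus ?thesis
    using pos by (simp add: dual_carrierD(3)[OF \<phi> x] norm_mult norm_divide norm_inverse field_simps)
qed

lemma dual_mnorm_le:
  assumes "\<And>x. x \<in> carrier Z \<Longrightarrow> mnorm Z x \<le> 1 \<Longrightarrow> cmod (\<phi> x) \<le> C"
  shows "mnorm (dual_bimodule Z) \<phi> \<le> C"
  unfolding dual_simps using assms mnorm_zero by (intro cSUP_least) (auto intro!: exI[of _ \<zero>])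

end

lemma (in banach_bimodule) dual_act_closed:
  assumes \<phi>: "\<phi> \<in> carrier (dual_bimodule Z)" and a: "a \<in> A"
  shows "lact (dual_bimodule Z) a \<phi> \<in> carrier (dual_bimodule Z)"
    and "ract (dual_bimodule Z) \<phi> a \<in> carrier (dual_bimodule Z)"
proof -
  obtain L where L: "\<And>x. x \<in> carrier Z \<Longrightarrow> cmod (\<phi> x) \<le> L * mnorm Z x"
    using dual_carrierD(4)[OF \<phi>] by blast
  obtain K where K: "\<And>x. x \<in> carrier Z \<Longrightarrow> mnorm Z (lact Z a x) \<le> K * norm a * mnorm Z x"
      "\<And>x. x \<in> carrier Z \<Longrightarrow> mnorm Z (ract Z x a) \<le> K * norm a * mnorm Z x"
    using act_bounded a by blast
  have bound: "cmod (\<phi> y) \<le> (\<bar>L\<bar> * (K * norm a)) * mnorm Z x"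
    if y: "y \<in> carrier Z" "mnorm Z y \<le> K * norm a * mnorm Z x" for x y
  proof -
    have "L * mnorm Z y \<le> \<bar>L\<bar> * (K * norm a * mnorm Z x)"
      using y(2) mnorm_nonneg[OF y(1)] by (intro mult_mono) simp_all
    with L[OF y(1)] show ?thesis by (simp add: mult.assoc)
  qed
  show "lact (dual_bimodule Z) a \<phi> \<in> carrier (dual_bimodule Z)"
    unfolding dual_simps
    by (rule dual_carrierI) (auto simp: dual_carrierD[OF \<phi>] smult_in_carrier a ract_add ract_smult ract_closed
        intro!: bound K(2))
  show "ract (dual_bimodule Z) \<phi> a \<in> carrier (dual_bimodule Z)"
    unfolding dual_simps
    by (rule dual_carrierI) (auto simp: dual_carrierD[OF \<phi>] smult_in_carrier a lact_add lact_smult lact_closed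
        intro!: bound K(1))
qed

section \<open>The universal derivation of a Banach algebra\<close>

context banach_algebra
begin

lemma A_zero [simp]: "0 \<in> A"
  and A_add [simp]: "a \<in> A \<Longrightarrow> b \<in> A \<Longrightarrow> a + b \<in> A"
  and A_diff [simp]: "a \<in> A \<Longrightarrow> b \<in> A \<Longrightarrow> a - b \<in> A"
  and A_scaleC [simp]: "a \<in> A \<Longrightarrow> k *\<^sub>C a \<in> A"
  using subspace by (simp_all add: complex_vector.subspace_0 complex_vector.subspace_add
      complex_vector.subspace_diff complex_vector.subspace_scale)

lemma mul_zero_left [simp]: "b \<in> A \<Longrightarrow> mul 0 b = 0"
  using mul_scaleC_left[of 0 b 0] by simp

lemma mul_zero_right [simp]: "b \<in> A \<Longrightarrow> mul b 0 = 0"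
  using mul_scaleC_right[of b 0 0] by simp

text \<open>The bounded bilinear forms on \<open>A\<^sup>1 \<times> A\<close>, where \<open>A\<^sup>1\<close> is \<open>A\<close> with a unit adjoined. Such a form \<open>\<Phi>\<close> is
  encoded as the function \<open>F a b = \<Phi> (1 + a, b)\<close>, which is affine in \<open>a\<close>; thus \<open>F 0 b = \<Phi> (1, b)\<close> and
  \<open>F a b - F 0 b = \<Phi> (a, b)\<close>. The value \<open>0\<close> off \<open>A\<close> makes the encoding unique.\<close>

definition forms :: "('a \<Rightarrow> 'a \<Rightarrow> complex) set"
  where "forms = {F. (\<forall>a b. a \<notin> A \<or> b \<notin> A \<longrightarrow> F a b = 0) \<and>
    (\<forall>a\<in>A. \<forall>b\<in>A. \<forall>c\<in>A. F a (b + c) = F a b + F a c) \<and>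
    (\<forall>k. \<forall>a\<in>A. \<forall>b\<in>A. F a (k *\<^sub>C b) = k * F a b) \<and>
    (\<forall>a\<in>A. \<forall>b\<in>A. \<forall>c\<in>A. F (a + b) c = F a c + F b c - F 0 c) \<and>
    (\<forall>k. \<forall>a\<in>A. \<forall>b\<in>A. F (k *\<^sub>C a) b = k * F a b + (1 - k) * F 0 b) \<and>
    (\<exists>K. \<forall>a\<in>A. \<forall>b\<in>A. cmod (F a b) \<le> K * (1 + norm a) * norm b)}"

lemma formsI:
  assumes "\<And>a b. a \<notin> A \<or> b \<notin> A \<Longrightarrow> F a b = 0"
    "\<And>a b c. a \<in> A \<Longrightarrow> b \<in> A \<Longrightarrow> c \<in> A \<Longrightarrow> F a (b + c) = F a b + F a c"
    "\<And>k a b. a \<in> A \<Longrightarrow> b \<in> A \<Longrightarrow> F a (k *\<^sub>C b) = k * F a b"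
    "\<And>a b c. a \<in> A \<Longrightarrow> b \<in> A \<Longrightarrow> c \<in> A \<Longrightarrow> F (a + b) c = F a c + F b c - F 0 c"
    "\<And>k a b. a \<in> A \<Longrightarrow> b \<in> A \<Longrightarrow> F (k *\<^sub>C a) b = k * F a b + (1 - k) * F 0 b"
    "\<And>a b. a \<in> A \<Longrightarrow> b \<in> A \<Longrightarrow> cmod (F a b) \<le> K * (1 + norm a) * norm b"
  shows "F \<in> forms"
  unfolding forms_def mem_Collect_eq using assms
  by (intro conjI allI ballI impI exI[of _ K]) auto

lemma formsD:
  assumes "F \<in> forms"
  shows "\<And>a b. a \<notin> A \<or> b \<notin> A \<Longrightarrow> F a b = 0"
    "\<And>a b c. a \<in> A \<Longrightarrow> b \<in> A \<Longrightarrow> c \<in> A \<Longrightarrow> F a (b + c) = F a b + F a c"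
    "\<And>k a b. a \<in> A \<Longrightarrow> b \<in> A \<Longrightarrow> F a (k *\<^sub>C b) = k * F a b"
    "\<And>a b c. a \<in> A \<Longrightarrow> b \<in> A \<Longrightarrow> c \<in> A \<Longrightarrow> F (a + b) c = F a c + F b c - F 0 c"
    "\<And>k a b. a \<in> A \<Longrightarrow> b \<in> A \<Longrightarrow> F (k *\<^sub>C a) b = k * F a b + (1 - k) * F 0 b"
    "\<exists>K. \<forall>a\<in>A. \<forall>b\<in>A. cmod (F a b) \<le> K * (1 + norm a) * norm b"
  using assms unfolding forms_def by auto

definition unit_pairs :: "('a \<times> 'a) set"
  where "unit_pairs = {(a, b). a \<in> A \<and> b \<in> A \<and> norm a \<le> 1 \<and> norm b \<le> 1}"

definition form_norm :: "('a \<Rightarrow> 'a \<Rightarrow> complex) \<Rightarrow> real"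
  where "form_norm F = (SUP (a, b)\<in>unit_pairs. cmod (F a b))"

lemma form_norm_le:
  assumes "\<And>a b. a \<in> A \<Longrightarrow> b \<in> A \<Longrightarrow> norm a \<le> 1 \<Longrightarrow> norm b \<le> 1 \<Longrightarrow> cmod (F a b) \<le> C"
  shows "form_norm F \<le> C"
  unfolding form_norm_def using assms
  by (intro cSUP_least) (auto simp: unit_pairs_def intro!: exI[of _ 0])

lemma form_norm_upper:
  assumes F: "F \<in> forms" and ab: "a \<in> A" "b \<in> A" "norm a \<le> 1" "norm b \<le> 1"
  shows "cmod (F a b) \<le> form_norm F"
proof -
  obtain K where K: "\<And>a b. a \<in> A \<Longrightarrow> b \<in> A \<Longrightarrow> cmod (F a b) \<le> K * (1 + norm a) * norm b"
    using formsD(6)[OF F] by blast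
  have "bdd_above ((\<lambda>(a, b). cmod (F a b)) ` unit_pairs)"
  proof (rule bdd_aboveI2)
    fix p assume "p \<in> unit_pairs"
    then obtain a b where p: "p = (a, b)" "a \<in> A" "b \<in> A" "norm a \<le> 1" "norm b \<le> 1"
      by (auto simp: unit_pairs_def)
    have "K * (1 + norm a) * norm b \<le> (\<bar>K\<bar> * 2) * 1"
      using p by (intro mult_mono) auto
    with K[OF p(2,3)] show "(\<lambda>(a, b). cmod (F a b)) p \<le> \<bar>K\<bar> * 2" by (simp add: p(1))
  qed
  from cSUP_upper[OF _ this, of "(a, b)"] show ?thesis
    using ab by (simp add: form_norm_def unit_pairs_def)
qed

lemma form_norm_nonneg: "F \<in> forms \<Longrightarrow> 0 \<le> form_norm F"
  by (rule order_trans[OF norm_ge_zero form_norm_upper[of F 0 0]]) simp_all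

lemma normalized:
  assumes "a \<in> A"
  obtains a' where "a' \<in> A" "norm a' \<le> 1" "a = complex_of_real (norm a) *\<^sub>C a'"
proof (cases "a = 0")
  case True
  then show ?thesis using that[of 0] by simp
next
  case False
  then show ?thesis
    using assms by (intro that[of "complex_of_real (inverse (norm a)) *\<^sub>C a"])
      (simp_all add: norm_scaleC norm_inverse)
qed

lemma form_zero_bound:
  assumes F: "F \<in> forms" and b: "b \<in> A"
  shows "cmod (F 0 b) \<le> form_norm F * norm b"
proof -
  obtain b' where b': "b' \<in> A" "norm b' \<le> 1" "b = complex_of_real (norm b) *\<^sub>C b'"
    by (rule normalized[OF b])
  have "F 0 b = complex_of_real (norm b) * F 0 b'"
    by (subst b'(3)) (simp add: formsD(3)[OF F] b'(1))
  thus ?thesis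
    using form_norm_upper[OF F A_zero b'(1) _ b'(2)]
    by (simp add: norm_mult mult.commute[of "form_norm F"] mult_left_mono)
qed

text \<open>The norm is a supremum over pairs in the unit ball. The bilinear part is a difference of two
  values there, whence the factor \<open>2\<close>.\<close>

lemma form_diff_bound:
  assumes F: "F \<in> forms" and a: "a \<in> A" and b: "b \<in> A"
  shows "cmod (F a b - F 0 b) \<le> 2 * form_norm F * norm a * norm b"
proof -
  obtain a' where a': "a' \<in> A" "norm a' \<le> 1" "a = complex_of_real (norm a) *\<^sub>C a'"
    by (rule normalized[OF a])
  obtain b' where b': "b' \<in> A" "norm b' \<le> 1" "b = complex_of_real (norm b) *\<^sub>C b'"
    by (rule normalized[OF b])
  have "F a b = complex_of_real (norm a) * F a' b + (1 - complex_of_real (norm a)) * F 0 b"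
    using formsD(5)[OF F a'(1) b, of "complex_of_real (norm a)"] a'(3) by metis
  moreover have "F c b = complex_of_real (norm b) * F c b'" if "c \<in> A" for c
    using formsD(3)[OF F that b'(1), of "complex_of_real (norm b)"] b'(3) by metis
  ultimately have "F a b - F 0 b = complex_of_real (norm a) * (complex_of_real (norm b) * (F a' b' - F 0 b'))"
    using a'(1) by (simp add: algebra_simps)
  hence "cmod (F a b - F 0 b) = norm a * (norm b * cmod (F a' b' - F 0 b'))"
    by (simp add: norm_mult)
  also have "\<dots> \<le> norm a * (norm b * (form_norm F + form_norm F))"
    using form_norm_upper[OF F a'(1) b'(1) a'(2) b'(2)] form_norm_upper[OF F A_zero b'(1) _ b'(2)]
    by (intro mult_left_mono order_trans[OF norm_triangle_ineq4] add_mono) simp_all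
  finally show ?thesis by (simp add: algebra_simps)
qed

lemma form_bound:
  assumes F: "F \<in> forms" and a: "a \<in> A" and b: "b \<in> A"
  shows "cmod (F a b) \<le> 2 * form_norm F * (1 + norm a) * norm b"
proof -
  have "cmod (F a b) \<le> cmod (F a b - F 0 b) + cmod (F 0 b)"
    using norm_triangle_sub[of "F a b" "F 0 b"] by simp
  also have "\<dots> \<le> 2 * form_norm F * norm a * norm b + form_norm F * norm b"
    by (intro add_mono form_diff_bound form_zero_bound F a b)
  also have "\<dots> \<le> 2 * form_norm F * (1 + norm a) * norm b"
    using form_norm_nonneg[OF F] by (simp add: algebra_simps)
  finally show ?thesis .
qed

definition form_add :: "('a \<Rightarrow> 'a \<Rightarrow> complex) \<Rightarrow> ('a \<Rightarrow> 'a \<Rightarrow> complex) \<Rightarrow> 'a \<Rightarrow> 'a \<Rightarrow> complex"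
  where "form_add F G = (\<lambda>a b. F a b + G a b)"

definition form_scale :: "complex \<Rightarrow> ('a \<Rightarrow> 'a \<Rightarrow> complex) \<Rightarrow> 'a \<Rightarrow> 'a \<Rightarrow> complex"
  where "form_scale k F = (\<lambda>a b. k * F a b)"

text \<open>These actions are dual to those on the kernel of the multiplication of \<open>A\<^sup>1\<close>, where the tensor
  \<open>a \<otimes> b\<close> stands for \<open>a \<otimes> b - a b \<otimes> 1\<close>: there \<open>c \<cdot> (a \<otimes> b) = c a \<otimes> b\<close> and \<open>(a \<otimes> b) \<cdot> c = a \<otimes> b c - a b \<otimes> c\<close>. So
  \<open>\<Phi> \<cdot> c\<close> is \<open>\<Phi> (c a, b)\<close> and \<open>c \<cdot> \<Phi>\<close> is \<open>\<Phi> (a, b c) - \<Phi> (a b, c)\<close>, with \<open>1 + a\<close> in the place of \<open>a\<close>.\<close>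

definition form_ract :: "('a \<Rightarrow> 'a \<Rightarrow> complex) \<Rightarrow> 'a \<Rightarrow> 'a \<Rightarrow> 'a \<Rightarrow> complex"
  where "form_ract F c = (\<lambda>a b. if a \<in> A \<and> b \<in> A then F (c + mul c a) b - F 0 b else 0)"

definition form_lact :: "'a \<Rightarrow> ('a \<Rightarrow> 'a \<Rightarrow> complex) \<Rightarrow> 'a \<Rightarrow> 'a \<Rightarrow> complex"
  where "form_lact c F = (\<lambda>a b. if a \<in> A \<and> b \<in> A
    then F a (mul b c) - F (b + mul a b) c + F 0 c else 0)"

lemmas form_op_defs = form_add_def form_scale_def form_ract_def form_lact_def

lemma form_add_closed:
  assumes F: "F \<in> forms" and G: "G \<in> forms"
  shows "form_add F G \<in> forms"
proof (rule formsI)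
  fix a b assume ab: "a \<in> A" "b \<in> A"
  show "cmod (form_add F G a b) \<le> (2 * form_norm F + 2 * form_norm G) * (1 + norm a) * norm b"
    unfolding form_add_def distrib_right by (intro norm_triangle_mono form_bound F G ab)
qed (simp_all add: form_add_def formsD[OF F] formsD[OF G] algebra_simps)

lemma form_scale_closed:
  assumes F: "F \<in> forms"
  shows "form_scale k F \<in> forms"
proof (rule formsI)
  fix a b assume ab: "a \<in> A" "b \<in> A"
  show "cmod (form_scale k F a b) \<le> (cmod k * (2 * form_norm F)) * (1 + norm a) * norm b"
    using mult_left_mono[OF form_bound[OF F ab], of "cmod k"]
    by (simp add: form_scale_def norm_mult mult.assoc)
qed (auto simp: form_scale_def formsD[OF F] algebra_simps)

lemma form_ract_bound:
  assumes F: "F \<in> forms" and c: "c \<in> A" and a: "a \<in> A" and b: "b \<in> A"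
  shows "cmod (form_ract F c a b) \<le> (2 * form_norm F * norm c) * (1 + norm a) * norm b"
proof -
  have "norm (c + mul c a) \<le> norm c * (1 + norm a)"
    using norm_triangle_ineq[of c "mul c a"] norm_mul[OF c a] by (simp add: algebra_simps)
  hence "2 * form_norm F * norm (c + mul c a) * norm b \<le> 2 * form_norm F * (norm c * (1 + norm a)) * norm b"
    using form_norm_nonneg[OF F] by (intro mult_right_mono mult_left_mono) simp_all
  moreover have "cmod (form_ract F c a b) \<le> 2 * form_norm F * norm (c + mul c a) * norm b"
    using a b c by (simp add: form_ract_def form_diff_bound[OF F] mul_closed)
  ultimately show ?thesis by (simp add: mult.assoc)
qed

lemma form_lact_bound:
  assumes F: "F \<in> forms" and c: "c \<in> A" and a: "a \<in> A" and b: "b \<in> A"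
  shows "cmod (form_lact c F a b) \<le> (4 * form_norm F * norm c) * (1 + norm a) * norm b"
proof -
  have N: "0 \<le> form_norm F" by (rule form_norm_nonneg[OF F])
  have "norm (b + mul a b) \<le> (1 + norm a) * norm b"
    using norm_triangle_ineq[of b "mul a b"] norm_mul[OF a b] by (simp add: algebra_simps)
  hence 1: "2 * form_norm F * norm (b + mul a b) * norm c \<le> 2 * form_norm F * ((1 + norm a) * norm b) * norm c"
    using N by (intro mult_right_mono mult_left_mono) simp_all
  have 2: "2 * form_norm F * (1 + norm a) * norm (mul b c) \<le> 2 * form_norm F * (1 + norm a) * (norm b * norm c)"
    using N norm_mul[OF b c] by (intro mult_left_mono) simp_all
  have "cmod (form_lact c F a b) = cmod (F a (mul b c) - (F (b + mul a b) c - F 0 c))"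
    using a b by (simp add: form_lact_def algebra_simps)
  also have "\<dots> \<le> cmod (F a (mul b c)) + cmod (F (b + mul a b) c - F 0 c)"
    by (rule norm_triangle_ineq4)
  also have "\<dots> \<le> 2 * form_norm F * (1 + norm a) * norm (mul b c) + 2 * form_norm F * norm (b + mul a b) * norm c"
    using a b c by (intro add_mono form_bound[OF F] form_diff_bound[OF F]) (simp_all add: mul_closed)
  also have "\<dots> \<le> (4 * form_norm F * norm c) * (1 + norm a) * norm b"
    using 1 2 by (simp add: algebra_simps)
  finally show ?thesis .
qed

lemma form_ract_closed:
  assumes F: "F \<in> forms" and c: "c \<in> A"
  shows "form_ract F c \<in> forms"
proof (rule formsI)
  fix a b d k assume a: "a \<in> A" and b: "b \<in> A"
  show "cmod (form_ract F c a b) \<le> (2 * form_norm F * norm c) * (1 + norm a) * norm b"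
    by (rule form_ract_bound[OF F c a b])
  have "c + mul c (k *\<^sub>C a) = k *\<^sub>C (c + mul c a) + (1 - k) *\<^sub>C c"
    using a c by (simp add: mul_scaleC_right scaleC_add_right complex_vector.scale_left_diff_distrib)
  thus "form_ract F c (k *\<^sub>C a) b = k * form_ract F c a b + (1 - k) * form_ract F c 0 b"
    using a b c by (simp add: form_ract_def formsD[OF F] mul_closed algebra_simps)
  assume d: "d \<in> A"
  have "c + mul c (a + b) + c = (c + mul c a) + (c + mul c b)"
    using a b c by (simp add: mul_add_right)
  hence "F (c + mul c (a + b) + c) d = F ((c + mul c a) + (c + mul c b)) d" by (simp only:)
  hence "F (c + mul c (a + b)) d + F c d - F 0 d = F (c + mul c a) d + F (c + mul c b) d - F 0 d"
    using a b c d formsD(4)[OF F, of "c + mul c (a + b)" c d]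
      formsD(4)[OF F, of "c + mul c a" "c + mul c b" d] by (simp add: mul_closed)
  thus "form_ract F c (a + b) d = form_ract F c a d + form_ract F c b d - form_ract F c 0 d"
    using a b c d by (simp add: form_ract_def mul_closed algebra_simps)
qed (use c in \<open>auto simp: form_ract_def formsD[OF F] mul_closed algebra_simps\<close>)

lemma form_lact_closed:
  assumes F: "F \<in> forms" and c: "c \<in> A"
  shows "form_lact c F \<in> forms"
proof (rule formsI)
  fix a b d k assume a: "a \<in> A" and b: "b \<in> A"
  show "cmod (form_lact c F a b) \<le> (4 * form_norm F * norm c) * (1 + norm a) * norm b"
    by (rule form_lact_bound[OF F c a b])
  have "k *\<^sub>C b + mul a (k *\<^sub>C b) = k *\<^sub>C (b + mul a b)"
    using a b by (simp add: mul_scaleC_right scaleC_add_right)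
  thus "form_lact c F a (k *\<^sub>C b) = k * form_lact c F a b"
    using a b c by (simp add: form_lact_def formsD[OF F] mul_closed mul_scaleC_left algebra_simps)
  have "b + mul (k *\<^sub>C a) b = k *\<^sub>C (b + mul a b) + (1 - k) *\<^sub>C b"
    using a b by (simp add: mul_scaleC_left scaleC_add_right complex_vector.scale_left_diff_distrib)
  thus "form_lact c F (k *\<^sub>C a) b = k * form_lact c F a b + (1 - k) * form_lact c F 0 b"
    using a b c by (simp add: form_lact_def formsD[OF F] mul_closed algebra_simps)
  assume d: "d \<in> A"
  have "b + d + mul a (b + d) = (b + mul a b) + (d + mul a d)"
    using a b d by (simp add: mul_add_right)
  thus "form_lact c F a (b + d) = form_lact c F a b + form_lact c F a d"
    using a b c d by (simp add: form_lact_def formsD[OF F] mul_closed mul_add_left algebra_simps)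
  have "d + mul (a + b) d + d = (d + mul a d) + (d + mul b d)"
    using a b d by (simp add: mul_add_left)
  hence "F (d + mul (a + b) d + d) c = F ((d + mul a d) + (d + mul b d)) c" by (simp only:)
  hence "F (d + mul (a + b) d) c + F d c - F 0 c = F (d + mul a d) c + F (d + mul b d) c - F 0 c"
    using a b c d formsD(4)[OF F, of "d + mul (a + b) d" d c]
      formsD(4)[OF F, of "d + mul a d" "d + mul b d" c] by (simp add: mul_closed)
  thus "form_lact c F (a + b) d = form_lact c F a d + form_lact c F b d - form_lact c F 0 d"
    using a b c d by (simp add: form_lact_def formsD[OF F] mul_closed algebra_simps)
qed (auto simp: form_lact_def)

text \<open>Singletons carry the forms into the type over which amenability quantifies.\<close>

definition universal_bimodule :: "('a, 'a bimodule_universe) bimodule"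
  where "universal_bimodule =
    \<lparr>carrier = (\<lambda>F. {F}) ` forms,
     monoid.mult = undefined,
     one = undefined,
     zero = {\<lambda>_ _. 0},
     add = (\<lambda>x y. {form_add (the_elem x) (the_elem y)}),
     smult = (\<lambda>k x. {form_scale k (the_elem x)}),
     mnorm = (\<lambda>x. form_norm (the_elem x)),
     lact = (\<lambda>c x. {form_lact c (the_elem x)}),
     ract = (\<lambda>x c. {form_ract (the_elem x) c})\<rparr>"

lemma universal_bimodule_simps [simp]:
  "carrier universal_bimodule = (\<lambda>F. {F}) ` forms"
  "\<zero>\<^bsub>universal_bimodule\<^esub> = {\<lambda>_ _. 0}"
  "x \<oplus>\<^bsub>universal_bimodule\<^esub> y = {form_add (the_elem x) (the_elem y)}"
  "k \<odot>\<^bsub>universal_bimodule\<^esub> x = {form_scale k (the_elem x)}"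
  "mnorm universal_bimodule x = form_norm (the_elem x)"
  "lact universal_bimodule c x = {form_lact c (the_elem x)}"
  "ract universal_bimodule x c = {form_ract (the_elem x) c}"
  by (simp_all add: universal_bimodule_def)

lemma form_zero_closed: "(\<lambda>_ _. 0) \<in> forms"
  by (rule formsI[of _ 0]) simp_all

lemma abelian_group_universal_bimodule: "abelian_group universal_bimodule"
proof (rule abelian_groupI)
  fix x assume "x \<in> carrier universal_bimodule"
  then obtain F where F: "F \<in> forms" "x = {F}" by auto
  show "\<exists>y\<in>carrier universal_bimodule. y \<oplus>\<^bsub>universal_bimodule\<^esub> x = \<zero>\<^bsub>universal_bimodule\<^esub>"
    using form_scale_closed[OF F(1), of "-1"]
    by (intro bexI[of _ "{form_scale (-1) F}"]) (auto simp: F(2) form_add_def form_scale_def)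
  fix y assume "y \<in> carrier universal_bimodule"
  thus "x \<oplus>\<^bsub>universal_bimodule\<^esub> y \<in> carrier universal_bimodule"
    using F by (auto simp: form_add_closed)
qed (auto simp: form_zero_closed form_add_def add_ac)

lemma universal_minus:
  assumes F: "F \<in> forms" and G: "G \<in> forms"
  shows "{F} \<ominus>\<^bsub>universal_bimodule\<^esub> {G} = {\<lambda>a b. F a b - G a b}"
proof -
  interpret U: abelian_group universal_bimodule by (rule abelian_group_universal_bimodule)
  have "\<ominus>\<^bsub>universal_bimodule\<^esub> {G} = {form_scale (-1) G}"
    using G form_scale_closed[OF G, of "-1"]
    by (intro U.minus_equality) (auto simp: form_add_def form_scale_def)
  thus ?thesis by (simp add: a_minus_def form_add_def form_scale_def)
qed

lemma form_diff_closed: "F \<in> forms \<Longrightarrow> G \<in> forms \<Longrightarrow> (\<lambda>a b. F a b - G a b) \<in> forms"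
  using form_add_closed[OF _ form_scale_closed, of F G "-1"] by (simp add: form_add_def form_scale_def)

text \<open>The limit is taken pointwise. It is a form because its axioms are closed conditions and Cauchy
  sequences are uniformly bounded.\<close>

lemma forms_complete:
  fixes G :: "nat \<Rightarrow> 'a \<Rightarrow> 'a \<Rightarrow> complex"
  assumes G: "\<And>n. G n \<in> forms"
    and Cauchy: "\<And>e. e > 0 \<Longrightarrow> \<exists>N. \<forall>m\<ge>N. \<forall>n\<ge>N. form_norm (\<lambda>a b. G m a b - G n a b) < e"
  obtains L where "L \<in> forms" "(\<lambda>n. form_norm (\<lambda>a b. G n a b - L a b)) \<longlonglongrightarrow> 0"
proof -
  have diff: "cmod (G m a b - G n a b) \<le> 2 * form_norm (\<lambda>a b. G m a b - G n a b) * ((1 + norm a) * norm b)"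
    if "a \<in> A" "b \<in> A" for m n a b
    using form_bound[OF form_diff_closed[OF G G] that, of m n] by (simp add: mult.assoc)
  define L where "L a b = lim (\<lambda>n. G n a b)" for a b
  have L: "(\<lambda>n. G n a b) \<longlonglongrightarrow> L a b" for a b
  proof (cases "a \<in> A \<and> b \<in> A")
    case False
    hence "(\<lambda>n. G n a b) = (\<lambda>_. 0)" using formsD(1)[OF G] by auto
    thus ?thesis by (simp add: L_def)
  next
    case True
    have "Cauchy (\<lambda>n. G n a b)"
    proof (rule metric_CauchyI)
      fix e :: real assume e: "e > 0"
      define B where "B = 2 * ((1 + norm a) * norm b) + 1"
      have B: "B > 0" by (simp add: B_def add_nonneg_pos)
      with e have "e / B > 0" by simp
      then obtain N where N: "\<And>m n. m \<ge> N \<Longrightarrow> n \<ge> N \<Longrightarrow> form_norm (\<lambda>a b. G m a b - G n a b) < e / B"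
        using Cauchy by meson
      have "dist (G m a b) (G n a b) < e" if "m \<ge> N" "n \<ge> N" for m n
      proof -
        have "dist (G m a b) (G n a b) \<le> form_norm (\<lambda>a b. G m a b - G n a b) * (2 * ((1 + norm a) * norm b))"
          using diff[of a b m n] True by (simp add: dist_norm mult.commute)
        also have "\<dots> \<le> (e / B) * (2 * ((1 + norm a) * norm b))"
          using N[OF that] by (intro mult_right_mono) simp_all
        also have "\<dots> < (e / B) * B"
          using e B by (intro mult_strict_left_mono) (simp_all add: B_def)
        also have "\<dots> = e" using B by simp
        finally show ?thesis .
      qed
      thus "\<exists>N. \<forall>m\<ge>N. \<forall>n\<ge>N. dist (G m a b) (G n a b) < e" by blast
    qed
    thus ?thesis unfolding L_def by (simp add: Cauchy_convergent_iff convergent_LIMSEQ_iff)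
  qed
  have L_eqI: "L a b = x" if "(\<lambda>n. G n a b) \<longlonglongrightarrow> x" for a b x
    using L that by (rule LIMSEQ_unique)
  have close: "\<exists>N. \<forall>n\<ge>N. \<forall>a\<in>A. \<forall>b\<in>A. cmod (G n a b - L a b) \<le> 2 * e * ((1 + norm a) * norm b)"
    if e: "e > 0" for e
  proof -
    obtain N where N: "\<And>m n. m \<ge> N \<Longrightarrow> n \<ge> N \<Longrightarrow> form_norm (\<lambda>a b. G m a b - G n a b) < e"
      using Cauchy[OF e] by meson
    have "cmod (G n a b - L a b) \<le> 2 * e * ((1 + norm a) * norm b)" if n: "n \<ge> N" and ab: "a \<in> A" "b \<in> A" for n a b
    proof (rule LIMSEQ_le_const2)
      show "(\<lambda>m. cmod (G n a b - G m a b)) \<longlonglongrightarrow> cmod (G n a b - L a b)"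
        by (intro tendsto_intros L)
      have "cmod (G n a b - G m a b) \<le> 2 * e * ((1 + norm a) * norm b)" if "m \<ge> N" for m
        using N[OF n that] by (intro order_trans[OF diff[OF ab]] mult_right_mono) simp_all
      thus "\<exists>N. \<forall>m\<ge>N. cmod (G n a b - G m a b) \<le> 2 * e * ((1 + norm a) * norm b)" by blast
    qed
    thus ?thesis by blast
  qed
  have "L \<in> forms"
  proof -
    obtain N where N: "\<And>a b. a \<in> A \<Longrightarrow> b \<in> A \<Longrightarrow> cmod (G N a b - L a b) \<le> 2 * 1 * ((1 + norm a) * norm b)"
      using close[of 1] by auto
    show ?thesis
    proof (rule formsI)
      fix a b assume ab: "a \<in> A" "b \<in> A"
      have "cmod (L a b) \<le> cmod (G N a b) + cmod (G N a b - L a b)"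
        using norm_triangle_sub[of "L a b" "G N a b"] by (simp add: norm_minus_commute)
      also have "\<dots> \<le> 2 * form_norm (G N) * (1 + norm a) * norm b + 2 * 1 * ((1 + norm a) * norm b)"
        by (intro add_mono form_bound[OF G] N ab)
      finally show "cmod (L a b) \<le> (2 * form_norm (G N) + 2) * (1 + norm a) * norm b"
        by (simp add: algebra_simps)
    next
      show "L a b = 0" if "a \<notin> A \<or> b \<notin> A" for a b
        by (rule L_eqI) (simp add: formsD(1)[OF G that])
      fix a b c k assume ab: "a \<in> A" "b \<in> A"
      show "L a (k *\<^sub>C b) = k * L a b"
        by (rule L_eqI) (simp add: formsD(3)[OF G ab] tendsto_mult_left L)
      show "L (k *\<^sub>C a) b = k * L a b + (1 - k) * L 0 b"
        by (rule L_eqI) (simp add: formsD(5)[OF G ab] tendsto_intros L)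
      assume c: "c \<in> A"
      show "L a (b + c) = L a b + L a c"
        by (rule L_eqI) (simp add: formsD(2)[OF G ab c] tendsto_intros L)
      show "L (a + b) c = L a c + L b c - L 0 c"
        by (rule L_eqI) (simp add: formsD(4)[OF G ab c] tendsto_intros L)
    qed
  qed
  moreover have "(\<lambda>n. form_norm (\<lambda>a b. G n a b - L a b)) \<longlonglongrightarrow> 0"
  proof (rule metric_LIMSEQ_I)
    fix e :: real assume e: "e > 0"
    hence "e / 8 > 0" by simp
    from close[OF this] obtain N where
      N: "\<And>n a b. n \<ge> N \<Longrightarrow> a \<in> A \<Longrightarrow> b \<in> A \<Longrightarrow> cmod (G n a b - L a b) \<le> 2 * (e / 8) * ((1 + norm a) * norm b)"
      by blast
    have "dist (form_norm (\<lambda>a b. G n a b - L a b)) 0 < e" if n: "n \<ge> N" for n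
    proof -
      have "form_norm (\<lambda>a b. G n a b - L a b) \<le> 2 * (e / 8) * (2 * 1)"
      proof (rule form_norm_le)
        fix a b assume ab: "a \<in> A" "b \<in> A" "norm a \<le> 1" "norm b \<le> 1"
        have "2 * (e / 8) * ((1 + norm a) * norm b) \<le> 2 * (e / 8) * (2 * 1)"
          using ab e by (intro mult_left_mono mult_mono) simp_all
        with N[OF n ab(1,2)] show "cmod (G n a b - L a b) \<le> 2 * (e / 8) * (2 * 1)" by linarith
      qed
      moreover have "0 \<le> form_norm (\<lambda>a b. G n a b - L a b)"
        by (rule form_norm_nonneg[OF form_diff_closed[OF G \<open>L \<in> forms\<close>]])
      ultimately show ?thesis using e by (simp add: dist_real_def)
    qed
    thus "\<exists>N. \<forall>n\<ge>N. dist (form_norm (\<lambda>a b. G n a b - L a b)) 0 < e" by blast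
  qed
  ultimately show ?thesis by (rule that)
qed

lemma form_norm_eq_0_iff:
  assumes F: "F \<in> forms" shows "form_norm F = 0 \<longleftrightarrow> F = (\<lambda>_ _. 0)"
proof
  assume 0: "form_norm F = 0"
  show "F = (\<lambda>_ _. 0)"
  proof (intro ext)
    fix a b
    show "F a b = 0"
      using form_bound[OF F, of a b] formsD(1)[OF F, of a b] 0 by (cases "a \<in> A \<and> b \<in> A") auto
  qed
next
  assume "F = (\<lambda>_ _. 0)"
  moreover have "form_norm (\<lambda>_ _. 0) \<le> 0" by (rule form_norm_le) simp
  ultimately show "form_norm F = 0" using form_norm_nonneg[OF F] by simp
qed

lemma form_norm_scale:
  assumes F: "F \<in> forms" shows "form_norm (form_scale k F) = cmod k * form_norm F"
proof (cases "k = 0")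
  case True
  have "form_scale 0 F = (\<lambda>_ _. 0)" by (simp add: form_scale_def)
  then show ?thesis using True form_norm_eq_0_iff[OF form_zero_closed] by simp
next
  case False
  have le: "form_norm (form_scale k F) \<le> cmod k * form_norm F" if "F \<in> forms" for k F
    by (rule form_norm_le) (simp add: form_scale_def norm_mult mult_left_mono form_norm_upper[OF that])
  have "F = form_scale (inverse k) (form_scale k F)"
    using False by (simp add: form_scale_def fun_eq_iff)
  hence "form_norm F \<le> cmod (inverse k) * form_norm (form_scale k F)"
    using le[OF form_scale_closed[OF F], of "inverse k" k] by simp
  hence "cmod k * form_norm F \<le> form_norm (form_scale k F)"
    using False by (simp add: norm_inverse norm_divide field_simps)
  with le[OF F, of k] show ?thesis by simp
qed

lemma form_norm_triangle:
  assumes F: "F \<in> forms" and G: "G \<in> forms"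
  shows "form_norm (form_add F G) \<le> form_norm F + form_norm G"
  by (rule form_norm_le) (simp add: form_add_def norm_triangle_mono form_norm_upper F G)

lemma complex_banach_space_universal: "complex_banach_space universal_bimodule"
proof -
  interpret module complex_ring universal_bimodule
  proof (rule moduleI[OF cring_complex_ring abelian_group_universal_bimodule])
    fix k l x assume "x \<in> carrier universal_bimodule"
    then obtain F where F: "F \<in> forms" "x = {F}" by auto
    thus "k \<odot>\<^bsub>universal_bimodule\<^esub> x \<in> carrier universal_bimodule"
      by (simp add: form_scale_closed)
    show "(k \<otimes>\<^bsub>complex_ring\<^esub> l) \<odot>\<^bsub>universal_bimodule\<^esub> x
        = k \<odot>\<^bsub>universal_bimodule\<^esub> (l \<odot>\<^bsub>universal_bimodule\<^esub> x)"
      by (simp add: complex_ring_def form_scale_def mult.assoc)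
    show "(k \<oplus>\<^bsub>complex_ring\<^esub> l) \<odot>\<^bsub>universal_bimodule\<^esub> x
        = k \<odot>\<^bsub>universal_bimodule\<^esub> x \<oplus>\<^bsub>universal_bimodule\<^esub> l \<odot>\<^bsub>universal_bimodule\<^esub> x"
      by (simp add: complex_ring_def form_scale_def form_add_def distrib_right)
    show "\<one>\<^bsub>complex_ring\<^esub> \<odot>\<^bsub>universal_bimodule\<^esub> x = x"
      by (simp add: complex_ring_def form_scale_def F(2))
    fix y assume "y \<in> carrier universal_bimodule"
    show "k \<odot>\<^bsub>universal_bimodule\<^esub> (x \<oplus>\<^bsub>universal_bimodule\<^esub> y)
        = k \<odot>\<^bsub>universal_bimodule\<^esub> x \<oplus>\<^bsub>universal_bimodule\<^esub> k \<odot>\<^bsub>universal_bimodule\<^esub> y"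
      by (simp add: form_scale_def form_add_def distrib_left)
  qed
  show ?thesis
  proof unfold_locales
    fix s :: "nat \<Rightarrow> 'a bimodule_universe"
    assume s: "\<And>n. s n \<in> carrier universal_bimodule"
      and Cauchy: "\<And>e. e > 0 \<Longrightarrow> \<exists>N. \<forall>m\<ge>N. \<forall>n\<ge>N. mnorm universal_bimodule (s m \<ominus>\<^bsub>universal_bimodule\<^esub> s n) < e"
    have "\<exists>F. s n = {F} \<and> F \<in> forms" for n
      using s[of n] by auto
    then obtain G where sG: "\<And>n. s n = {G n}" and G: "\<And>n. G n \<in> forms" by metis
    have "\<exists>N. \<forall>m\<ge>N. \<forall>n\<ge>N. form_norm (\<lambda>a b. G m a b - G n a b) < e" if "e > 0" for e
      using Cauchy[OF that] by (simp add: sG universal_minus G)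
    from forms_complete[OF G this] obtain L where
      L: "L \<in> forms" "(\<lambda>n. form_norm (\<lambda>a b. G n a b - L a b)) \<longlonglongrightarrow> 0" by blast
    show "\<exists>l\<in>carrier universal_bimodule.
        (\<lambda>n. mnorm universal_bimodule (s n \<ominus>\<^bsub>universal_bimodule\<^esub> l)) \<longlonglongrightarrow> 0"
      using L by (intro bexI[of _ "{L}"]) (simp_all add: sG universal_minus G)
  qed (auto simp: form_norm_eq_0_iff form_norm_scale form_norm_triangle)
qed

lemma banach_bimodule_universal: "banach_bimodule A mul universal_bimodule"
proof -
  interpret U: complex_banach_space universal_bimodule by (rule complex_banach_space_universal)
  show ?thesis
  proof unfold_locales
    fix a b k x
    assume a: "a \<in> A" and "x \<in> carrier universal_bimodule"
    then obtain F where F: "F \<in> forms" "x = {F}" by auto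
    note [simp] = formsD[OF F(1)] mul_closed a F(2)
    show "lact universal_bimodule (k *\<^sub>C a) x = k \<odot>\<^bsub>universal_bimodule\<^esub> lact universal_bimodule a x"
      by (auto simp: form_op_defs fun_eq_iff mul_scaleC_right algebra_simps)
    show "ract universal_bimodule x (k *\<^sub>C a) = k \<odot>\<^bsub>universal_bimodule\<^esub> ract universal_bimodule x a"
    proof -
      have "k *\<^sub>C a + mul (k *\<^sub>C a) c = k *\<^sub>C (a + mul a c)" if "c \<in> A" for c
        using that by (simp add: mul_scaleC_left scaleC_add_right)
      thus ?thesis by (auto simp: form_op_defs fun_eq_iff algebra_simps)
    qed
    assume b: "b \<in> A"
    note [simp] = b
    show "lact universal_bimodule (a + b) x
        = lact universal_bimodule a x \<oplus>\<^bsub>universal_bimodule\<^esub> lact universal_bimodule b x"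
      by (auto simp: form_op_defs fun_eq_iff mul_add_right algebra_simps)
    show "ract universal_bimodule x (a + b)
        = ract universal_bimodule x a \<oplus>\<^bsub>universal_bimodule\<^esub> ract universal_bimodule x b"
    proof -
      have "a + b + mul (a + b) c = (a + mul a c) + (b + mul b c)" if "c \<in> A" for c
        using that by (simp add: mul_add_left)
      hence "F (a + b + mul (a + b) c) d = F ((a + mul a c) + (b + mul b c)) d" if "c \<in> A" for c d
        using that by (simp only:)
      hence "F (a + b + mul (a + b) c) d = F (a + mul a c) d + F (b + mul b c) d - F 0 d"
        if "c \<in> A" "d \<in> A" for c d
        using that formsD(4)[OF F(1), of "a + mul a c" "b + mul b c" d] by (simp only: A_add mul_closed a b)
      thus ?thesis by (auto simp: form_op_defs fun_eq_iff)
    qed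
    have affine: "F (x + y) d = F x d + F y d - F 0 d" if "x \<in> A" "y \<in> A" "d \<in> A" for x y d
      by (rule formsD(4)[OF F(1) that])
    show "lact universal_bimodule (mul a b) x = lact universal_bimodule a (lact universal_bimodule b x)"
    proof -
      have "a + mul (d + mul c d) a = a + (mul d a + mul c (mul d a))" if "c \<in> A" "d \<in> A" for c d
        using that by (simp add: mul_add_left mul_assoc)
      hence "F (a + mul (d + mul c d) a) b = F a b + F (mul d a + mul c (mul d a)) b - F 0 b"
        if "c \<in> A" "d \<in> A" for c d
        using that affine[of a "mul d a + mul c (mul d a)" b] by (simp only: A_add mul_closed a b)
      thus ?thesis by (auto simp: form_lact_def fun_eq_iff mul_assoc simp del: formsD(4)[OF F(1)])
    qed
    show "ract universal_bimodule x (mul a b) = ract universal_bimodule (ract universal_bimodule x a) b"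
    proof -
      have "a + mul a (b + mul b c) = a + (mul a b + mul (mul a b) c)" if "c \<in> A" for c
        using that by (simp add: mul_add_right mul_assoc)
      hence "F (a + mul a (b + mul b c)) d = F a d + F (mul a b + mul (mul a b) c) d - F 0 d"
        if "c \<in> A" "d \<in> A" for c d
        using that affine[of a "mul a b + mul (mul a b) c" d] by (simp only: A_add mul_closed a b)
      thus ?thesis by (auto simp: form_ract_def fun_eq_iff simp del: formsD(4)[OF F(1)])
    qed
    show "ract universal_bimodule (lact universal_bimodule a x) b
        = lact universal_bimodule a (ract universal_bimodule x b)"
    proof -
      have "F (d + mul (b + mul b c) d) a - F d a = F (b + mul b (d + mul c d)) a - F b a"
        if cd: "c \<in> A" "d \<in> A" for c d
      proof -
        have "mul (b + mul b c) d = mul b (d + mul c d)"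
          using cd by (simp add: mul_add_left mul_add_right mul_assoc)
        thus ?thesis
          using cd affine[of d "mul b (d + mul c d)" a] affine[of b "mul b (d + mul c d)" a]
          by (simp only: A_add mul_closed a b) simp
      qed
      hence "F (d + mul (b + mul b c) d) a = F (b + mul b (d + mul c d)) a - F b a + F d a"
        if "c \<in> A" "d \<in> A" for c d
        using that by (simp add: algebra_simps del: formsD(4)[OF F(1)])
      thus ?thesis
        by (auto simp: form_lact_def form_ract_def fun_eq_iff simp del: formsD(4)[OF F(1)])
    qed
  next
    show "\<exists>K. \<forall>a\<in>A. \<forall>x\<in>carrier universal_bimodule.
      mnorm universal_bimodule (lact universal_bimodule a x) \<le> K * norm a * mnorm universal_bimodule x \<and>
      mnorm universal_bimodule (ract universal_bimodule x a) \<le> K * norm a * mnorm universal_bimodule x"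
    proof (intro exI[of _ 8] ballI conjI)
      fix c x assume c: "c \<in> A" and "x \<in> carrier universal_bimodule"
      then obtain F where F: "F \<in> forms" "x = {F}" by auto
      have small: "C * (1 + norm a) * norm b \<le> C * 2 * 1"
        if "0 \<le> C" "norm a \<le> 1" "norm b \<le> 1" for C and a b :: 'a
        using that by (intro mult_mono mult_left_mono) simp_all
      have N: "0 \<le> form_norm F * norm c" "0 \<le> norm c * form_norm F"
        using form_norm_nonneg[OF F(1)] by simp_all
      have "form_norm (form_lact c F) \<le> (4 * form_norm F * norm c) * 2 * 1"
        using N by (intro form_norm_le order_trans[OF form_lact_bound[OF F(1) c]] small) simp_all
      thus "mnorm universal_bimodule (lact universal_bimodule c x) \<le> 8 * norm c * mnorm universal_bimodule x"
        by (simp add: F(2) ac_simps)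
      have "form_norm (form_ract F c) \<le> (2 * form_norm F * norm c) * 2 * 1"
        using N by (intro form_norm_le order_trans[OF form_ract_bound[OF F(1) c]] small) simp_all
      thus "mnorm universal_bimodule (ract universal_bimodule x c) \<le> 8 * norm c * mnorm universal_bimodule x"
        using N by (simp add: F(2) ac_simps)
    qed
  qed (auto simp: form_lact_closed form_ract_closed, (auto simp: form_op_defs fun_eq_iff algebra_simps)+)
qed

text \<open>Evaluation of forms at \<open>(1, s)\<close>.\<close>

definition universal_derivation :: "'a \<Rightarrow> 'a bimodule_universe \<Rightarrow> complex"
  where "universal_derivation s = (\<lambda>x\<in>carrier universal_bimodule. the_elem x 0 s)"

lemma universal_derivation_closed:
  assumes s: "s \<in> A"
  shows "universal_derivation s \<in> carrier (dual_bimodule universal_bimodule)"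
proof -
  interpret U: complex_banach_space universal_bimodule by (rule complex_banach_space_universal)
  show ?thesis
  proof (rule U.dual_carrierI)
    fix x assume "x \<in> carrier universal_bimodule"
    then obtain F where F: "F \<in> forms" "x = {F}" by auto
    thus "cmod (universal_derivation s x) \<le> norm s * mnorm universal_bimodule x"
      using form_zero_bound[OF F(1) s] by (simp add: universal_derivation_def mult.commute)
  next
    fix x y assume "x \<in> carrier universal_bimodule" "y \<in> carrier universal_bimodule"
    then obtain F G where "F \<in> forms" "x = {F}" "G \<in> forms" "y = {G}" by auto
    thus "universal_derivation s (x \<oplus>\<^bsub>universal_bimodule\<^esub> y) = universal_derivation s x + universal_derivation s y"
      by (simp add: universal_derivation_def form_add_closed) (simp add: form_add_def)
  next
    fix x k assume "x \<in> carrier universal_bimodule"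
    then obtain F where "F \<in> forms" "x = {F}" by auto
    thus "universal_derivation s (k \<odot>\<^bsub>universal_bimodule\<^esub> x) = k * universal_derivation s x"
      by (simp add: universal_derivation_def form_scale_closed) (simp add: form_scale_def)
  qed (simp add: universal_derivation_def)
qed

text \<open>The derivation rule is the identity
  \<open>\<Phi> (1, a b) = \<Phi> (a, b) + (\<Phi> (1, a b) - \<Phi> (a, b))\<close>, whose summands are the values of \<open>\<Phi> \<cdot> a\<close> at \<open>(1, b)\<close>
  and of \<open>b \<cdot> \<Phi>\<close> at \<open>(1, a)\<close>.\<close>

lemma continuous_derivation_universal:
  "continuous_derivation A mul (dual_bimodule universal_bimodule) universal_derivation"
proof -
  interpret U: complex_banach_space universal_bimodule by (rule complex_banach_space_universal)
  note [simp] = universal_derivation_closed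
  have apply_simp: "universal_derivation s {F} = F 0 s" if "F \<in> forms" for s F
    using that by (simp add: universal_derivation_def)
  show ?thesis
    unfolding continuous_derivation_def U.dual_simps(1-5)
  proof (intro conjI ballI allI impI)
    show "universal_derivation \<in> A \<rightarrow> carrier (dual_bimodule universal_bimodule)" by simp
    fix a b k assume a: "a \<in> A"
    show "universal_derivation (k *\<^sub>C a) = (\<lambda>x\<in>carrier universal_bimodule. k * universal_derivation a x)"
      unfolding universal_derivation_def
      by (rule restrict_ext) (auto simp: formsD(3) a)
    assume b: "b \<in> A"
    show "universal_derivation (a + b)
        = (\<lambda>x\<in>carrier universal_bimodule. universal_derivation a x + universal_derivation b x)"
      unfolding universal_derivation_def
      by (rule restrict_ext) (auto simp: formsD(2) a b)
    have "F 0 (mul a b) = (F a b - F 0 b) + (F 0 (mul a b) - F a b + F 0 b)" for F :: "'a \<Rightarrow> 'a \<Rightarrow> complex"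
      by simp
    thus "universal_derivation (mul a b) = (\<lambda>x\<in>carrier universal_bimodule.
        (\<lambda>x\<in>carrier universal_bimodule. universal_derivation b (ract universal_bimodule x a)) x +
        (\<lambda>x\<in>carrier universal_bimodule. universal_derivation a (lact universal_bimodule b x)) x)"
      unfolding universal_derivation_def
      by (intro restrict_ext) (auto simp: form_ract_closed form_lact_closed a b,
        simp add: form_ract_def form_lact_def a b)
  next
    fix a and e :: real assume a: "a \<in> A" and e: "e > 0"
    show "\<exists>d>0. \<forall>b\<in>A. dist b a < d \<longrightarrow> mnorm (dual_bimodule universal_bimodule)
        (universal_derivation b \<ominus>\<^bsub>dual_bimodule universal_bimodule\<^esub> universal_derivation a) < e"
    proof (intro exI[of _ e] conjI ballI impI e)
      fix b assume b: "b \<in> A" and "dist b a < e"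
      have "mnorm (dual_bimodule universal_bimodule)
        (universal_derivation b \<ominus>\<^bsub>dual_bimodule universal_bimodule\<^esub> universal_derivation a) \<le> norm (b - a)"
      proof (rule U.dual_mnorm_le)
        fix x assume "x \<in> carrier universal_bimodule" "mnorm universal_bimodule x \<le> 1"
        then obtain F where F: "F \<in> forms" "x = {F}" "form_norm F \<le> 1" by auto
        have "F 0 (b - a) + F 0 a = F 0 b"
          using formsD(2)[OF F(1) A_zero, of "b - a" a] a b by simp
        hence "F 0 b - F 0 a = F 0 (b - a)" by (simp add: algebra_simps)
        moreover have "form_norm F * norm (b - a) \<le> norm (b - a)"
          using F(3) form_norm_nonneg[OF F(1)] by (simp add: mult_left_le_one_le)
        ultimately show "cmod ((universal_derivation b \<ominus>\<^bsub>dual_bimodule universal_bimodule\<^esub> universal_derivation a) x)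
            \<le> norm (b - a)"
          using form_zero_bound[OF F(1), of "b - a"] a b F(1,2) by (simp add: U.dual_minus apply_simp)
      qed
      with \<open>dist b a < e\<close> show "mnorm (dual_bimodule universal_bimodule)
        (universal_derivation b \<ominus>\<^bsub>dual_bimodule universal_bimodule\<^esub> universal_derivation a) < e"
        by (simp add: dist_norm)
    qed
  qed
qed

lemma amenable_universal_splitting:
  assumes "amenable TYPE('a bimodule_universe) A mul"
  obtains M K where
    "\<And>F G. F \<in> forms \<Longrightarrow> G \<in> forms \<Longrightarrow> M (form_add F G) = M F + M G"
    "\<And>k F. F \<in> forms \<Longrightarrow> M (form_scale k F) = k * M F"
    "\<And>F. F \<in> forms \<Longrightarrow> cmod (M F) \<le> K * form_norm F"
    "\<And>F c. F \<in> forms \<Longrightarrow> c \<in> A \<Longrightarrow> F 0 c = M (form_ract F c) - M (form_lact c F)"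
proof -
  interpret U: banach_bimodule A mul universal_bimodule by (rule banach_bimodule_universal)
  have "inner_derivation A (dual_bimodule universal_bimodule) universal_derivation"
    using assms banach_bimodule_universal continuous_derivation_universal unfolding amenable_def by blast
  then obtain \<mu> where \<mu>: "\<mu> \<in> carrier (dual_bimodule universal_bimodule)"
    and inner: "\<And>a. a \<in> A \<Longrightarrow> universal_derivation a = lact (dual_bimodule universal_bimodule) a \<mu>
      \<ominus>\<^bsub>dual_bimodule universal_bimodule\<^esub> ract (dual_bimodule universal_bimodule) \<mu> a"
    unfolding inner_derivation_def by blast
  note \<mu>D = U.dual_carrierD[OF \<mu>]
  obtain K where K: "\<And>x. x \<in> carrier universal_bimodule \<Longrightarrow> cmod (\<mu> x) \<le> K * mnorm universal_bimodule x"
    using \<mu>D(4) by blast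
  show ?thesis
  proof (rule that[of "\<lambda>F. \<mu> {F}" K])
    fix F c assume F: "F \<in> forms" and c: "c \<in> A"
    show "F 0 c = \<mu> {form_ract F c} - \<mu> {form_lact c F}"
      using fun_cong[OF inner[OF c], of "{F}"] F c
      by (simp add: U.dual_minus U.dual_act_closed \<mu>) (simp add: U.dual_simps universal_derivation_def)
  next
    show "\<mu> {form_add F G} = \<mu> {F} + \<mu> {G}" if "F \<in> forms" "G \<in> forms" for F G
      using \<mu>D(2)[of "{F}" "{G}"] that by simp
    show "\<mu> {form_scale k F} = k * \<mu> {F}" if "F \<in> forms" for k F
      using \<mu>D(3)[of "{F}" k] that by simp
    show "cmod (\<mu> {F}) \<le> K * form_norm F" if "F \<in> forms" for F
      using K[of "{F}"] that by simp
  qed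
qed

text \<open>The encoding of the form that is \<open>\<phi>\<close> on \<open>A \<times> A\<close> and \<open>f\<close> on \<open>1 \<times> A\<close>.\<close>

definition form_of :: "('a \<Rightarrow> 'a \<Rightarrow> complex) \<Rightarrow> ('a \<Rightarrow> complex) \<Rightarrow> 'a \<Rightarrow> 'a \<Rightarrow> complex"
  where "form_of \<phi> f = (\<lambda>a b. if a \<in> A \<and> b \<in> A then \<phi> a b + f b else 0)"

lemma bilinear_on_bound:
  assumes "bilinear_on A K \<phi>" "a \<in> A" "b \<in> A"
  shows "cmod (\<phi> a b) \<le> K * norm a * norm b"
  using functional_onD(4)[OF bilinear_onD(2)[OF assms(1,2)] assms(3)] .

lemma bilinear_on_zero_left:
  assumes \<phi>: "bilinear_on A K \<phi>" and b: "b \<in> A"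
  shows "\<phi> 0 b = 0"
  using bilinear_on_bound[OF \<phi> A_zero b] by simp

lemma form_of_closed:
  assumes \<phi>: "bilinear_on A K \<phi>" and f: "functional_on A L f"
  shows "form_of \<phi> f \<in> forms"
proof (rule formsI)
  note K = bilinear_onD(1)[OF \<phi>] and L = functional_onD(1)[OF f]
  note left = functional_onD(2,3)[OF bilinear_onD(3)[OF \<phi>]] and right = functional_onD(2,3)[OF bilinear_onD(2)[OF \<phi>]]
  fix a b c k assume ab: "a \<in> A" "b \<in> A"
  have "cmod (\<phi> a b + f b) \<le> K * norm a * norm b + L * norm b"
    by (intro norm_triangle_mono bilinear_on_bound[OF \<phi>] functional_onD(4)[OF f] ab)
  also have "\<dots> \<le> (K + L) * (1 + norm a) * norm b"
    using K L by (simp add: algebra_simps)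
  finally show "cmod (form_of \<phi> f a b) \<le> (K + L) * (1 + norm a) * norm b"
    using ab by (simp add: form_of_def)
  show "form_of \<phi> f a (k *\<^sub>C b) = k * form_of \<phi> f a b"
    using ab by (simp add: form_of_def right functional_onD[OF f] distrib_left)
  show "form_of \<phi> f (k *\<^sub>C a) b = k * form_of \<phi> f a b + (1 - k) * form_of \<phi> f 0 b"
    using ab by (simp add: form_of_def left bilinear_on_zero_left[OF \<phi>] algebra_simps)
  assume c: "c \<in> A"
  show "form_of \<phi> f a (b + c) = form_of \<phi> f a b + form_of \<phi> f a c"
    using ab c by (simp add: form_of_def right functional_onD[OF f])
  show "form_of \<phi> f (a + b) c = form_of \<phi> f a c + form_of \<phi> f b c - form_of \<phi> f 0 c"
    using ab c by (simp add: form_of_def left bilinear_on_zero_left[OF \<phi>])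
qed (auto simp: form_of_def)

lemma form_norm_form_of:
  assumes \<phi>: "bilinear_on A K \<phi>" and f: "functional_on A L f"
  shows "form_norm (form_of \<phi> f) \<le> K + L"
proof (rule form_norm_le)
  fix a b assume ab: "a \<in> A" "b \<in> A" "norm a \<le> 1" "norm b \<le> 1"
  have "K * norm a * norm b \<le> K * 1 * 1"
    using bilinear_onD(1)[OF \<phi>] ab by (intro mult_mono) simp_all
  moreover have "L * norm b \<le> L * 1"
    using functional_onD(1)[OF f] ab by (intro mult_left_mono) simp_all
  ultimately have "cmod (\<phi> a b) \<le> K" "cmod (f b) \<le> L"
    using bilinear_on_bound[OF \<phi> ab(1,2)] functional_onD(4)[OF f ab(2)] by simp_all
  hence "cmod (\<phi> a b + f b) \<le> K + L" by (rule norm_triangle_mono)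
  thus "cmod (form_of \<phi> f a b) \<le> K + L" using ab by (simp add: form_of_def)
qed

lemma form_ract_form_of:
  assumes \<phi>: "bilinear_on A K \<phi>" and s: "s \<in> A"
  shows "form_ract (form_of \<phi> f) s = form_of (\<lambda>a b. \<phi> (mul s a) b) (\<lambda>b. \<phi> s b)"
  using s by (auto simp: form_ract_def form_of_def fun_eq_iff mul_closed bilinear_on_zero_left[OF \<phi>]
      functional_onD(2)[OF bilinear_onD(3)[OF \<phi>]])

lemma form_lact_form_of:
  assumes \<phi>: "bilinear_on A K \<phi>" and s: "s \<in> A"
  shows "form_lact s (form_of \<phi> f)
    = form_of (\<lambda>a b. \<phi> a (mul b s) - \<phi> (mul a b) s) (\<lambda>b. f (mul b s) - \<phi> b s)"
  using s by (auto simp: form_lact_def form_of_def fun_eq_iff mul_closed bilinear_on_zero_left[OF \<phi>]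
      functional_onD(2)[OF bilinear_onD(3)[OF \<phi>]])

lemma form_of_cong:
  "(\<And>a b. a \<in> A \<Longrightarrow> b \<in> A \<Longrightarrow> \<phi> a b = \<phi>' a b) \<Longrightarrow> (\<And>b. b \<in> A \<Longrightarrow> f b = f' b) \<Longrightarrow>
    form_of \<phi> f = form_of \<phi>' f'"
  by (auto simp: form_of_def fun_eq_iff)

end

section \<open>Derivations into dual bimodules\<close>

locale derivation_into_dual = banach_bimodule A mul Z
  for A :: "'a::complex_banach set" and mul and Z :: "('a, 'z) bimodule" (structure) +
  fixes D :: "'a \<Rightarrow> 'z \<Rightarrow> complex"
  assumes D: "continuous_derivation A mul (dual_bimodule Z) D"
begin

lemma D_closed: "a \<in> A \<Longrightarrow> D a \<in> carrier (dual_bimodule Z)"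
  using D unfolding continuous_derivation_def by blast

lemma D_add: "a \<in> A \<Longrightarrow> b \<in> A \<Longrightarrow> z \<in> carrier Z \<Longrightarrow> D (a + b) z = D a z + D b z"
  and D_scaleC: "a \<in> A \<Longrightarrow> z \<in> carrier Z \<Longrightarrow> D (k *\<^sub>C a) z = k * D a z"
  and D_mul: "a \<in> A \<Longrightarrow> b \<in> A \<Longrightarrow> z \<in> carrier Z \<Longrightarrow> D (mul a b) z = D b (ract Z z a) + D a (lact Z b z)"
  using D unfolding continuous_derivation_def dual_simps(1-5) by auto

lemma D_module_add: "a \<in> A \<Longrightarrow> z \<in> carrier Z \<Longrightarrow> w \<in> carrier Z \<Longrightarrow> D a (z \<oplus> w) = D a z + D a w"
  and D_smult: "a \<in> A \<Longrightarrow> z \<in> carrier Z \<Longrightarrow> D a (k \<odot> z) = k * D a z"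
  using dual_carrierD(2,3)[OF D_closed] by blast+

text \<open>Continuity at \<open>0\<close> bounds \<open>D\<close> by \<open>1\<close> on a small ball; the rest is homogeneity.\<close>

lemma D_bounded: "\<exists>C\<ge>0. \<forall>a\<in>A. \<forall>z\<in>carrier Z. cmod (D a z) \<le> C * norm a * mnorm Z z"
proof -
  have D0: "D 0 z = 0" if "z \<in> carrier Z" for z
    using D_scaleC[OF A_zero that, of 0] by simp
  obtain d where d: "d > 0" and
    small: "\<And>b. b \<in> A \<Longrightarrow> dist b 0 < d \<Longrightarrow> mnorm (dual_bimodule Z) (D b \<ominus>\<^bsub>dual_bimodule Z\<^esub> D 0) < 1"
    using D A_zero zero_less_one unfolding continuous_derivation_def by meson
  have near: "cmod (D b z) \<le> mnorm Z z" if b: "b \<in> A" "norm b < d" and z: "z \<in> carrier Z" for b z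
  proof -
    have eq: "D b \<ominus>\<^bsub>dual_bimodule Z\<^esub> D 0 = D b"
      using dual_minus[OF D_closed[OF b(1)] D_closed[OF A_zero]] dual_carrierD(1)[OF D_closed[OF b(1)]] D0
      by (auto simp: fun_eq_iff extensional_def)
    have "mnorm (dual_bimodule Z) (D b) \<le> 1"
      using small[of b] b by (simp add: eq)
    hence "mnorm (dual_bimodule Z) (D b) * mnorm Z z \<le> 1 * mnorm Z z"
      using mnorm_nonneg[OF z] by (rule mult_right_mono)
    with dual_bound[OF D_closed[OF b(1)] z] show ?thesis by simp
  qed
  have "cmod (D a z) \<le> (2 / d) * norm a * mnorm Z z" if a: "a \<in> A" and z: "z \<in> carrier Z" for a z
  proof (cases "a = 0")
    case True
    then show ?thesis using D0[OF z] by simp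
  next
    case False
    define t where "t = d / (2 * norm a)"
    have t: "t > 0" using d False by (simp add: t_def)
    have "norm (complex_of_real t *\<^sub>C a) < d"
      using t d False by (simp add: norm_scaleC t_def norm_divide norm_mult)
    from near[OF A_scaleC[OF a] this z] have "t * cmod (D a z) \<le> mnorm Z z"
      using t by (simp add: D_scaleC a z norm_mult)
    thus ?thesis using t d False by (simp add: t_def field_simps)
  qed
  thus ?thesis using d by (intro exI[of _ "2 / d"]) simp
qed

end

locale operator_derivation = derivation_into_dual approximable ccompose Z D
  for Z :: "(('x::complex_banach, 'x) cblinfun, 'z) bimodule" (structure) and D
begin

sublocale dual_algebra: banach_algebra "approximable :: ('x cdual, 'x cdual) cblinfun set" ccompose
  by (rule banach_algebra_approximable)


definition derivation_bound :: real
  where "derivation_bound = (SOME C. C \<ge> 0 \<and>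
    (\<forall>a\<in>approximable. \<forall>z\<in>carrier Z. cmod (D a z) \<le> C * norm a * mnorm Z z))"

lemma derivation_bound: "0 \<le> derivation_bound" "a \<in> approximable \<Longrightarrow> z \<in> carrier Z \<Longrightarrow> cmod (D a z) \<le> derivation_bound * norm a * mnorm Z z"
  using someI_ex[OF D_bounded] unfolding derivation_bound_def by blast+

definition action_bound :: real
  where "action_bound = (SOME K. K \<ge> 0 \<and>
    (\<forall>a\<in>approximable. \<forall>z\<in>carrier Z. mnorm Z (lact Z a z) \<le> K * norm a * mnorm Z z))"

lemma action_bound: "0 \<le> action_bound" "a \<in> approximable \<Longrightarrow> z \<in> carrier Z \<Longrightarrow> mnorm Z (lact Z a z) \<le> action_bound * norm a * mnorm Z z"
proof -
  obtain K' where K': "\<forall>a\<in>approximable. \<forall>z\<in>carrier Z. mnorm Z (lact Z a z) \<le> K' * norm a * mnorm Z z"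
    using act_bounded by blast
  have "mnorm Z (lact Z a z) \<le> \<bar>K'\<bar> * norm a * mnorm Z z" if "a \<in> approximable" "z \<in> carrier Z" for a z
  proof -
    have "K' * norm a * mnorm Z z \<le> \<bar>K'\<bar> * norm a * mnorm Z z"
      using mnorm_nonneg[OF that(2)] by (intro mult_right_mono) simp_all
    with K' that show ?thesis by force
  qed
  hence "\<exists>K. K \<ge> 0 \<and>
      (\<forall>a\<in>approximable. \<forall>z\<in>carrier Z. mnorm Z (lact Z a z) \<le> K * norm a * mnorm Z z)"
    by (intro exI[of _ "\<bar>K'\<bar>"]) simp
  from someI_ex[OF this]
  show "0 \<le> action_bound" "a \<in> approximable \<Longrightarrow> z \<in> carrier Z \<Longrightarrow> mnorm Z (lact Z a z) \<le> action_bound * norm a * mnorm Z z"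
    unfolding action_bound_def by blast+
qed

text \<open>The form \<open>(a, b) \<mapsto> \<langle>D b, a z\<rangle>\<close> on \<open>B\<^sup>1 \<times> B\<close>, given by its restrictions to \<open>B \<times> B\<close> and to \<open>1 \<times> B\<close>.\<close>

definition bilinear_part :: "'z \<Rightarrow> ('x, 'x) cblinfun \<Rightarrow> ('x, 'x) cblinfun \<Rightarrow> complex"
  where "bilinear_part z a b = D b (lact Z a z)"

definition linear_part :: "'z \<Rightarrow> ('x, 'x) cblinfun \<Rightarrow> complex"
  where "linear_part z b = D b z"

lemma functional_on_linear_part:
  assumes z: "z \<in> carrier Z" shows "functional_on approximable (derivation_bound * mnorm Z z) (linear_part z)"
proof (rule functional_onI)
  show "0 \<le> derivation_bound * mnorm Z z" using derivation_bound(1) mnorm_nonneg[OF z] by simp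
  show "cmod (linear_part z a) \<le> derivation_bound * mnorm Z z * norm a" if "a \<in> approximable" for a
    using derivation_bound(2)[OF that z] by (simp add: linear_part_def ac_simps)
qed (simp_all add: linear_part_def D_add D_scaleC z)

lemma bilinear_on_bilinear_part:
  assumes z: "z \<in> carrier Z" shows "bilinear_on approximable (derivation_bound * action_bound * mnorm Z z) (bilinear_part z)"
  unfolding bilinear_on_def
proof (intro conjI ballI)
  show nonneg: "0 \<le> derivation_bound * action_bound * mnorm Z z" using derivation_bound(1) action_bound(1) mnorm_nonneg[OF z] by simp
  have bound: "cmod (bilinear_part z a b) \<le> derivation_bound * action_bound * mnorm Z z * norm a * norm b"
    if a: "a \<in> approximable" and b: "b \<in> approximable" for a b
  proof -
    have "cmod (bilinear_part z a b) \<le> derivation_bound * norm b * mnorm Z (lact Z a z)"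
      unfolding bilinear_part_def by (rule derivation_bound(2)[OF b lact_closed[OF a z]])
    also have "\<dots> \<le> derivation_bound * norm b * (action_bound * norm a * mnorm Z z)"
      using derivation_bound(1) by (intro mult_left_mono action_bound(2)[OF a z]) simp
    finally show ?thesis by (simp add: ac_simps)
  qed
  fix a :: "('x, 'x) cblinfun" assume a: "a \<in> approximable"
  show "functional_on approximable (derivation_bound * action_bound * mnorm Z z * norm a) (bilinear_part z a)"
    by (rule functional_onI) (use nonneg bound[OF a] in \<open>simp_all add: bilinear_part_def D_add D_scaleC lact_closed a z\<close>)
  show "functional_on approximable (derivation_bound * action_bound * mnorm Z z * norm a) (\<lambda>b. bilinear_part z b a)"
  proof (rule functional_onI)
    show "cmod (bilinear_part z b a) \<le> derivation_bound * action_bound * mnorm Z z * norm a * norm b" if "b \<in> approximable" for b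
      using bound[OF that a] by (simp add: ac_simps)
  qed (use nonneg in \<open>simp_all add: bilinear_part_def add_lact scaleC_lact D_module_add D_smult lact_closed a z\<close>)
qed

text \<open>The module actions on \<open>z\<close> turn into the two actions on forms over \<open>B\<close> with reversed product. For
  the right action this is the derivation rule for \<open>D (c b)\<close>.\<close>

lemma bilinear_part_lact: "c \<in> approximable \<Longrightarrow> z \<in> carrier Z \<Longrightarrow> a \<in> approximable \<Longrightarrow>
    bilinear_part (lact Z c z) a b = bilinear_part z (ccompose a c) b"
  and linear_part_lact: "linear_part (lact Z c z) b = bilinear_part z c b"
  by (simp_all add: bilinear_part_def linear_part_def lact_mul)

lemma bilinear_part_ract: "c \<in> approximable \<Longrightarrow> z \<in> carrier Z \<Longrightarrow> a \<in> approximable \<Longrightarrow> b \<in> approximable \<Longrightarrow>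
    bilinear_part z a (ccompose c b) = bilinear_part (ract Z z c) a b + bilinear_part z (ccompose b a) c"
  and linear_part_ract: "c \<in> approximable \<Longrightarrow> z \<in> carrier Z \<Longrightarrow> b \<in> approximable \<Longrightarrow>
    linear_part z (ccompose c b) = linear_part (ract Z z c) b + bilinear_part z b c"
  by (simp_all add: bilinear_part_def linear_part_def D_mul lact_mul lact_ract lact_closed ract_closed)

definition extended_form :: "'z \<Rightarrow> ('x cdual, 'x cdual) cblinfun \<Rightarrow> ('x cdual, 'x cdual) cblinfun \<Rightarrow> complex"
  where "extended_form z = dual_algebra.form_of (extension2 (bilinear_part z)) (extension (linear_part z))"

lemmas extended_bilinear_part = bilinear_on_extension2[OF bilinear_on_bilinear_part]
lemmas extended_linear_part = functional_on_extension[OF functional_on_linear_part]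

lemma extended_form_closed: "z \<in> carrier Z \<Longrightarrow> extended_form z \<in> dual_algebra.forms"
  unfolding extended_form_def by (rule dual_algebra.form_of_closed[OF extended_bilinear_part extended_linear_part])

lemma extended_form_norm:
  assumes "z \<in> carrier Z"
  shows "dual_algebra.form_norm (extended_form z) \<le> (4 * (derivation_bound * action_bound) + 2 * derivation_bound) * mnorm Z z"
  using dual_algebra.form_norm_form_of[OF extended_bilinear_part[OF assms] extended_linear_part[OF assms]]
  by (simp add: extended_form_def algebra_simps)

lemma extended_form_add:
  assumes z: "z \<in> carrier Z" and w: "w \<in> carrier Z"
  shows "extended_form (z \<oplus> w) = dual_algebra.form_add (extended_form z) (extended_form w)"
proof -
  have "extension2 (bilinear_part (z \<oplus> w)) = extension2 (\<lambda>a b. bilinear_part z a b + bilinear_part w a b)"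
    by (rule extension2_cong) (simp add: bilinear_part_def lact_add D_module_add lact_closed z w)
  moreover have "extension (linear_part (z \<oplus> w)) = extension (\<lambda>b. linear_part z b + linear_part w b)"
    by (rule extension_cong) (simp add: linear_part_def D_module_add z w rank_one_approximable)
  ultimately show ?thesis
    by (auto simp: extended_form_def dual_algebra.form_of_def dual_algebra.form_add_def fun_eq_iff
        extension2_add[OF bilinear_on_bilinear_part[OF z] bilinear_on_bilinear_part[OF w]]
        extension_add[OF functional_on_linear_part[OF z] functional_on_linear_part[OF w]])
qed

lemma extended_form_smult:
  assumes z: "z \<in> carrier Z"
  shows "extended_form (k \<odot> z) = dual_algebra.form_scale k (extended_form z)"
proof -
  have "extension2 (bilinear_part (k \<odot> z)) = extension2 (\<lambda>a b. k * bilinear_part z a b)"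
    by (rule extension2_cong) (simp add: bilinear_part_def lact_smult D_smult lact_closed z)
  moreover have "extension (linear_part (k \<odot> z)) = extension (\<lambda>b. k * linear_part z b)"
    by (rule extension_cong) (simp add: linear_part_def D_smult z rank_one_approximable)
  ultimately show ?thesis
    by (auto simp: extended_form_def dual_algebra.form_of_def dual_algebra.form_scale_def fun_eq_iff distrib_left
        extension2_mult[OF bilinear_on_bilinear_part[OF z]] extension_mult[OF functional_on_linear_part[OF z]])
qed

text \<open>If one argument is an adjoint, the extension in that variable is undone. These two facts account
  for the terms in which the actions on forms bring the unit or \<open>c\<close> into a slot.\<close>

lemma extension2_adjoint_left:
  assumes z: "z \<in> carrier Z" and c: "c \<in> approximable" and T: "T \<in> approximable"
  shows "extension2 (bilinear_part z) (adjoint_op c) T = extension (bilinear_part z c) T"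
  unfolding extension2_def
  by (rule extension_adjoint[OF functional_on_inner_extension[OF bilinear_on_bilinear_part[OF z] T] c])

lemma extension2_adjoint_right:
  assumes z: "z \<in> carrier Z" and c: "c \<in> approximable"
  shows "extension2 (bilinear_part z) S (adjoint_op c) = extension (\<lambda>a. bilinear_part z a c) S"
proof -
  have "extension (\<lambda>a. extension (bilinear_part z a) (adjoint_op c)) = extension (\<lambda>a. bilinear_part z a c)"
    by (rule extension_cong)
      (rule extension_adjoint[OF bilinear_onD(2)[OF bilinear_on_bilinear_part[OF z] rank_one_approximable] c])
  thus ?thesis by (simp add: extension2_def)
qed

lemma extended_form_lact:
  assumes z: "z \<in> carrier Z" and c: "c \<in> approximable"
  shows "extended_form (lact Z c z) = dual_algebra.form_ract (extended_form z) (adjoint_op c)"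
  unfolding extended_form_def dual_algebra.form_ract_form_of[OF extended_bilinear_part[OF z] adjoint_approximable[OF c]]
proof (rule dual_algebra.form_of_cong)
  fix S T :: "('x cdual, 'x cdual) cblinfun"
  assume T: "T \<in> approximable"
  have "extension (linear_part (lact Z c z)) = extension (bilinear_part z c)"
    by (rule extension_cong) (rule linear_part_lact)
  thus "extension (linear_part (lact Z c z)) T = extension2 (bilinear_part z) (adjoint_op c) T"
    by (simp add: extension2_adjoint_left[OF z c T])
  assume S: "S \<in> approximable"
  have "extension2 (bilinear_part (lact Z c z)) S T = extension2 (\<lambda>a. bilinear_part z (ccompose a c)) S T"
    by (rule fun_cong[OF fun_cong[OF extension2_cong]]) (rule bilinear_part_lact[OF c z])
  also have "\<dots> = extension2 (bilinear_part z) (ccompose (adjoint_op c) S) T"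
    unfolding extension2_def
    by (rule extension_ccompose_right[OF functional_on_inner_extension[OF bilinear_on_bilinear_part[OF z] T] c S])
  finally show "extension2 (bilinear_part (lact Z c z)) S T = extension2 (bilinear_part z) (ccompose (adjoint_op c) S) T" .
qed

text \<open>The relation \<open>\<langle>D (c b), a z\<rangle> = \<langle>D b, a z c\<rangle> + \<langle>D c, b a z\<rangle>\<close> extends term by term. The last term is a
  functional of the product \<open>b a\<close>, and extending it in both variables yields the product on \<open>A\<close> by
  \<open>extension_ccompose\<close>.\<close>

lemma extended_form_ract:
  assumes z: "z \<in> carrier Z" and c: "c \<in> approximable"
  shows "extended_form (ract Z z c) = dual_algebra.form_lact (adjoint_op c) (extended_form z)"
  unfolding extended_form_def dual_algebra.form_lact_form_of[OF extended_bilinear_part[OF z] adjoint_approximable[OF c]]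
proof (rule dual_algebra.form_of_cong)
  note zc = ract_closed[OF c z]
  note slice = bilinear_onD(3)[OF bilinear_on_bilinear_part[OF z] c]
  fix S T :: "('x cdual, 'x cdual) cblinfun"
  assume T: "T \<in> approximable"
  have "extension (linear_part z) (ccompose T (adjoint_op c)) = extension (\<lambda>b. linear_part z (ccompose c b)) T"
    by (rule extension_ccompose_left[OF functional_on_linear_part[OF z] c T, symmetric])
  also have "extension (\<lambda>b. linear_part z (ccompose c b)) = extension (\<lambda>b. linear_part (ract Z z c) b + bilinear_part z b c)"
    by (rule extension_cong) (rule linear_part_ract[OF c z rank_one_approximable])
  also have "\<dots> T = extension (linear_part (ract Z z c)) T + extension2 (bilinear_part z) T (adjoint_op c)"
    by (simp add: extension_add[OF functional_on_linear_part[OF zc] slice T] extension2_adjoint_right[OF z c])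
  finally show "extension (linear_part (ract Z z c)) T
      = extension (linear_part z) (ccompose T (adjoint_op c)) - extension2 (bilinear_part z) T (adjoint_op c)" by simp
  assume S: "S \<in> approximable"
  have bilinear: "bilinear_on approximable (derivation_bound * action_bound * mnorm Z z * norm c) (\<lambda>a b. bilinear_part z (ccompose b a) c)"
    using functional_onD(1)[OF slice] functional_on_ccompose_left[OF slice] functional_on_ccompose_right[OF slice]
    unfolding bilinear_on_def by blast
  have "extension (\<lambda>a. extension (\<lambda>b. bilinear_part z a (ccompose c b)) T)
      = extension (\<lambda>a. extension (bilinear_part z a) (ccompose T (adjoint_op c)))"
    by (rule extension_cong)
      (rule extension_ccompose_left[OF bilinear_onD(2)[OF bilinear_on_bilinear_part[OF z] rank_one_approximable] c T])
  hence "extension2 (bilinear_part z) S (ccompose T (adjoint_op c)) = extension2 (\<lambda>a b. bilinear_part z a (ccompose c b)) S T"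
    by (simp add: extension2_def)
  also have "\<dots> = extension2 (\<lambda>a b. bilinear_part (ract Z z c) a b + bilinear_part z (ccompose b a) c) S T"
    by (rule fun_cong[OF fun_cong[OF extension2_cong]]) (rule bilinear_part_ract[OF c z])
  also have "\<dots> = extension2 (bilinear_part (ract Z z c)) S T + extension2 (\<lambda>a b. bilinear_part z (ccompose b a) c) S T"
    by (rule extension2_add[OF bilinear_on_bilinear_part[OF zc] bilinear S T])
  also have "extension2 (\<lambda>a b. bilinear_part z (ccompose b a) c) S T = extension (\<lambda>a. bilinear_part z a c) (ccompose S T)"
    unfolding extension2_def by (rule extension_ccompose[OF slice S T])
  also have "\<dots> = extension2 (bilinear_part z) (ccompose S T) (adjoint_op c)"
    by (rule extension2_adjoint_right[OF z c, symmetric])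
  finally show "extension2 (bilinear_part (ract Z z c)) S T
      = extension2 (bilinear_part z) S (ccompose T (adjoint_op c)) - extension2 (bilinear_part z) (ccompose S T) (adjoint_op c)"
    by simp
qed

lemma extended_form_zero_adjoint:
  assumes z: "z \<in> carrier Z" and c: "c \<in> approximable"
  shows "extended_form z 0 (adjoint_op c) = D c z"
  using dual_algebra.bilinear_on_zero_left[OF extended_bilinear_part[OF z] adjoint_approximable[OF c]]
    adjoint_approximable[OF c]
  by (simp add: extended_form_def dual_algebra.form_of_def extension_adjoint[OF functional_on_linear_part[OF z] c]) (simp add: linear_part_def)

text \<open>The sign of \<open>\<eta>\<close> comes from the adjoint map reversing products: the left action on \<open>Z\<close> becomes the
  right action on forms.\<close>

lemma inner_derivation_if_dual_amenable:
  assumes "amenable TYPE(('x cdual, 'x cdual) cblinfun bimodule_universe)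
      (approximable :: ('x cdual, 'x cdual) cblinfun set) ccompose"
  shows "inner_derivation approximable (dual_bimodule Z) D"
proof -
  from dual_algebra.amenable_universal_splitting[OF assms] obtain M L where
    M_add: "\<And>G H. G \<in> dual_algebra.forms \<Longrightarrow> H \<in> dual_algebra.forms \<Longrightarrow> M (dual_algebra.form_add G H) = M G + M H"
    and M_scale: "\<And>k G. G \<in> dual_algebra.forms \<Longrightarrow> M (dual_algebra.form_scale k G) = k * M G"
    and M_bound: "\<And>G. G \<in> dual_algebra.forms \<Longrightarrow> cmod (M G) \<le> L * dual_algebra.form_norm G"
    and M_split: "\<And>G c. G \<in> dual_algebra.forms \<Longrightarrow> c \<in> approximable \<Longrightarrow>
      G 0 c = M (dual_algebra.form_ract G c) - M (dual_algebra.form_lact c G)"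
    by blast
  define \<eta> where "\<eta> = (\<lambda>z\<in>carrier Z. - M (extended_form z))"
  have \<eta>: "\<eta> \<in> carrier (dual_bimodule Z)"
  proof (rule dual_carrierI)
    show "\<eta> \<in> extensional (carrier Z)" by (simp add: \<eta>_def)
    fix z assume z: "z \<in> carrier Z"
    have "cmod (M (extended_form z)) \<le> \<bar>L\<bar> * dual_algebra.form_norm (extended_form z)"
      using M_bound[OF extended_form_closed[OF z]] dual_algebra.form_norm_nonneg[OF extended_form_closed[OF z]]
      by (meson abs_ge_self mult_right_mono order_trans)
    also have "\<dots> \<le> \<bar>L\<bar> * ((4 * (derivation_bound * action_bound) + 2 * derivation_bound) * mnorm Z z)"
      by (intro mult_left_mono extended_form_norm z) simp
    finally show "cmod (\<eta> z) \<le> (\<bar>L\<bar> * (4 * (derivation_bound * action_bound) + 2 * derivation_bound)) * mnorm Z z"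
      using z by (simp add: \<eta>_def mult.assoc)
    show "\<eta> (k \<odot> z) = k * \<eta> z" for k
      using z by (simp add: \<eta>_def extended_form_smult M_scale extended_form_closed smult_in_carrier)
    fix w assume "w \<in> carrier Z"
    thus "\<eta> (z \<oplus> w) = \<eta> z + \<eta> w"
      using z by (simp add: \<eta>_def extended_form_add M_add extended_form_closed)
  qed
  have "D c = lact (dual_bimodule Z) c \<eta> \<ominus>\<^bsub>dual_bimodule Z\<^esub> ract (dual_bimodule Z) \<eta> c"
    if c: "c \<in> approximable" for c
  proof (rule dual_eqI)
    show "D c \<in> carrier (dual_bimodule Z)" by (rule D_closed[OF c])
    interpret dual: abelian_group "dual_bimodule Z" by (rule abelian_group_dual)
    show "lact (dual_bimodule Z) c \<eta> \<ominus>\<^bsub>dual_bimodule Z\<^esub> ract (dual_bimodule Z) \<eta> c \<in> carrier (dual_bimodule Z)"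
      using dual_act_closed[OF \<eta> c] by simp
    fix z assume z: "z \<in> carrier Z"
    have "D c z = M (extended_form (lact Z c z)) - M (extended_form (ract Z z c))"
      using M_split[OF extended_form_closed[OF z] adjoint_approximable[OF c]]
      by (simp add: extended_form_zero_adjoint[OF z c] extended_form_lact[OF z c] extended_form_ract[OF z c])
    thus "D c z = (lact (dual_bimodule Z) c \<eta> \<ominus>\<^bsub>dual_bimodule Z\<^esub> ract (dual_bimodule Z) \<eta> c) z"
      using z by (simp add: dual_minus dual_act_closed[OF \<eta> c])
        (simp add: dual_simps \<eta>_def lact_closed[OF c z] ract_closed[OF c z])
  qed
  with \<eta> show ?thesis unfolding inner_derivation_def by blast
qed

end

theorem corollary5p3:
  assumes infinite_dimensional:
      "\<nexists>B :: 'x::complex_banach set. finite B \<and> complex_vector.span B = UNIV"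
    and amenable_dual:
      "amenable TYPE(('x cdual, 'x cdual) cblinfun bimodule_universe)
         (approximable :: ('x cdual, 'x cdual) cblinfun set) ccompose"
  shows "amenable TYPE('z) (approximable :: ('x, 'x) cblinfun set) ccompose"
  unfolding amenable_def
proof (intro conjI allI impI banach_algebra_approximable)
  fix Z :: "(('x, 'x) cblinfun, 'z) bimodule" and D
  assume "banach_bimodule approximable ccompose Z"
    and "continuous_derivation approximable ccompose (dual_bimodule Z) D"
  then interpret operator_derivation Z D
    by (simp add: operator_derivation_def derivation_into_dual_def derivation_into_dual_axioms_def)
  show "inner_derivation approximable (dual_bimodule Z) D"
    by (rule inner_derivation_if_dual_amenable[OF amenable_dual])
qed

end
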